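(* Let $X$ be an infinite-dimensional complex Banach space and $A\in L(X)$. The following conditions are equivalent: (i) $A$ is left generalized Drazin-Riesz invertible, i.e. there is $B\in L(X)$ such that $ABA=BA^2$, $B^2A=B$ and $A-ABA$ is Riesz; (ii) there exists $C\in L(X)$ such that $ACA=CA^2$, $C^2A=C=CAC$ and $A-ACA$ is Riesz; (iii) there exists $(M,N)\in Red(A)$ such that $A_M$ is left invertible and $A_N$ is Riesz; (iv) there exists a projector $P\in L(X)$ commuting with $A$ such that $A+P$ is left Browder and $AP$ is Riesz; (v) there exists a projector $P\in L(X)$ commuting with $A$ such that $A(I-P)+P$ is left Browder and $AP$ is Riesz; (vi) there exist $C,D,P\in L(X)$ such that $C$ is left Browder, $D$ is Riesz, $P$ is a projector commuting with $C$ and $D$, and $A=C(I-P)+DP$; (vii) $A$ is left Riesz-quasipolar; (viii) $A$ admits a GSRD and $0\notin \mathrm{int}\,\sigma_l(A)$; (ix) $A$ admits a GSRD and $A$ has the SVEP at $0$; (x) $A$ admits a GSRD and $0\notin \mathrm{acc}\,\sigma_{\mathcal B}^l(A)$; (xi) $A$ admits a GSRD and $0\notin \mathrm{int}\,\sigma_{\mathcal B}^l(A)$; (xii) $A$ admits a GSRD and $0\notin \mathrm{acc}\,\sigma_{D}^+(A)$; (xiii) $A$ admits a GSRD and $0\notin \mathrm{int}\,\sigma_{D}^+(A)$; (xiv) $A$ admits a GSRD and $0\notin \mathrm{int}\,\sigma_{p}(A)$.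
   Context: $L(X)$ is the algebra of bounded linear operators on $X$; $\mathcal N(A)$, $\mathcal R(A)$ denote null-space and range; a projector is an idempotent in $L(X)$. For $K\subset\mathbb C$, $\mathrm{int}\,K$ is its interior and $\mathrm{acc}\,K$ its set of accumulation points. The notions below are used for operators on any complex Banach space, in particular on closed invariant subspaces (possibly $\{0\}$). $(M,N)\in Red(A)$ means: $M,N$ are closed $A$-invariant subspaces with $X=M\oplus N$; $A_M:M\to M$, $A_N:N\to N$ are the restrictions of $A$. A subspace is complemented if it is closed and has a closed algebraic complement. The ascent is $a(A)=\inf\{n\ge 0: \mathcal N(A)\cap \mathcal R(A^n)=\{0\}\}$ ($\inf\emptyset=\infty$). $A$ is left Browder if $\dim\mathcal N(A)<\infty$, $a(A)<\infty$ and $\mathcal R(A)$ is complemented. $A$ is upper Drazin invertible if $a(A)<\infty$ and $\mathcal R(A^{a(A)+1})$ is closed. $A$ is Riesz if $\dim\mathcal N(A-\lambda I)<\infty$ and $\mathrm{codim}\,\mathcal R(A-\lambda I)<\infty$ for every nonzero $\lambda\in\mathbb C$. $A$ is Kato if $\mathcal R(A)$ is closed and $\mathcal N(A)\subset\mathcal R(A^n)$ for every $n\in\mathbb N$; $A$ is Saphar if it is Kato and $\mathcal N(A)$, $\mathcal R(A)$ are complemented. $A$ admits a GSRD (generalized Saphar-Riesz decomposition) if there is $(M,N)\in Red(A)$ such that $A_M$ is Saphar and $A_N$ is Riesz. $A$ is left Riesz-quasipolar if there is a projector $Q\in L(X)$ with $AQ=QA$, $A(I-Q)$ Riesz, and $Q\in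 L(X)A=\{TA:T\in L(X)\}$. $A$ has the SVEP at $\lambda_0$ if for every open disc $D_{\lambda_0}$ centered at $\lambda_0$ the only analytic $f:D_{\lambda_0}\to X$ with $(A-\lambda I)f(\lambda)=0$ for all $\lambda\in D_{\lambda_0}$ is $f\equiv0$. Spectra: $\sigma_l(A)$ (left spectrum), $\sigma_{\mathcal B}^l(A)$, $\sigma_D^+(A)$ are the sets of $\lambda\in\mathbb C$ such that $A-\lambda I$ is not left invertible, not left Browder, not upper Drazin invertible, respectively; $\sigma_p(A)$ is the point spectrum (set of eigenvalues). *)

theory Defs
  imports "HOL-Analysis.Analysis" "HOL-Library.Extended_Nat"
begin

section \<open>Complex Banach spaces\<close>

text \<open>The real structure inherited from the class \<open>banach\<close> is the one induced by the complex
  scalar multiplication.\<close>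

class complex_banach = banach +
  fixes scaleC :: "complex \<Rightarrow> 'a \<Rightarrow> 'a"  (infixr \<open>*\<^sub>C\<close> 75)
  assumes scaleC_add_right: "a *\<^sub>C (x + y) = a *\<^sub>C x + a *\<^sub>C y"
    and scaleC_add_left: "(a + b) *\<^sub>C x = a *\<^sub>C x + b *\<^sub>C x"
    and scaleC_scaleC: "a *\<^sub>C (b *\<^sub>C x) = (a * b) *\<^sub>C x"
    and scaleC_one: "1 *\<^sub>C x = x"
    and scaleR_scaleC: "r *\<^sub>R x = complex_of_real r *\<^sub>C x"
    and norm_scaleC: "norm (a *\<^sub>C x) = cmod a * norm x"

instantiation complex :: complex_banach
begin

definition scaleC_complex :: "complex \<Rightarrow> complex \<Rightarrow> complex"
  where "scaleC_complex a x = a * x"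

instance
  by standard (auto simp: scaleC_complex_def algebra_simps norm_mult scaleR_conv_of_real)

end

interpretation complex_vector: vector_space "scaleC :: complex \<Rightarrow> 'a \<Rightarrow> 'a::complex_banach"
  by standard (auto simp: scaleC_add_right scaleC_add_left scaleC_scaleC scaleC_one)


section \<open>Subspaces\<close>

text \<open>Finite-dimensionality is not expressed through \<open>complex_vector.dim\<close>, which is \<open>0\<close> on
  infinite-dimensional spaces.\<close>

definition finite_dim :: "'a::complex_banach set \<Rightarrow> bool"
  where "finite_dim V \<longleftrightarrow> (\<exists>B. finite B \<and> V = complex_vector.span B)"

text \<open>\<open>codim V < \<infinity>\<close> in \<open>E\<close>: the quotient \<open>E / V\<close> is spanned by the classes of finitely many
  vectors.\<close>

definition finite_codim :: "'a::complex_banach set \<Rightarrow> 'a set \<Rightarrow> bool"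
  where "finite_codim E V \<longleftrightarrow>
    (\<exists>B. finite B \<and> B \<subseteq> E \<and> (\<forall>x\<in>E. \<exists>y\<in>complex_vector.span B. x - y \<in> V))"

definition direct_sum :: "'a::complex_banach set \<Rightarrow> 'a set \<Rightarrow> 'a set \<Rightarrow> bool"
  where "direct_sum E V W \<longleftrightarrow>
    complex_vector.subspace V \<and> complex_vector.subspace W \<and>
    V \<inter> W = {0} \<and> E = {v + w | v w. v \<in> V \<and> w \<in> W}"

definition complemented :: "'a::complex_banach set \<Rightarrow> 'a set \<Rightarrow> bool"
  where "complemented E V \<longleftrightarrow> closed V \<and> (\<exists>W. closed W \<and> direct_sum E V W)"


section \<open>Operators on a closed subspace\<close>

text \<open>The notions that are also needed for restrictions of an operator take as first argument
  \<open>E\<close> the space acted on, a closed subspace of the ambient type (\<open>UNIV\<close> for operators on the whole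
  space). An element of \<open>L(E)\<close> is represented by a function on the ambient type of which only the
  values on \<open>E\<close> matter; so if \<open>M\<close> is invariant under \<open>A\<close>, the restriction of \<open>A\<close> to \<open>M\<close> is
  represented by \<open>A\<close> itself, considered on the space \<open>M\<close>.\<close>

definition bounded_ops :: "'a::complex_banach set \<Rightarrow> ('a \<Rightarrow> 'a) set"
  where "bounded_ops E = {T. (\<forall>x\<in>E. T x \<in> E) \<and>
    (\<forall>x\<in>E. \<forall>y\<in>E. T (x + y) = T x + T y) \<and>
    (\<forall>c. \<forall>x\<in>E. T (c *\<^sub>C x) = c *\<^sub>C T x) \<and>
    (\<exists>K. \<forall>x\<in>E. norm (T x) \<le> norm x * K)}"

lemma bounded_ops_UNIV_iff:
  "T \<in> bounded_ops UNIV \<longleftrightarrow> bounded_linear T \<and> (\<forall>c x. T (c *\<^sub>C x) = c *\<^sub>C T x)"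
  by (auto simp: bounded_ops_def bounded_linear_def bounded_linear_axioms_def linear_iff
      scaleR_scaleC)

definition null_space :: "'a::complex_banach set \<Rightarrow> ('a \<Rightarrow> 'a) \<Rightarrow> 'a set"
  where "null_space E A = {x\<in>E. A x = 0}"

definition shift :: "('a::complex_banach \<Rightarrow> 'a) \<Rightarrow> complex \<Rightarrow> 'a \<Rightarrow> 'a"
  where "shift A c = (\<lambda>x. A x - c *\<^sub>C x)"

definition left_invertible :: "'a::complex_banach set \<Rightarrow> ('a \<Rightarrow> 'a) \<Rightarrow> bool"
  where "left_invertible E A \<longleftrightarrow> (\<exists>B\<in>bounded_ops E. \<forall>x\<in>E. B (A x) = x)"

definition ascent :: "'a::complex_banach set \<Rightarrow> ('a \<Rightarrow> 'a) \<Rightarrow> enat"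
  where "ascent E A = Inf {enat n | n. null_space E A \<inter> (A ^^ n) ` E = {0}}"

definition left_Browder :: "'a::complex_banach set \<Rightarrow> ('a \<Rightarrow> 'a) \<Rightarrow> bool"
  where "left_Browder E A \<longleftrightarrow>
    finite_dim (null_space E A) \<and> ascent E A < \<infinity> \<and> complemented E (A ` E)"

definition upper_Drazin_invertible :: "'a::complex_banach set \<Rightarrow> ('a \<Rightarrow> 'a) \<Rightarrow> bool"
  where "upper_Drazin_invertible E A \<longleftrightarrow>
    ascent E A < \<infinity> \<and> closed ((A ^^ (the_enat (ascent E A) + 1)) ` E)"

definition Riesz :: "'a::complex_banach set \<Rightarrow> ('a \<Rightarrow> 'a) \<Rightarrow> bool"
  where "Riesz E A \<longleftrightarrow> (\<forall>c. c \<noteq> 0 \<longrightarrow>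
    finite_dim (null_space E (shift A c)) \<and> finite_codim E (shift A c ` E))"

definition Kato :: "'a::complex_banach set \<Rightarrow> ('a \<Rightarrow> 'a) \<Rightarrow> bool"
  where "Kato E A \<longleftrightarrow> closed (A ` E) \<and> (\<forall>n. null_space E A \<subseteq> (A ^^ n) ` E)"

definition Saphar :: "'a::complex_banach set \<Rightarrow> ('a \<Rightarrow> 'a) \<Rightarrow> bool"
  where "Saphar E A \<longleftrightarrow>
    Kato E A \<and> complemented E (null_space E A) \<and> complemented E (A ` E)"


section \<open>Operators on the whole space\<close>

definition projector :: "('a::complex_banach \<Rightarrow> 'a) \<Rightarrow> bool"
  where "projector P \<longleftrightarrow> P \<in> bounded_ops UNIV \<and> P \<circ> P = P"

definition Red :: "('a::complex_banach \<Rightarrow> 'a) \<Rightarrow> ('a set \<times> 'a set) set"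
  where "Red A = {(M, N). closed M \<and> closed N \<and> A ` M \<subseteq> M \<and> A ` N \<subseteq> N \<and>
    direct_sum UNIV M N}"

definition admits_GSRD :: "('a::complex_banach \<Rightarrow> 'a) \<Rightarrow> bool"
  where "admits_GSRD A \<longleftrightarrow> (\<exists>(M, N)\<in>Red A. Saphar M A \<and> Riesz N A)"

definition left_Riesz_quasipolar :: "('a::complex_banach \<Rightarrow> 'a) \<Rightarrow> bool"
  where "left_Riesz_quasipolar A \<longleftrightarrow> (\<exists>Q. projector Q \<and> A \<circ> Q = Q \<circ> A \<and>
    Riesz UNIV (A \<circ> (\<lambda>x. x - Q x)) \<and> Q \<in> {T \<circ> A | T. T \<in> bounded_ops UNIV})"

definition left_gen_Drazin_Riesz_invertible :: "('a::complex_banach \<Rightarrow> 'a) \<Rightarrow> bool"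
  where "left_gen_Drazin_Riesz_invertible A \<longleftrightarrow> (\<exists>B\<in>bounded_ops UNIV.
    A \<circ> B \<circ> A = B \<circ> (A ^^ 2) \<and> (B ^^ 2) \<circ> A = B \<and> Riesz UNIV (\<lambda>x. A x - (A \<circ> B \<circ> A) x))"

text \<open>The library's \<open>holomorphic_on\<close> and \<open>analytic_on\<close> cover scalar-valued functions only. As
  there, analyticity on an open set is complex differentiability at every point.\<close>

definition vector_analytic_on :: "(complex \<Rightarrow> 'a::complex_banach) \<Rightarrow> complex set \<Rightarrow> bool"
  where "vector_analytic_on f D \<longleftrightarrow> (\<forall>z\<in>D. \<exists>v. (f has_derivative (\<lambda>h. h *\<^sub>C v)) (at z))"

definition SVEP_at :: "('a::complex_banach \<Rightarrow> 'a) \<Rightarrow> complex \<Rightarrow> bool"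
  where "SVEP_at A z0 \<longleftrightarrow> (\<forall>r>0. \<forall>f. vector_analytic_on f (ball z0 r) \<and>
    (\<forall>z\<in>ball z0 r. shift A z (f z) = 0) \<longrightarrow> (\<forall>z\<in>ball z0 r. f z = 0))"

definition left_spectrum :: "('a::complex_banach \<Rightarrow> 'a) \<Rightarrow> complex set"
  where "left_spectrum A = {c. \<not> left_invertible UNIV (shift A c)}"

definition left_Browder_spectrum :: "('a::complex_banach \<Rightarrow> 'a) \<Rightarrow> complex set"
  where "left_Browder_spectrum A = {c. \<not> left_Browder UNIV (shift A c)}"

definition upper_Drazin_spectrum :: "('a::complex_banach \<Rightarrow> 'a) \<Rightarrow> complex set"
  where "upper_Drazin_spectrum A = {c. \<not> upper_Drazin_invertible UNIV (shift A c)}"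

definition point_spectrum :: "('a::complex_banach \<Rightarrow> 'a) \<Rightarrow> complex set"
  where "point_spectrum A = {c. \<exists>x. x \<noteq> 0 \<and> A x = c *\<^sub>C x}"

definition all_equivalent :: "bool list \<Rightarrow> bool"
  where "all_equivalent ps \<longleftrightarrow> (\<forall>p\<in>set ps. \<forall>q\<in>set ps. p \<longleftrightarrow> q)"

end

theory Submission
  imports Defs "HOL-Complex_Analysis.Conformal_Mappings"
begin

text \<open>
  Every condition says that \<open>X\<close> splits into a reducing pair \<open>(M, N)\<close> such that \<open>A\<close> is left
  invertible on \<open>M\<close> and Riesz on \<open>N\<close>; all of them are compared with this one condition,
  \<open>left_invertible_Riesz_splitting\<close>.

  \<^emph>\<open>Generalized inverses.\<close> The equations for \<open>B\<close> make \<open>Q = BA\<close> an idempotent that commutes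
  with \<open>A\<close>. Its range is \<open>M\<close>, where \<open>QB\<close> inverts \<open>A\<close> from the left, and its kernel is \<open>N\<close>, because
  \<open>A - ABA = A(I - Q)\<close>. In the other direction \<open>C\<close> is the left inverse of \<open>A\<close> on \<open>M\<close> composed with the
  projection onto \<open>M\<close> along \<open>N\<close>.

  \<^emph>\<open>Left Browder operators.\<close> If \<open>P\<close> projects onto \<open>N\<close> along \<open>M\<close>, then \<open>A + P\<close> is \<open>A + I\<close> on \<open>N\<close>,
  a Fredholm operator whose ascent is finite because \<open>A\<close> is Riesz there (\<open>Riesz_finite_ascent\<close>).
  Conversely a left Browder operator is left invertible up to a direct summand of finite dimension
  (\<open>left_Browder_decomposition\<close>). On that summand every operator is Riesz, so it can be
  moved into \<open>N\<close>.

  \<^emph>\<open>Spectra.\<close> Left invertibility survives small perturbations, and \<open>A - \<lambda>\<close> is Fredholm of finite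
  ascent on \<open>N\<close> for all \<open>\<lambda> \<noteq> 0\<close>; so the left Browder spectrum misses a punctured disc around
  \<open>0\<close>. The other spectral conditions follow from this one, because left Browder operators are upper
  Drazin invertible and an upper Drazin invertible \<open>S\<close> has only injective \<open>S - \<mu>\<close> for small
  \<open>\<mu> \<noteq> 0\<close> (\<open>upper_Drazin_punctured_injective\<close>). Conversely let \<open>A\<close> be Saphar on \<open>M\<close> without
  being left invertible. Then it has a kernel vector \<open>x\<^sub>0 \<in> M\<close>. The Kato property yields a
  backward orbit \<open>A x\<^sub>n\<^sub>+\<^sub>1 = x\<^sub>n\<close> of geometric growth, and \<open>\<Sum>n. \<mu>\<^sup>n x\<^sub>n\<close> is an analytic family of
  eigenvectors for all small \<open>\<mu>\<close> (\<open>Kato_eigenvectors\<close>). This family refutes the SVEP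
  and puts a disc around \<open>0\<close> into each of the spectra.

  The same two facts prove \<open>Riesz_finite_ascent\<close> without index theory: the \<open>\<lambda> \<noteq> 0\<close> with finite
  ascent of \<open>A - \<lambda>\<close> form an open set, and so do those with infinite ascent; the punctured plane is
  connected, and the first set contains all large \<open>\<lambda>\<close>.

  Two theorems on Banach spaces carry the analysis. The open mapping theorem bounds the inverses
  and projections that algebra provides. The Hahn-Banach theorem yields functionals that separate
  points from closed subspaces; they split off Jordan chains, show that subspaces of finite
  dimension are closed, and reduce the identity theorem for vector-valued functions to scalar ones.
\<close>

section \<open>The open mapping theorem\<close>

text \<open>By Baire's theorem the closure of the image of some ball contains a ball of the range
  around a point \<open>y0\<close>. Subtracting \<open>y0\<close> recentres it at the origin at the price of doubling the
  radius, and scaling turns this into approximate preimages, with controlled norm, of all points of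
  the range.\<close>
lemma open_mapping_approx:
  fixes T :: "'a::banach \<Rightarrow> 'b::banach"
  assumes E: "subspace E"
    and add: "\<And>x y. x \<in> E \<Longrightarrow> y \<in> E \<Longrightarrow> T (x + y) = T x + T y"
    and scale: "\<And>c x. x \<in> E \<Longrightarrow> T (c *\<^sub>R x) = c *\<^sub>R T x"
    and img: "closed (T ` E)"
  obtains C where "C > 0" "\<And>y. y \<in> T ` E \<Longrightarrow> \<exists>x\<in>E. norm (y - T x) \<le> norm y / 2 \<and> norm x \<le> C * norm y"
proof -
  define F where "F = T ` E"
  define G where "G n = closure (T ` (E \<inter> cball 0 (real n)))" for n
  have diff: "T (x - y) = T x - T y" if "x \<in> E" "y \<in> E" for x y
    using add[of x "- y"] scale[of y "-1"] that E by (simp add: subspace_neg)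
  have T0: "T 0 = 0" using scale[of 0 0] E by (simp add: subspace_0)
  have F0: "0 \<in> F" unfolding F_def using T0 E subspace_0 by (metis imageI)
  have Fadd: "u + v \<in> F" if "u \<in> F" "v \<in> F" for u v
    using that add subspace_add[OF E] unfolding F_def by (metis (no_types, lifting) image_iff)
  have Fscale: "c *\<^sub>R u \<in> F" if "u \<in> F" for u c
    using that scale subspace_scale[OF E] unfolding F_def by (metis (no_types, lifting) image_iff)
  have GF: "G n \<subseteq> F" for n
    unfolding G_def F_def by (rule closure_minimal) (use img in auto)
  have cov: "F = (\<Union>n. G n)"
  proof
    show "F \<subseteq> (\<Union>n. G n)"
    proof
      fix y assume "y \<in> F"
      then obtain x where x: "x \<in> E" "y = T x" unfolding F_def by auto
      obtain n where "norm x \<le> real n" using real_arch_simple by blast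
      then have "y \<in> T ` (E \<inter> cball 0 (real n))" using x by auto
      then have "y \<in> G n" unfolding G_def by (rule subsetD[OF closure_subset])
      then show "y \<in> (\<Union>n. G n)" by blast
    qed
  qed (use GF in auto)
  have "\<exists>n. top_of_set F interior_of G n \<noteq> {}"
  proof (rule ccontr)
    assume "\<not> ?thesis"
    then have "\<And>n. top_of_set F interior_of G n = {}" by auto
    moreover have "closedin (top_of_set F) (G n)" for n
      using GF[of n] unfolding G_def by (simp add: closed_subset)
    ultimately have "top_of_set F interior_of (\<Union>(range G)) = {}"
      by (intro Baire_category_alt disjI1 completely_metrizable_space_closedin
            completely_metrizable_space_euclidean) (use img in \<open>auto simp: F_def\<close>)
    then have "top_of_set F interior_of F = {}" using cov by simp
    moreover have "top_of_set F interior_of F = F"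
      using interior_of_topspace[of "top_of_set F"] by simp
    ultimately show False using F0 by auto
  qed
  then obtain n y0 where "y0 \<in> top_of_set F interior_of G n" by blast
  then obtain U where U: "openin (top_of_set F) U" "y0 \<in> U" "U \<subseteq> G n"
    unfolding interior_of_def by auto
  then obtain e where e: "e > 0" "y0 \<in> F" "ball y0 e \<inter> F \<subseteq> G n"
    unfolding openin_contains_ball by (meson subset_iff order_trans)
  have small: "\<exists>x\<in>E. norm (y - T x) < d \<and> norm x \<le> 2 * real n"
    if y: "y \<in> F" "norm y < e" and d: "d > 0" for y d
  proof -
    have "y0 + y \<in> G n" using e y Fadd by (intro subsetD[OF e(3)]) (auto simp: dist_norm)
    then obtain u where u: "u \<in> E" "norm u \<le> real n" "dist (T u) (y0 + y) < d / 2"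
      using d unfolding G_def closure_approachable by (auto dest!: spec[of _ "d / 2"])
    have "y0 \<in> G n" using e by auto
    then obtain v where v: "v \<in> E" "norm v \<le> real n" "dist (T v) y0 < d / 2"
      using d unfolding G_def closure_approachable by (auto dest!: spec[of _ "d / 2"])
    have eq: "y - T (u - v) = (T v - y0) - (T u - (y0 + y))"
      using diff u v by simp
    have "norm (y - T (u - v)) \<le> norm (T v - y0) + norm (T u - (y0 + y))"
      unfolding eq by (rule norm_triangle_ineq4)
    then have "norm (y - T (u - v)) < d"
      using u(3) v(3) unfolding dist_norm by linarith
    moreover have "norm (u - v) \<le> 2 * real n"
      using u(2) v(2) norm_triangle_ineq4[of u v] by simp
    ultimately show ?thesis using u v E subspace_diff by blast
  qed
  show thesis
  proof
    show "4 * (real n + 1) / e > 0" using e by simp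
    fix y assume y: "y \<in> T ` E"
    show "\<exists>x\<in>E. norm (y - T x) \<le> norm y / 2 \<and> norm x \<le> 4 * (real n + 1) / e * norm y"
    proof (cases "y = 0")
      case True
      then show ?thesis using T0 E subspace_0 by (intro bexI[of _ 0]) auto
    next
      case False
      \<comment> \<open>the factor that scales \<open>y\<close> into the ball of radius \<open>e\<close>\<close>
      define c where "c = e / (2 * norm y)"
      have c: "c > 0" using e False c_def by simp
      have "norm (c *\<^sub>R y) < e" using e False c by (simp add: c_def)
      then obtain x where x: "x \<in> E" "norm (c *\<^sub>R y - T x) < c * norm y / 2" "norm x \<le> 2 * real n"
        using small[of "c *\<^sub>R y" "c * norm y / 2"] y Fscale c False unfolding F_def by auto
      have "y - T ((1/c) *\<^sub>R x) = (1/c) *\<^sub>R (c *\<^sub>R y - T x)"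
        using c x scale by (simp add: algebra_simps)
      then have "norm (y - T ((1/c) *\<^sub>R x)) = norm (c *\<^sub>R y - T x) / c"
        using c by simp
      also have "\<dots> \<le> norm y / 2" using x(2) c by (simp add: field_simps)
      finally have 1: "norm (y - T ((1/c) *\<^sub>R x)) \<le> norm y / 2" .
      have "norm ((1/c) *\<^sub>R x) = norm x / c" using c by simp
      also have "\<dots> \<le> 2 * (real n + 1) / c" using x(3) c by (intro divide_right_mono) auto
      also have "\<dots> = 4 * (real n + 1) / e * norm y" unfolding c_def using e by simp
      finally show ?thesis using 1 x(1) E subspace_scale by blast
    qed
  qed
qed

text \<open>Approximate preimages become exact ones by approximating the remainder again and again: the
  remainders decrease like \<open>(1/2)\<^sup>n\<close>, so the corrections form a convergent series.\<close>
theorem open_mapping_closed_image: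
  fixes T :: "'a::banach \<Rightarrow> 'b::banach"
  assumes E: "subspace E" "closed E"
    and add: "\<And>x y. x \<in> E \<Longrightarrow> y \<in> E \<Longrightarrow> T (x + y) = T x + T y"
    and scale: "\<And>c x. x \<in> E \<Longrightarrow> T (c *\<^sub>R x) = c *\<^sub>R T x"
    and bound: "\<And>x. x \<in> E \<Longrightarrow> norm (T x) \<le> norm x * K"
    and img: "closed (T ` E)"
  obtains C where "C > 0" "\<And>y. y \<in> T ` E \<Longrightarrow> \<exists>x\<in>E. T x = y \<and> norm x \<le> C * norm y"
proof -
  obtain C where C: "C > 0"
    and ex: "\<And>y. y \<in> T ` E \<Longrightarrow> \<exists>x\<in>E. norm (y - T x) \<le> norm y / 2 \<and> norm x \<le> C * norm y"
    using open_mapping_approx[OF E(1) add scale img] by blast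
  have diff: "T (x - y) = T x - T y" if "x \<in> E" "y \<in> E" for x y
    using add[of x "- y"] scale[of y "-1"] that E by (simp add: subspace_neg)
  have T0: "T 0 = 0" using scale[of 0 0] E by (simp add: subspace_0)
  show thesis
  proof
    show "2 * C > 0" using C by simp
    fix y assume y: "y \<in> T ` E"
    obtain s where s: "\<And>y. y \<in> T ` E \<Longrightarrow> s y \<in> E \<and> norm (y - T (s y)) \<le> norm y / 2 \<and> norm (s y) \<le> C * norm y"
      using ex by metis
    \<comment> \<open>\<open>r n\<close> is what is left of \<open>y\<close> after \<open>n\<close> corrections\<close>
    define r where "r n = ((\<lambda>y. y - T (s y)) ^^ n) y" for n
    have r0: "r 0 = y" and rS: "r (Suc n) = r n - T (s (r n))" for n
      by (simp_all add: r_def)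
    have rin: "r n \<in> T ` E" for n
    proof (induction n)
      case (Suc n)
      then obtain x where x: "x \<in> E" "r n = T x" by auto
      have sE: "s (r n) \<in> E" using s Suc by auto
      have "r (Suc n) = T (x - s (r n))" using x sE diff rS by auto
      then show ?case using x sE E subspace_diff by auto
    qed (simp add: r0 y)
    have rn: "norm (r n) \<le> norm y * (1/2) ^ n" for n
    proof (induction n)
      case (Suc n)
      have "norm (r (Suc n)) \<le> norm (r n) / 2" using s rin rS by auto
      then show ?case using Suc by simp
    qed (simp add: r0)
    have xE: "s (r n) \<in> E" for n using s rin by auto
    have xb: "norm (s (r n)) \<le> C * norm y * (1/2) ^ n" for n
    proof -
      have "norm (s (r n)) \<le> C * norm (r n)" using s rin by auto
      also have "\<dots> \<le> C * (norm y * (1/2) ^ n)" using rn C by (intro mult_left_mono) auto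
      finally show ?thesis by simp
    qed
    have geo: "(\<lambda>n. C * norm y * (1/2) ^ n) sums (C * norm y * 2)"
      using sums_mult[OF geometric_sums[of "1/2 :: real"], of "C * norm y"] by simp
    have sumn: "summable (\<lambda>n. norm (s (r n)))"
      by (rule summable_comparison_test'[of "\<lambda>n. C * norm y * (1/2) ^ n" 0])
        (use xb sums_summable[OF geo] in auto)
    then have sums: "summable (\<lambda>n. s (r n))" by (rule summable_norm_cancel)
    define x where "x = (\<Sum>n. s (r n))"
    have lim: "(\<lambda>n. \<Sum>i<n. s (r i)) \<longlonglongrightarrow> x"
      unfolding x_def using sums by (rule summable_LIMSEQ)
    have partE: "(\<Sum>i<n. s (r i)) \<in> E" for n
      using E xE by (intro subspace_sum) auto
    have x: "x \<in> E"
      using closed_sequentially[OF E(2) _ lim] partE by auto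
    have Tpart: "T (\<Sum>i<n. s (r i)) = y - r n" for n
    proof (induction n)
      case (Suc n)
      then show ?case using add[OF partE xE, of n n] rS[of n] by simp
    qed (simp add: r0 T0)
    have "(\<lambda>n. r n) \<longlonglongrightarrow> 0"
    proof (rule Lim_null_comparison)
      show "(\<lambda>n. norm y * (1/2) ^ n) \<longlonglongrightarrow> 0"
        using tendsto_mult_right_zero[OF LIMSEQ_realpow_zero[of "1/2"]] by simp
    qed (use rn in auto)
    then have l1: "(\<lambda>n. T (\<Sum>i<n. s (r i))) \<longlonglongrightarrow> y"
      unfolding Tpart using tendsto_diff[OF tendsto_const, of r 0 sequentially y] by simp
    have l2: "(\<lambda>n. T (\<Sum>i<n. s (r i))) \<longlonglongrightarrow> T x"
    proof (rule LIM_zero_cancel, rule Lim_null_comparison)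
      show "\<forall>\<^sub>F n in sequentially. norm (T (\<Sum>i<n. s (r i)) - T x) \<le> norm ((\<Sum>i<n. s (r i)) - x) * K"
        using bound[OF subspace_diff[OF E(1) partE x]] diff[OF partE x] by simp
      show "(\<lambda>n. norm ((\<Sum>i<n. s (r i)) - x) * K) \<longlonglongrightarrow> 0"
        using tendsto_mult_left_zero[OF tendsto_norm_zero[OF LIM_zero[OF lim]]] by simp
    qed
    have "T x = y" using LIMSEQ_unique[OF l2 l1] .
    moreover have "norm x \<le> 2 * C * norm y"
    proof -
      have "norm x \<le> (\<Sum>n. norm (s (r n)))" unfolding x_def by (rule summable_norm[OF sumn])
      also have "\<dots> \<le> (\<Sum>n. C * norm y * (1/2) ^ n)"
        by (rule suminf_le[OF xb sumn sums_summable[OF geo]])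
      also have "\<dots> = C * norm y * 2" using sums_unique[OF geo] by simp
      finally show ?thesis by simp
    qed
    ultimately show "\<exists>x\<in>E. T x = y \<and> norm x \<le> 2 * C * norm y" using x by blast
  qed
qed

section \<open>The Hahn-Banach theorem\<close>

text \<open>Functionals are represented by their graphs \<open>g\<close>. This is the one-dimensional extension step:
  \<open>c\<close> is an admissible value at the new vector \<open>z\<close>. It exists because the triangle inequality puts
  every lower bound for it, \<open>r - \<parallel>x - z\<parallel>\<close>, below every upper bound, \<open>\<parallel>x + z\<parallel> - r\<close>.\<close>
lemma norm_extension_step:
  fixes g :: "('a::real_normed_vector \<times> real) set"
  assumes g: "subspace g" and le: "\<And>x r. (x, r) \<in> g \<Longrightarrow> r \<le> norm x"
  obtains c where "\<And>x r t. (x, r) \<in> g \<Longrightarrow> r + t * c \<le> norm (x + t *\<^sub>R z)"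
proof -
  define c where "c = (SUP (x, r)\<in>g. r - norm (x - z))"
  have key: "r - norm (x - z) \<le> norm (x' + z) - r'" if "(x, r) \<in> g" "(x', r') \<in> g" for x r x' r'
  proof -
    have "(x + x', r + r') \<in> g" using subspace_add[OF g that] by simp
    then have "r + r' \<le> norm (x + x')" by (rule le)
    also have "\<dots> \<le> norm (x - z) + norm (x' + z)"
      using norm_triangle_ineq[of "x - z" "x' + z"] by simp
    finally show ?thesis by simp
  qed
  have zero: "(0, 0) \<in> g" using subspace_0[OF g] by (simp add: zero_prod_def)
  have bdd: "bdd_above ((\<lambda>(x, r). r - norm (x - z)) ` g)"
    by (rule bdd_aboveI[of _ "norm (0 + z) - 0"]) (use key[OF _ zero] in auto)
  have lo: "r - norm (x - z) \<le> c" if "(x, r) \<in> g" for x r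
    unfolding c_def using cSUP_upper[OF that bdd] by simp
  have hi: "c \<le> norm (x + z) - r" if "(x, r) \<in> g" for x r
    unfolding c_def by (rule cSUP_least) (use zero key[OF _ that] in auto)
  have "r + t * c \<le> norm (x + t *\<^sub>R z)" if xr: "(x, r) \<in> g" for x r t
  proof -
    have inv: "((1/s) *\<^sub>R x, r / s) \<in> g" for s
      using subspace_scale[OF g xr, of "1/s"] by simp
    consider "t = 0" | "t > 0" | "t < 0" by linarith
    then show ?thesis
    proof cases
      case 1
      then show ?thesis using le[OF xr] by simp
    next
      case 2
      have "c \<le> norm ((1/t) *\<^sub>R x + z) - r / t" by (rule hi[OF inv])
      then have "t * c \<le> t * norm ((1/t) *\<^sub>R x + z) - r" using 2 by (simp add: field_simps)
      also have "t * norm ((1/t) *\<^sub>R x + z) = norm (t *\<^sub>R ((1/t) *\<^sub>R x + z))" using 2 by simp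
      also have "\<dots> = norm (x + t *\<^sub>R z)" using 2 by (simp add: algebra_simps)
      finally show ?thesis by simp
    next
      case 3
      define s where "s = - t"
      have s: "s > 0" "t = - s" using 3 s_def by auto
      have "r / s - norm ((1/s) *\<^sub>R x - z) \<le> c" by (rule lo[OF inv])
      then have "r - s * norm ((1/s) *\<^sub>R x - z) \<le> s * c" using s by (simp add: field_simps)
      moreover have "s * norm ((1/s) *\<^sub>R x - z) = norm (s *\<^sub>R ((1/s) *\<^sub>R x - z))" using s by simp
      moreover have "\<dots> = norm (x + t *\<^sub>R z)" using s by (simp add: algebra_simps)
      moreover have "t * c = - (s * c)" unfolding s(2) by simp
      ultimately show ?thesis by linarith
    qed
  qed
  then show thesis using that by blast
qed

text \<open>Zorn's lemma applied to graphs. Nothing needs to be said about single-valuedness: a linear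
  subspace of pairs whose second component is dominated by the norm of the first one contains no
  \<open>(0, r)\<close> with \<open>r \<noteq> 0\<close>.\<close>
theorem Hahn_Banach_norm:
  fixes g0 :: "('a::real_normed_vector \<times> real) set"
  assumes g0: "subspace g0" and le0: "\<And>x r. (x, r) \<in> g0 \<Longrightarrow> r \<le> norm x"
  obtains f where "linear f" "\<And>x. f x \<le> norm x" "\<And>x r. (x, r) \<in> g0 \<Longrightarrow> f x = r"
proof -
  define \<G> where "\<G> = {g. subspace g \<and> g0 \<subseteq> g \<and> (\<forall>(x, r)\<in>g. r \<le> norm x)}"
  have "\<exists>M\<in>\<G>. \<forall>X\<in>\<G>. M \<subseteq> X \<longrightarrow> X = M"
  proof (rule subset_Zorn)
    fix C assume C: "subset.chain \<G> C"
    show "\<exists>U\<in>\<G>. \<forall>X\<in>C. X \<subseteq> U"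
    proof (cases "C = {}")
      case True
      then show ?thesis using g0 le0 unfolding \<G>_def by (intro bexI[of _ g0]) auto
    next
      case False
      have sub: "C \<subseteq> \<G>" and tot: "\<And>X Y. X \<in> C \<Longrightarrow> Y \<in> C \<Longrightarrow> X \<subseteq> Y \<or> Y \<subseteq> X"
        using C unfolding subset_chain_def by auto
      have sp: "subspace X" if "X \<in> C" for X using that sub unfolding \<G>_def by auto
      have "subspace (\<Union>C)"
      proof (rule subspaceI)
        show "0 \<in> \<Union>C" using False sp subspace_0 by blast
        fix x y assume "x \<in> \<Union>C" "y \<in> \<Union>C"
        then obtain X Y where "X \<in> C" "Y \<in> C" "x \<in> X" "y \<in> Y" by auto
        then obtain Z where "Z \<in> C" "x \<in> Z" "y \<in> Z" using tot by blast
        then show "x + y \<in> \<Union>C" using sp subspace_add by blast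
      next
        fix c x assume "x \<in> \<Union>C"
        then show "c *\<^sub>R x \<in> \<Union>C" using sp subspace_scale by blast
      qed
      then have "\<Union>C \<in> \<G>" using False sub unfolding \<G>_def by blast
      then show ?thesis by blast
    qed
  qed
  then obtain g where g: "g \<in> \<G>" and mx: "\<And>X. X \<in> \<G> \<Longrightarrow> g \<subseteq> X \<Longrightarrow> X = g" by auto
  have sg: "subspace g" and g0g: "g0 \<subseteq> g" and le: "\<And>x r. (x, r) \<in> g \<Longrightarrow> r \<le> norm x"
    using g unfolding \<G>_def by auto
  have uniq: "r = r'" if "(x, r) \<in> g" "(x, r') \<in> g" for x r r'
    using le[of 0 "r - r'"] le[of 0 "r' - r"] subspace_diff[OF sg that] subspace_diff[OF sg that(2,1)]
    by simp
  have total: "\<exists>r. (z, r) \<in> g" for z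
  proof -
    obtain c where c: "\<And>x r t. (x, r) \<in> g \<Longrightarrow> r + t * c \<le> norm (x + t *\<^sub>R z)"
      using norm_extension_step[OF sg le] by blast
    define h where "h = {u + v | u v. u \<in> g \<and> v \<in> span {(z, c)}}"
    have "subspace h" unfolding h_def by (intro subspace_sums sg subspace_span)
    moreover have gh: "g \<subseteq> h"
    proof
      fix w assume "w \<in> g"
      then have "w + 0 \<in> h" unfolding h_def using span_zero by blast
      then show "w \<in> h" by simp
    qed
    moreover have "r \<le> norm x" if "(x, r) \<in> h" for x r
      using that c unfolding h_def span_singleton by auto
    ultimately have "h \<in> \<G>" using g0g unfolding \<G>_def by auto
    then have "h = g" using mx gh by blast
    moreover have "0 + (z, c) \<in> h"
      unfolding h_def using subspace_0[OF sg] span_base[of "(z, c)" "{(z, c)}"] by blast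
    ultimately show ?thesis by (metis add_0)
  qed
  define f where "f x = (THE r. (x, r) \<in> g)" for x
  have f: "(x, f x) \<in> g" for x
    unfolding f_def using total[of x] uniq by (metis theI)
  have feq: "f x = r" if "(x, r) \<in> g" for x r using uniq[OF f that] .
  have "linear f"
  proof (rule linearI)
    show "f (x + y) = f x + f y" for x y using subspace_add[OF sg f f] by (auto intro: feq)
    show "f (c *\<^sub>R x) = c *\<^sub>R f x" for c x using subspace_scale[OF sg f] by (auto intro: feq)
  qed
  then show thesis using that le[OF f] feq g0g by blast
qed


lemma real_subspace: "complex_vector.subspace V \<Longrightarrow> subspace V"
  for V :: "'a::complex_banach set"
  unfolding subspace_def complex_vector.subspace_def by (auto simp: scaleR_scaleC)

text \<open>If the ball of radius \<open>d\<close> around \<open>e\<close> misses \<open>V\<close>, the real functional \<open>v + c e \<mapsto> d Re c\<close> is dominated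
  by the norm. An extension \<open>f\<close> of it to the whole space is the real part of a complex linear
  functional, \<open>x \<mapsto> f x - \<i> f (\<i> x)\<close>, which takes the value \<open>d\<close> at \<open>e\<close>.\<close>
theorem Hahn_Banach_separation:
  fixes V :: "'a::complex_banach set"
  assumes V: "complex_vector.subspace V" "closed V" and e: "e \<notin> V"
  obtains \<phi> :: "'a \<Rightarrow> complex"
  where "bounded_linear \<phi>" "\<And>c x. \<phi> (c *\<^sub>C x) = c * \<phi> x" "\<And>v. v \<in> V \<Longrightarrow> \<phi> v = 0" "\<phi> e = 1"
proof -
  obtain d where d: "d > 0" "ball e d \<subseteq> - V"
    using V(2) e by (metis ComplI open_Compl open_contains_ball)
  have dist: "cmod c * d \<le> norm (v + c *\<^sub>C e)" if v: "v \<in> V" for v c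
  proof (cases "c = 0")
    case False
    have "(- 1 / c) *\<^sub>C v \<in> V" using V(1) v by (rule complex_vector.subspace_scale)
    then have "d \<le> norm (e - (- 1 / c) *\<^sub>C v)" using d(2) by (force simp: dist_norm)
    then have "cmod c * d \<le> cmod c * norm (e - (- 1 / c) *\<^sub>C v)" by (rule mult_left_mono) simp
    also have "\<dots> = norm (c *\<^sub>C (e - (- 1 / c) *\<^sub>C v))" by (rule norm_scaleC[symmetric])
    also have "c *\<^sub>C (e - (- 1 / c) *\<^sub>C v) = v + c *\<^sub>C e"
      using False by (simp add: scaleC_add_right)
    finally show ?thesis .
  qed simp
  define g0 where "g0 = {(v + c *\<^sub>C e, Re c * d) | v c. v \<in> V}"
  have g0I: "(v + c *\<^sub>C e, Re c * d) \<in> g0" if "v \<in> V" for v c using that unfolding g0_def by blast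
  have "subspace g0"
  proof (rule subspaceI)
    show "0 \<in> g0" using g0I[of 0 0] complex_vector.subspace_0[OF V(1)] by (simp add: zero_prod_def)
  next
    fix x y assume "x \<in> g0" "y \<in> g0"
    then obtain v c w b where x: "x = (v + c *\<^sub>C e, Re c * d)" "v \<in> V"
      and y: "y = (w + b *\<^sub>C e, Re b * d)" "w \<in> V" unfolding g0_def by blast
    have "x + y = ((v + w) + (c + b) *\<^sub>C e, Re (c + b) * d)"
      unfolding x y by (simp add: scaleC_add_left algebra_simps)
    then show "x + y \<in> g0" using g0I complex_vector.subspace_add[OF V(1) x(2) y(2)] by metis
  next
    fix r x assume "x \<in> g0"
    then obtain v c where x: "x = (v + c *\<^sub>C e, Re c * d)" "v \<in> V" unfolding g0_def by blast
    have "r *\<^sub>R x = (complex_of_real r *\<^sub>C v + (complex_of_real r * c) *\<^sub>C e, Re (complex_of_real r * c) * d)"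
      unfolding x by (simp add: scaleR_scaleC scaleC_add_right scaleC_scaleC)
    then show "r *\<^sub>R x \<in> g0" using g0I complex_vector.subspace_scale[OF V(1) x(2)] by metis
  qed
  moreover have "r \<le> norm x" if xr: "(x, r) \<in> g0" for x r
  proof -
    obtain v c where x: "x = v + c *\<^sub>C e" "r = Re c * d" "v \<in> V" using xr unfolding g0_def by blast
    have "Re c * d \<le> cmod c * d" using d(1) complex_Re_le_cmod by (intro mult_right_mono) auto
    then show ?thesis using dist[OF x(3), of c] x by simp
  qed
  ultimately obtain f where f: "linear f" "\<And>x. f x \<le> norm x" "\<And>x r. (x, r) \<in> g0 \<Longrightarrow> f x = r"
    using Hahn_Banach_norm by blast
  have fabs: "\<bar>f x\<bar> \<le> norm x" for x
    using f(2)[of x] f(2)[of "- x"] linear_neg[OF f(1)] by simp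
  have fval: "f (v + c *\<^sub>C e) = Re c * d" if "v \<in> V" for v c using f(3) g0I that by blast
  define \<phi> where "\<phi> x = Complex (f x / d) (- f (\<i> *\<^sub>C x) / d)" for x
  have fcomb: "f (c *\<^sub>C x) = Re c * f x + Im c * f (\<i> *\<^sub>C x)" for c x
  proof -
    have "c *\<^sub>C x = (complex_of_real (Re c) + complex_of_real (Im c) * \<i>) *\<^sub>C x"
      by (metis complex_eq mult.commute)
    also have "\<dots> = Re c *\<^sub>R x + Im c *\<^sub>R (\<i> *\<^sub>C x)"
      by (simp add: scaleC_add_left scaleR_scaleC scaleC_scaleC)
    finally show ?thesis by (simp add: linear_add[OF f(1)] linear_scale[OF f(1)])
  qed
  have scale: "\<phi> (c *\<^sub>C x) = c * \<phi> x" for c x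
  proof -
    have "f (\<i> *\<^sub>C c *\<^sub>C x) = - Im c * f x + Re c * f (\<i> *\<^sub>C x)"
      using fcomb[of "\<i> * c" x] by (simp add: scaleC_scaleC)
    then show ?thesis
      using fcomb[of c x] d(1) unfolding \<phi>_def by (simp add: complex_eq_iff field_simps)
  qed
  have "bounded_linear \<phi>"
  proof (rule bounded_linear_intro)
    show "\<phi> (x + y) = \<phi> x + \<phi> y" for x y
      unfolding \<phi>_def by (simp add: linear_add[OF f(1)] scaleC_add_right complex_eq_iff add_divide_distrib diff_divide_distrib)
    show "\<phi> (r *\<^sub>R x) = r *\<^sub>R \<phi> x" for r x
      unfolding scaleR_scaleC scale by (simp add: scaleC_complex_def)
    show "norm (\<phi> x) \<le> norm x * (2 / d)" for x
    proof -
      have "norm (\<phi> x) \<le> \<bar>f x / d\<bar> + \<bar>- f (\<i> *\<^sub>C x) / d\<bar>"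
        using cmod_le[of "\<phi> x"] unfolding \<phi>_def by simp
      also have "\<dots> = (\<bar>f x\<bar> + \<bar>f (\<i> *\<^sub>C x)\<bar>) / d" using d(1) by (simp add: add_divide_distrib)
      also have "\<dots> \<le> (norm x + norm x) / d"
        using d(1) fabs[of x] fabs[of "\<i> *\<^sub>C x"] by (intro divide_right_mono add_mono) (auto simp: norm_scaleC)
      finally show ?thesis by (simp add: mult.commute)
    qed
  qed
  moreover have "\<phi> v = 0" if "v \<in> V" for v
    using fval[OF that, of 0] fval[OF complex_vector.subspace_scale[OF V(1) that], of \<i> 0]
    unfolding \<phi>_def by (simp add: complex_eq_iff)
  moreover have "\<phi> e = 1"
    using fval[of 0 1] fval[of 0 \<i>] complex_vector.subspace_0[OF V(1)] d(1)
    unfolding \<phi>_def by (simp add: complex_eq_iff scaleC_one)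
  ultimately show thesis using that scale by blast
qed

section \<open>Bounded operators on a closed subspace\<close>

lemma bounded_linear_scaleC_left: "bounded_linear (\<lambda>c. c *\<^sub>C (x :: 'a::complex_banach))"
  by (rule bounded_linear_intro[of _ "norm x"])
    (simp_all add: scaleC_add_left norm_scaleC scaleR_conv_of_real scaleR_scaleC)

lemma bounded_linear_scaleC_right: "bounded_linear (\<lambda>x :: 'a::complex_banach. c *\<^sub>C x)"
  by (rule bounded_linear_intro[of _ "cmod c"])
    (simp_all add: scaleC_add_right norm_scaleC scaleR_scaleC mult.commute)

definition closed_subspace :: "'a::complex_banach set \<Rightarrow> bool"
  where "closed_subspace E \<longleftrightarrow> closed E \<and> complex_vector.subspace E"

lemma closed_subspaceD:
  assumes "closed_subspace E"
  shows "closed E" "complex_vector.subspace E" "subspace E" "0 \<in> E"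
    "\<And>x y. x \<in> E \<Longrightarrow> y \<in> E \<Longrightarrow> x + y \<in> E" "\<And>x y. x \<in> E \<Longrightarrow> y \<in> E \<Longrightarrow> x - y \<in> E"
    "\<And>c x. x \<in> E \<Longrightarrow> c *\<^sub>C x \<in> E" "\<And>x. x \<in> E \<Longrightarrow> - x \<in> E"
  using assms unfolding closed_subspace_def
  by (simp_all add: real_subspace complex_vector.subspace_0 complex_vector.subspace_add
    complex_vector.subspace_diff complex_vector.subspace_scale complex_vector.subspace_neg)

lemma closed_subspace_UNIV [simp]: "closed_subspace UNIV"
  and closed_subspace_zero [simp]: "closed_subspace {0}"
  unfolding closed_subspace_def by auto

lemma closed_subspace_Int: "closed_subspace E \<Longrightarrow> closed_subspace F \<Longrightarrow> closed_subspace (E \<inter> F)"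
  unfolding closed_subspace_def by (auto intro: complex_vector.subspace_inter)

lemma bounded_opsD:
  assumes "T \<in> bounded_ops E"
  shows "\<And>x. x \<in> E \<Longrightarrow> T x \<in> E" "\<And>x y. x \<in> E \<Longrightarrow> y \<in> E \<Longrightarrow> T (x + y) = T x + T y"
    "\<And>c x. x \<in> E \<Longrightarrow> T (c *\<^sub>C x) = c *\<^sub>C T x"
  using assms unfolding bounded_ops_def by auto

lemma bounded_ops_bound:
  assumes "T \<in> bounded_ops E"
  obtains K where "K > 0" "\<And>x. x \<in> E \<Longrightarrow> norm (T x) \<le> K * norm x"
proof -
  obtain K where K: "\<And>x. x \<in> E \<Longrightarrow> norm (T x) \<le> norm x * K"
    using assms unfolding bounded_ops_def by blast
  show thesis
  proof (rule that[of "\<bar>K\<bar> + 1"])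
    fix x assume "x \<in> E"
    then have "norm (T x) \<le> norm x * K" by (rule K)
    also have "\<dots> \<le> norm x * (\<bar>K\<bar> + 1)" by (intro mult_left_mono) auto
    finally show "norm (T x) \<le> (\<bar>K\<bar> + 1) * norm x" by (simp add: mult.commute)
  qed simp
qed

lemma bounded_opsI:
  assumes "\<And>x. x \<in> E \<Longrightarrow> T x \<in> E" "\<And>x y. x \<in> E \<Longrightarrow> y \<in> E \<Longrightarrow> T (x + y) = T x + T y"
    "\<And>c x. x \<in> E \<Longrightarrow> T (c *\<^sub>C x) = c *\<^sub>C T x" "\<And>x. x \<in> E \<Longrightarrow> norm (T x) \<le> K * norm x"
  shows "T \<in> bounded_ops E"
  using assms unfolding bounded_ops_def by (auto simp: mult.commute intro!: exI[of _ K])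

lemma bounded_ops_zero:
  assumes "T \<in> bounded_ops E" "0 \<in> E" shows "T 0 = 0"
  using bounded_opsD(3)[OF assms, of 0] by simp

lemma bounded_ops_minus:
  assumes "T \<in> bounded_ops E" "x \<in> E" shows "T (- x) = - T x"
  using bounded_opsD(3)[OF assms, of "-1"] by simp

lemma bounded_ops_diff:
  assumes "T \<in> bounded_ops E" "complex_vector.subspace E" "x \<in> E" "y \<in> E"
  shows "T (x - y) = T x - T y"
  using bounded_opsD(2)[OF assms(1,3), of "- y"] bounded_ops_minus[OF assms(1,4)]
    complex_vector.subspace_neg[OF assms(2,4)] by simp

lemma bounded_ops_real_scale:
  assumes "T \<in> bounded_ops E" "x \<in> E" shows "T (c *\<^sub>R x) = c *\<^sub>R T x"
  using bounded_opsD(3)[OF assms] by (simp add: scaleR_scaleC)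

lemma bounded_ops_restrict:
  assumes "T \<in> bounded_ops E" "M \<subseteq> E" "\<And>x. x \<in> M \<Longrightarrow> T x \<in> M" shows "T \<in> bounded_ops M"
proof -
  obtain K where "\<And>x. x \<in> E \<Longrightarrow> norm (T x) \<le> K * norm x" using bounded_ops_bound[OF assms(1)] by blast
  then show ?thesis
    using assms(2,3) bounded_opsD(2,3)[OF assms(1)] by (intro bounded_opsI[where K = K]) (blast | simp)+
qed

lemma bounded_ops_id: "(\<lambda>x. x) \<in> bounded_ops E"
  by (rule bounded_opsI[where K = 1]) auto

lemma bounded_ops_comp_subspace:
  assumes S: "S \<in> bounded_ops F" and T: "T \<in> bounded_ops E" "\<And>x. x \<in> E \<Longrightarrow> T x \<in> F" and F: "F \<subseteq> E"
  shows "(\<lambda>x. S (T x)) \<in> bounded_ops E"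
proof -
  obtain K where K: "K > 0" "\<And>x. x \<in> F \<Longrightarrow> norm (S x) \<le> K * norm x" using bounded_ops_bound[OF S] by blast
  obtain L where L: "L > 0" "\<And>x. x \<in> E \<Longrightarrow> norm (T x) \<le> L * norm x" using bounded_ops_bound[OF T(1)] by blast
  show ?thesis
  proof (rule bounded_opsI[where K = "K * L"])
    fix x assume x: "x \<in> E"
    have "norm (S (T x)) \<le> K * norm (T x)" by (rule K(2)[OF T(2)[OF x]])
    also have "\<dots> \<le> K * (L * norm x)" using K(1) L(2)[OF x] by (intro mult_left_mono) auto
    finally show "norm (S (T x)) \<le> K * L * norm x" by simp
    show "S (T x) \<in> E" using bounded_opsD(1)[OF S T(2)[OF x]] F by blast
  qed (use bounded_opsD[OF S] bounded_opsD[OF T(1)] T(2) in auto)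
qed

lemma bounded_ops_comp:
  assumes "S \<in> bounded_ops E" "T \<in> bounded_ops E" shows "(\<lambda>x. S (T x)) \<in> bounded_ops E"
  by (rule bounded_ops_comp_subspace[OF assms bounded_opsD(1)[OF assms(2)] order_refl])

lemma bounded_ops_add:
  assumes "S \<in> bounded_ops E" "T \<in> bounded_ops E" "complex_vector.subspace E"
  shows "(\<lambda>x. S x + T x) \<in> bounded_ops E"
proof -
  obtain K where K: "K > 0" "\<And>x. x \<in> E \<Longrightarrow> norm (S x) \<le> K * norm x" using bounded_ops_bound[OF assms(1)] by blast
  obtain L where L: "L > 0" "\<And>x. x \<in> E \<Longrightarrow> norm (T x) \<le> L * norm x" using bounded_ops_bound[OF assms(2)] by blast
  show ?thesis
  proof (rule bounded_opsI[where K = "K + L"])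
    fix x assume x: "x \<in> E"
    show "norm (S x + T x) \<le> (K + L) * norm x"
      using norm_triangle_ineq[of "S x" "T x"] K(2)[OF x] L(2)[OF x] by (simp add: distrib_right)
  qed (use bounded_opsD[OF assms(1)] bounded_opsD[OF assms(2)] complex_vector.subspace_add[OF assms(3)]
      in \<open>auto simp: scaleC_add_right\<close>)
qed

lemma bounded_ops_scale:
  assumes "T \<in> bounded_ops E" "complex_vector.subspace E"
  shows "(\<lambda>x. c *\<^sub>C T x) \<in> bounded_ops E"
proof -
  obtain L where L: "L > 0" "\<And>x. x \<in> E \<Longrightarrow> norm (T x) \<le> L * norm x" using bounded_ops_bound[OF assms(1)] by blast
  show ?thesis
  proof (rule bounded_opsI[where K = "cmod c * L"])
    fix x assume x: "x \<in> E"
    show "norm (c *\<^sub>C T x) \<le> cmod c * L * norm x"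
      using mult_left_mono[OF L(2)[OF x], of "cmod c"] by (simp add: norm_scaleC)
  qed (use bounded_opsD[OF assms(1)] complex_vector.subspace_scale[OF assms(2)]
      in \<open>auto simp: scaleC_add_right mult.commute\<close>)
qed

lemma bounded_ops_minus_op:
  assumes "S \<in> bounded_ops E" "T \<in> bounded_ops E" "complex_vector.subspace E"
  shows "(\<lambda>x. S x - T x) \<in> bounded_ops E"
  using bounded_ops_add[OF assms(1) bounded_ops_scale[OF assms(2,3), of "-1"] assms(3)] by simp

lemma bounded_ops_shift:
  assumes "T \<in> bounded_ops E" "complex_vector.subspace E" shows "shift T c \<in> bounded_ops E"
  unfolding shift_def by (intro bounded_ops_minus_op assms bounded_ops_scale bounded_ops_id)

lemma bounded_ops_funpow:
  assumes "T \<in> bounded_ops E" shows "T ^^ n \<in> bounded_ops E"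
proof (induction n)
  case 0
  then show ?case using bounded_ops_id by (simp add: id_def)
next
  case (Suc n)
  then show ?case using bounded_ops_comp[OF assms Suc] by (simp add: comp_def)
qed

lemma bounded_ops_continuous:
  assumes "T \<in> bounded_ops E" "complex_vector.subspace E" shows "continuous_on E T"
proof -
  obtain K where K: "K > 0" "\<And>x. x \<in> E \<Longrightarrow> norm (T x) \<le> K * norm x" using bounded_ops_bound[OF assms(1)] by blast
  show ?thesis
  proof (rule continuous_onI)
    fix x e assume x: "x \<in> E" and e: "(0::real) < e"
    show "\<exists>d>0. \<forall>x'\<in>E. dist x' x < d \<longrightarrow> dist (T x') (T x) \<le> e"
    proof (intro exI[of _ "e / K"] conjI ballI impI)
      fix x' assume x': "x' \<in> E" "dist x' x < e / K"
      have "dist (T x') (T x) = norm (T (x' - x))"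
        using bounded_ops_diff[OF assms x'(1) x] by (simp add: dist_norm)
      also have "\<dots> \<le> K * norm (x' - x)" using K(2) x x' complex_vector.subspace_diff[OF assms(2)] by blast
      also have "\<dots> \<le> e" using x'(2) K(1) by (simp add: dist_norm field_simps)
      finally show "dist (T x') (T x) \<le> e" .
    qed (use K e in auto)
  qed
qed

lemma closed_subspace_preimage:
  assumes T: "T \<in> bounded_ops E" and E: "closed_subspace E" and V: "closed_subspace V"
  shows "closed_subspace {x \<in> E. T x \<in> V}"
proof -
  have "closed {x \<in> E. T x \<in> V}"
    using continuous_closed_preimage[OF bounded_ops_continuous[OF T closed_subspaceD(2)[OF E]]
        closed_subspaceD(1)[OF E] closed_subspaceD(1)[OF V]]
    by (simp add: vimage_def Int_def)
  moreover have "complex_vector.subspace {x \<in> E. T x \<in> V}"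
    using closed_subspaceD[OF E] closed_subspaceD[OF V] bounded_opsD[OF T] bounded_ops_zero[OF T]
    by (intro complex_vector.subspaceI) auto
  ultimately show ?thesis unfolding closed_subspace_def by blast
qed

lemma closed_subspace_null_space:
  assumes "T \<in> bounded_ops E" "closed_subspace E" shows "closed_subspace (null_space E T)"
  using closed_subspace_preimage[OF assms closed_subspace_zero] unfolding null_space_def by simp

lemma subspace_range:
  assumes T: "T \<in> bounded_ops E" and F: "complex_vector.subspace F" "F \<subseteq> E"
  shows "complex_vector.subspace (T ` F)"
proof (rule complex_vector.subspaceI)
  show "0 \<in> T ` F" using bounded_ops_zero[OF T] complex_vector.subspace_0[OF F(1)] F(2) by force
  show "x + y \<in> T ` F" if "x \<in> T ` F" "y \<in> T ` F" for x y
    using that bounded_opsD(2)[OF T] F(2) complex_vector.subspace_add[OF F(1)]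
    by clarsimp (metis imageI subsetD)
  show "c *\<^sub>C x \<in> T ` F" if "x \<in> T ` F" for c x
    using that bounded_opsD(3)[OF T] F(2) complex_vector.subspace_scale[OF F(1)]
    by clarsimp (metis imageI subsetD)
qed

lemma range_open_mapping:
  assumes T: "T \<in> bounded_ops E" and F: "closed_subspace F" "F \<subseteq> E" and cl: "closed (T ` F)"
  obtains C where "C > 0" "\<And>y. y \<in> T ` F \<Longrightarrow> \<exists>x\<in>F. T x = y \<and> norm x \<le> C * norm y"
proof -
  obtain K where K: "K > 0" "\<And>x. x \<in> E \<Longrightarrow> norm (T x) \<le> K * norm x" using bounded_ops_bound[OF T] by blast
  show thesis
  proof (rule open_mapping_closed_image[of F T K])
    show "subspace F" "closed F" using closed_subspaceD[OF F(1)] by auto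
    show "T (x + y) = T x + T y" if "x \<in> F" "y \<in> F" for x y
      using bounded_opsD(2)[OF T] that F(2) by blast
    show "T (c *\<^sub>R x) = c *\<^sub>R T x" if "x \<in> F" for c x
      using bounded_ops_real_scale[OF T] that F(2) by blast
    show "norm (T x) \<le> norm x * K" if "x \<in> F" for x
      using K(2)[of x] that F(2) by (auto simp: mult.commute)
  qed (use that cl in auto)
qed

section \<open>Direct sums and projections\<close>

lemma direct_sumD:
  assumes "direct_sum E M N"
  shows "M \<subseteq> E" "N \<subseteq> E" "M \<inter> N = {0}" "complex_vector.subspace M" "complex_vector.subspace N"
    "\<And>x. x \<in> E \<Longrightarrow> \<exists>m\<in>M. \<exists>n\<in>N. x = m + n" "\<And>m n. m \<in> M \<Longrightarrow> n \<in> N \<Longrightarrow> m + n \<in> E"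
proof -
  show M: "complex_vector.subspace M" and N: "complex_vector.subspace N" and "M \<inter> N = {0}"
    and ex: "\<And>x. x \<in> E \<Longrightarrow> \<exists>m\<in>M. \<exists>n\<in>N. x = m + n" and sum: "\<And>m n. m \<in> M \<Longrightarrow> n \<in> N \<Longrightarrow> m + n \<in> E"
    using assms unfolding direct_sum_def by auto
  show "M \<subseteq> E" using sum[OF _ complex_vector.subspace_0[OF N]] by auto
  show "N \<subseteq> E" using sum[OF complex_vector.subspace_0[OF M]] by auto
qed

lemma direct_sumI:
  assumes "complex_vector.subspace M" "complex_vector.subspace N" "M \<inter> N \<subseteq> {0}"
    "\<And>x. x \<in> E \<Longrightarrow> \<exists>m\<in>M. \<exists>n\<in>N. x = m + n" "\<And>m n. m \<in> M \<Longrightarrow> n \<in> N \<Longrightarrow> m + n \<in> E"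
  shows "direct_sum E M N"
  using assms complex_vector.subspace_0[OF assms(1)] complex_vector.subspace_0[OF assms(2)]
  unfolding direct_sum_def by blast

lemma direct_sum_unique:
  assumes "direct_sum E M N" "m \<in> M" "m' \<in> M" "n \<in> N" "n' \<in> N" "m + n = m' + n'"
  shows "m = m' \<and> n = n'"
proof -
  have eq: "m - m' = n' - n" using assms(6) by (simp add: algebra_simps)
  have "m - m' \<in> M" "n' - n \<in> N"
    using assms(2-5) direct_sumD(4,5)[OF assms(1)] complex_vector.subspace_diff by blast+
  then have "m - m' \<in> M \<inter> N" using eq by simp
  then have "m - m' = 0" unfolding direct_sumD(3)[OF assms(1)] by simp
  then show ?thesis using eq by simp
qed

lemma direct_sum_commute: "direct_sum E M N \<Longrightarrow> direct_sum E N M"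
  unfolding direct_sum_def by (auto; metis add.commute)

lemma direct_sum_assoc:
  assumes ds: "direct_sum E M N" and ds': "direct_sum M K W"
  shows "direct_sum E K {n + w | n w. n \<in> N \<and> w \<in> W}" (is "direct_sum E K ?V")
    and "direct_sum {n + w | n w. n \<in> N \<and> w \<in> W} N W"
proof -
  note D = direct_sumD[OF ds] and D' = direct_sumD[OF ds']
  have VI: "n + w \<in> ?V" if "n \<in> N" "w \<in> W" for n w using that by blast
  show "direct_sum E K ?V"
  proof (rule direct_sumI)
    show "complex_vector.subspace K" by (rule D'(4))
    show "complex_vector.subspace ?V" by (rule complex_vector.subspace_sums[OF D(5) D'(5)])
    show "K \<inter> ?V \<subseteq> {0}"
    proof
      fix v assume v: "v \<in> K \<inter> ?V"
      then obtain n w where nw: "n \<in> N" "w \<in> W" "v = n + w" by blast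
      have "v \<in> M" "w \<in> M" using v nw(2) D'(1,2) by blast+
      then have "v = w \<and> 0 = n"
        using direct_sum_unique[OF ds, of v w 0 n] nw complex_vector.subspace_0[OF D(5)] by (simp add: add.commute)
      then show "v \<in> {0}" using v nw(2) D'(3) by blast
    qed
    show "\<exists>k\<in>K. \<exists>v\<in>?V. x = k + v" if x: "x \<in> E" for x
    proof -
      obtain m n where mn: "m \<in> M" "n \<in> N" "x = m + n" using D(6)[OF x] by blast
      obtain k w where kw: "k \<in> K" "w \<in> W" "m = k + w" using D'(6)[OF mn(1)] by blast
      have "x = k + (n + w)" using mn kw by (simp add: algebra_simps)
      then show ?thesis using kw(1) VI[OF mn(2) kw(2)] by blast
    qed
    show "k + v \<in> E" if kv: "k \<in> K" "v \<in> ?V" for k v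
    proof -
      obtain n w where nw: "n \<in> N" "w \<in> W" "v = n + w" using kv(2) by blast
      have "(k + w) + n \<in> E" by (rule D(7)[OF D'(7)[OF kv(1) nw(2)] nw(1)])
      then show ?thesis using nw(3) by (simp add: algebra_simps)
    qed
  qed
  show "direct_sum ?V N W"
  proof (rule direct_sumI)
    show "N \<inter> W \<subseteq> {0}" using D(3) D'(2) by blast
  qed (use D(5) D'(5) VI in auto)
qed

lemma sum_invariant:
  assumes T: "T \<in> bounded_ops E" and sub: "V \<subseteq> E" "W \<subseteq> E" and inv: "T ` V \<subseteq> V" "T ` W \<subseteq> W"
  shows "T ` {v + w | v w. v \<in> V \<and> w \<in> W} \<subseteq> {v + w | v w. v \<in> V \<and> w \<in> W}"
proof
  fix z assume "z \<in> T ` {v + w | v w. v \<in> V \<and> w \<in> W}"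
  then obtain v w where vw: "v \<in> V" "w \<in> W" "z = T (v + w)" by blast
  have "z = T v + T w" unfolding vw(3) using vw(1,2) sub by (intro bounded_opsD(2)[OF T]) blast+
  then show "z \<in> {v + w | v w. v \<in> V \<and> w \<in> W}" using vw(1,2) inv by blast
qed

text \<open>The projection is bounded because addition \<open>M \<times> N \<rightarrow> E\<close> is a continuous bijection between
  Banach spaces, so by the open mapping theorem the summands are bounded by the sum.\<close>
lemma direct_sum_projection:
  assumes E: "closed_subspace E" and ds: "direct_sum E M N" and cl: "closed M" "closed N"
  shows "\<exists>p\<in>bounded_ops E. (\<forall>x\<in>E. p x \<in> M \<and> x - p x \<in> N) \<and> (\<forall>x\<in>M. p x = x) \<and> (\<forall>x\<in>N. p x = 0)"
proof -
  note D = direct_sumD[OF ds]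
  define p where "p x = (THE m. m \<in> M \<and> x - m \<in> N)" for x
  have peq: "p x = m" if "m \<in> M" "x - m \<in> N" for x m
    unfolding p_def
  proof (rule the_equality)
    fix m' assume m': "m' \<in> M \<and> x - m' \<in> N"
    show "m' = m" using direct_sum_unique[OF ds, of m' m "x - m'" "x - m"] that m' by simp
  qed (use that in simp)
  have p: "p x \<in> M" "x - p x \<in> N" if "x \<in> E" for x
  proof -
    obtain m n where "m \<in> M" "n \<in> N" "x = m + n" using D(6) \<open>x \<in> E\<close> by blast
    then show "p x \<in> M" "x - p x \<in> N" using peq[of m x] by auto
  qed
  define T where "T z = fst z + snd z" for z :: "'a \<times> 'a"
  have img: "T ` (M \<times> N) = E"
    using D(6,7) unfolding T_def by (auto simp: image_iff)
  obtain C where C: "C > 0" "\<And>y. y \<in> T ` (M \<times> N) \<Longrightarrow> \<exists>x\<in>M \<times> N. T x = y \<and> norm x \<le> C * norm y"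
  proof (rule open_mapping_closed_image[of "M \<times> N" T 2])
    show "subspace (M \<times> N)" using D(4,5) real_subspace by (intro subspace_Times) auto
    show "closed (M \<times> N)" using cl by (rule closed_Times)
    show "closed (T ` (M \<times> N))" using img E closed_subspaceD(1) by simp
    show "norm (T x) \<le> norm x * 2" for x
      using norm_triangle_ineq[of "fst x" "snd x"] norm_fst_le[of "fst x" "snd x"]
        norm_snd_le[of "snd x" "fst x"] unfolding T_def by simp
  qed (auto simp: T_def algebra_simps)
  have bound: "norm (p x) \<le> C * norm x" if x: "x \<in> E" for x
  proof -
    obtain m n where mn: "m \<in> M" "n \<in> N" "m + n = x" "norm (m, n) \<le> C * norm x"
      using C(2)[of x] x img unfolding T_def by auto
    then have "p x = m" by (intro peq) auto
    then show ?thesis using mn(4) norm_fst_le[of m n] by simp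
  qed
  show ?thesis
  proof (intro bexI[of _ p] conjI ballI)
    show "p \<in> bounded_ops E"
    proof (rule bounded_opsI[where K = C])
      fix x y assume xy: "x \<in> E" "y \<in> E"
      show "p (x + y) = p x + p y"
      proof (rule peq)
        have "x + y - (p x + p y) = (x - p x) + (y - p y)" by simp
        then show "x + y - (p x + p y) \<in> N"
          using p(2) xy complex_vector.subspace_add[OF D(5)] by metis
      qed (use p(1) xy complex_vector.subspace_add[OF D(4)] in auto)
    next
      fix c x assume x: "x \<in> E"
      show "p (c *\<^sub>C x) = c *\<^sub>C p x"
      proof (rule peq)
        have "c *\<^sub>C x - c *\<^sub>C p x = c *\<^sub>C (x - p x)"
          by (simp add: complex_vector.scale_right_diff_distrib)
        then show "c *\<^sub>C x - c *\<^sub>C p x \<in> N"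
          using p(2) x complex_vector.subspace_scale[OF D(5)] by metis
      qed (use p(1) x complex_vector.subspace_scale[OF D(4)] in auto)
    qed (use p(1) D(1) bound in auto)
    show "p x = x" if "x \<in> M" for x using that complex_vector.subspace_0[OF D(5)] by (intro peq) auto
    show "p x = 0" if "x \<in> N" for x using that complex_vector.subspace_0[OF D(4)] by (intro peq) auto
  qed (use p in auto)
qed

lemma closed_subspace_summand:
  assumes "direct_sum E M N" "closed M" shows "closed_subspace M"
  using assms direct_sumD(4) unfolding closed_subspace_def by blast

lemma projection_direct_sum:
  assumes E: "closed_subspace E" and p: "p \<in> bounded_ops E"
    and V: "\<And>x. x \<in> E \<Longrightarrow> p x \<in> V" "\<And>x. x \<in> V \<Longrightarrow> x \<in> E \<and> p x = x"
  shows "direct_sum E V (null_space E p)" "closed V" "closed (null_space E p)"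
proof -
  have W: "closed_subspace (null_space E p)" by (rule closed_subspace_null_space[OF p E])
  then show "closed (null_space E p)" by (rule closed_subspaceD(1))
  have idp: "(\<lambda>x. x - p x) \<in> bounded_ops E"
    by (intro bounded_ops_minus_op bounded_ops_id p closed_subspaceD(2) E)
  have "V = null_space E (\<lambda>x. x - p x)" using V unfolding null_space_def by fastforce
  then have V': "closed_subspace V" using closed_subspace_null_space[OF idp E] by simp
  then show "closed V" by (rule closed_subspaceD(1))
  show "direct_sum E V (null_space E p)"
  proof (rule direct_sumI)
    show "complex_vector.subspace V" "complex_vector.subspace (null_space E p)"
      using V' W by (auto intro: closed_subspaceD)
    show "V \<inter> null_space E p \<subseteq> {0}" using V(2) unfolding null_space_def by auto
    show "\<exists>m\<in>V. \<exists>n\<in>null_space E p. x = m + n" if x: "x \<in> E" for x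
    proof (intro bexI)
      show "x = p x + (x - p x)" by simp
      have "p (x - p x) = p x - p (p x)"
        using bounded_ops_diff[OF p closed_subspaceD(2)[OF E] x bounded_opsD(1)[OF p x]] .
      then show "x - p x \<in> null_space E p"
        using V x bounded_opsD(1)[OF idp x] unfolding null_space_def by auto
    qed (use V x in auto)
    show "m + n \<in> E" if "m \<in> V" "n \<in> null_space E p" for m n
      using that V(2) closed_subspaceD(5)[OF E] unfolding null_space_def by auto
  qed
qed

text \<open>The form in which complements are used: projections compose and restrict well, while the
  closed complement itself is awkward to follow through these constructions.\<close>
lemma complemented_iff_projection:
  assumes E: "closed_subspace E"
  shows "complemented E V \<longleftrightarrow>
    (\<exists>p\<in>bounded_ops E. (\<forall>x\<in>E. p x \<in> V) \<and> (\<forall>x\<in>V. x \<in> E \<and> p x = x))"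
proof
  assume "complemented E V"
  then obtain W where W: "closed V" "closed W" "direct_sum E V W" unfolding complemented_def by blast
  show "\<exists>p\<in>bounded_ops E. (\<forall>x\<in>E. p x \<in> V) \<and> (\<forall>x\<in>V. x \<in> E \<and> p x = x)"
    using direct_sum_projection[OF E W(3,1,2)] direct_sumD(1)[OF W(3)] by blast
next
  assume "\<exists>p\<in>bounded_ops E. (\<forall>x\<in>E. p x \<in> V) \<and> (\<forall>x\<in>V. x \<in> E \<and> p x = x)"
  then obtain p where p: "p \<in> bounded_ops E" and V: "\<And>x. x \<in> E \<Longrightarrow> p x \<in> V" "\<And>x. x \<in> V \<Longrightarrow> x \<in> E \<and> p x = x"
    by blast
  show "complemented E V" using projection_direct_sum[OF E p V] unfolding complemented_def by blast
qed

text \<open>A left inverse \<open>B\<close> of \<open>T\<close> gives the projection \<open>TB\<close> onto the range. Conversely the inverse of \<open>T\<close>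
  on its closed range is bounded by the open mapping theorem, and the projection onto the range
  extends it to the whole space.\<close>
lemma left_invertible_iff_complemented_range:
  assumes E: "closed_subspace E" and T: "T \<in> bounded_ops E"
  shows "left_invertible E T \<longleftrightarrow> null_space E T = {0} \<and> complemented E (T ` E)"
proof
  assume "left_invertible E T"
  then obtain B where B: "B \<in> bounded_ops E" "\<And>x. x \<in> E \<Longrightarrow> B (T x) = x"
    unfolding left_invertible_def by blast
  have "x = 0" if "x \<in> E" "T x = 0" for x
    using B(2)[OF that(1)] that(2) bounded_ops_zero[OF B(1) closed_subspaceD(4)[OF E]] by simp
  then have "null_space E T = {0}"
    using closed_subspaceD(4)[OF E] bounded_ops_zero[OF T] unfolding null_space_def by auto
  moreover have "complemented E (T ` E)"
    unfolding complemented_iff_projection[OF E]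
    by (rule bexI[OF _ bounded_ops_comp[OF T B(1)]]) (use B bounded_opsD(1)[OF T] bounded_opsD(1)[OF B(1)] in auto)
  ultimately show "null_space E T = {0} \<and> complemented E (T ` E)" ..
next
  assume R: "null_space E T = {0} \<and> complemented E (T ` E)"
  then obtain p where p: "p \<in> bounded_ops E" "\<And>x. x \<in> E \<Longrightarrow> p x \<in> T ` E" "\<And>x. x \<in> T ` E \<Longrightarrow> p x = x"
    unfolding complemented_iff_projection[OF E] by metis
  have inj: "x = y" if "x \<in> E" "y \<in> E" "T x = T y" for x y
  proof -
    have "x - y \<in> null_space E T"
      using that closed_subspaceD(6)[OF E] bounded_ops_diff[OF T closed_subspaceD(2)[OF E]]
      unfolding null_space_def by auto
    then show ?thesis using R by auto
  qed
  have "closed (T ` E)" using R unfolding complemented_def by blast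
  then obtain C where C: "C > 0" "\<And>y. y \<in> T ` E \<Longrightarrow> \<exists>x\<in>E. T x = y \<and> norm x \<le> C * norm y"
    using range_open_mapping[OF T E] by blast
  define G where "G = the_inv_into E T"
  have G: "G (T x) = x" if "x \<in> E" for x
    unfolding G_def by (rule the_inv_into_f_f) (use inj that in \<open>auto simp: inj_on_def\<close>)
  obtain K where K: "K > 0" "\<And>x. x \<in> E \<Longrightarrow> norm (p x) \<le> K * norm x" using bounded_ops_bound[OF p(1)] by blast
  have "(\<lambda>x. G (p x)) \<in> bounded_ops E"
  proof (rule bounded_opsI[where K = "C * K"])
    fix x assume x: "x \<in> E"
    obtain u where u: "u \<in> E" "T u = p x" "norm u \<le> C * norm (p x)" using C(2) p(2)[OF x] by blast
    have Gu: "G (p x) = u" using G[OF u(1)] u(2) by simp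
    show "G (p x) \<in> E" using Gu u(1) by simp
    have "C * norm (p x) \<le> C * (K * norm x)" using C(1) K(2)[OF x] by (intro mult_left_mono) auto
    then show "norm (G (p x)) \<le> C * K * norm x" using Gu u(3) by simp
    show "G (p (c *\<^sub>C x)) = c *\<^sub>C G (p x)" for c
    proof -
      have "p (c *\<^sub>C x) = T (c *\<^sub>C u)" using bounded_opsD(3)[OF p(1) x] bounded_opsD(3)[OF T u(1)] u(2) by simp
      then show ?thesis using G[OF closed_subspaceD(7)[OF E u(1)]] Gu by simp
    qed
    fix y assume y: "y \<in> E"
    obtain v where v: "v \<in> E" "T v = p y" using C(2) p(2)[OF y] by blast
    have Gv: "G (p y) = v" using G[OF v(1)] v(2) by simp
    have "p (x + y) = T (u + v)"
      using bounded_opsD(2)[OF p(1) x y] bounded_opsD(2)[OF T u(1) v(1)] u(2) v(2) by simp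
    then show "G (p (x + y)) = G (p x) + G (p y)" using G[OF closed_subspaceD(5)[OF E u(1) v(1)]] Gu Gv by simp
  qed
  then show "left_invertible E T" unfolding left_invertible_def using G p(3) by (intro bexI) auto
qed

section \<open>Subspaces of finite dimension and finite codimension\<close>

text \<open>With a functional \<open>\<phi>\<close> that vanishes on \<open>V\<close> and is \<open>1\<close> at \<open>b\<close>, membership in the sum is the
  condition that the continuous expression \<open>x - \<phi> x b\<close> lies in \<open>V\<close>.\<close>
lemma closed_subspace_add_line:
  assumes V: "closed_subspace V"
  shows "closed_subspace {v + c *\<^sub>C b | v c. v \<in> V}"
proof (cases "b \<in> V")
  case True
  have "{v + c *\<^sub>C b | v c. v \<in> V} = V"
  proof
    show "V \<subseteq> {v + c *\<^sub>C b | v c. v \<in> V}"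
    proof
      fix v assume "v \<in> V"
      moreover have "v = v + 0 *\<^sub>C b" by simp
      ultimately show "v \<in> {v + c *\<^sub>C b | v c. v \<in> V}" by blast
    qed
  qed (use closed_subspaceD[OF V] True in auto)
  then show ?thesis using V by simp
next
  case False
  obtain \<phi> :: "'a \<Rightarrow> complex" where \<phi>: "bounded_linear \<phi>" "\<And>c x. \<phi> (c *\<^sub>C x) = c * \<phi> x"
    "\<And>v. v \<in> V \<Longrightarrow> \<phi> v = 0" "\<phi> b = 1"
    using Hahn_Banach_separation[OF closed_subspaceD(2,1)[OF V] False] by metis
  have lin: "linear \<phi>" using \<phi>(1) by (rule bounded_linear.linear)
  have cont: "continuous_on UNIV (\<lambda>x. x - \<phi> x *\<^sub>C b)"
    by (intro continuous_intros bounded_linear.continuous_on[OF bounded_linear_scaleC_left]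
        bounded_linear.continuous_on[OF \<phi>(1)])
  have "closed ((\<lambda>x. x - \<phi> x *\<^sub>C b) -` V)"
    using continuous_closed_vimage[OF closed_subspaceD(1)[OF V]] cont continuous_on_eq_continuous_within
    by blast
  moreover have "(\<lambda>x. x - \<phi> x *\<^sub>C b) -` V = {v + c *\<^sub>C b | v c. v \<in> V}"
  proof (intro equalityI subsetI)
    fix x assume "x \<in> (\<lambda>x. x - \<phi> x *\<^sub>C b) -` V"
    moreover have "x = (x - \<phi> x *\<^sub>C b) + \<phi> x *\<^sub>C b" by simp
    ultimately show "x \<in> {v + c *\<^sub>C b | v c. v \<in> V}" by blast
  next
    fix x assume "x \<in> {v + c *\<^sub>C b | v c. v \<in> V}"
    then obtain v c where x: "x = v + c *\<^sub>C b" "v \<in> V" by blast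
    then have "\<phi> x = c" using \<phi> by (simp add: linear_add[OF lin])
    then show "x \<in> (\<lambda>x. x - \<phi> x *\<^sub>C b) -` V" using x by simp
  qed
  moreover have "complex_vector.subspace {v + c *\<^sub>C b | v c. v \<in> V}"
  proof -
    have "{v + c *\<^sub>C b | v c. v \<in> V} = {x + y | x y. x \<in> V \<and> y \<in> complex_vector.span {b}}"
      unfolding complex_vector.span_singleton by blast
    then show ?thesis
      using complex_vector.subspace_sums[OF closed_subspaceD(2)[OF V] complex_vector.subspace_span[of "{b}"]]
      by simp
  qed
  ultimately show ?thesis unfolding closed_subspace_def by simp
qed

lemma closed_subspace_add_finite_dim:
  assumes V: "closed_subspace V" and W: "finite_dim W"
  shows "closed_subspace {v + w | v w. v \<in> V \<and> w \<in> W}"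
proof -
  obtain B where B: "finite B" "W = complex_vector.span B" using W unfolding finite_dim_def by blast
  have "closed_subspace {v + w | v w. v \<in> V \<and> w \<in> complex_vector.span B}"
    using B(1)
  proof (induction B)
    case empty
    then show ?case using V by simp
  next
    case (insert b B)
    have "{v + w | v w. v \<in> V \<and> w \<in> complex_vector.span (insert b B)} =
      {u + c *\<^sub>C b | u c. u \<in> {v + w | v w. v \<in> V \<and> w \<in> complex_vector.span B}}" (is "?L = ?R")
    proof (intro equalityI subsetI)
      fix x assume "x \<in> ?L"
      then obtain v w k where *: "x = v + w" "v \<in> V" "w - k *\<^sub>C b \<in> complex_vector.span B"
        unfolding complex_vector.span_breakdown_eq by blast
      have "x = (v + (w - k *\<^sub>C b)) + k *\<^sub>C b" using * by simp
      then show "x \<in> ?R" using * by blast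
    next
      fix x assume "x \<in> ?R"
      then obtain v w k where *: "x = v + w + k *\<^sub>C b" "v \<in> V" "w \<in> complex_vector.span B" by blast
      have "x = v + (w + k *\<^sub>C b)" using * by (simp add: add.assoc)
      moreover have "w + k *\<^sub>C b \<in> complex_vector.span (insert b B)"
        unfolding complex_vector.span_breakdown_eq using * by (intro exI[of _ k]) simp
      ultimately show "x \<in> ?L" using * by blast
    qed
    then show ?case using closed_subspace_add_line[OF insert.IH, of b] by simp
  qed
  then show ?thesis using B(2) by simp
qed

lemma closed_subspace_finite_dim: "finite_dim W \<Longrightarrow> closed_subspace W"
  using closed_subspace_add_finite_dim[OF closed_subspace_zero, of W] by simp

lemma finite_dim_zero [simp]: "finite_dim {0}"
  unfolding finite_dim_def by (intro exI[of _ "{}"]) simp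

lemma finite_dim_subspace:
  assumes W: "finite_dim W" and V: "complex_vector.subspace V" "V \<subseteq> W"
  shows "finite_dim V"
proof -
  obtain B where B: "finite B" "W = complex_vector.span B" using W unfolding finite_dim_def by blast
  obtain C where C: "C \<subseteq> V" "complex_vector.independent C" "V \<subseteq> complex_vector.span C"
    using complex_vector.maximal_independent_subset by blast
  have "finite C" using complex_vector.independent_span_bound[OF B(1) C(2)] C(1) V(2) B(2) by blast
  moreover have "V = complex_vector.span C" using complex_vector.span_minimal[OF C(1) V(1)] C(3) by blast
  ultimately show ?thesis unfolding finite_dim_def by blast
qed

lemma finite_dim_sum:
  assumes "finite_dim V" "finite_dim W" shows "finite_dim {v + w | v w. v \<in> V \<and> w \<in> W}"
proof -
  obtain B C where "finite B" "V = complex_vector.span B" "finite C" "W = complex_vector.span C"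
    using assms unfolding finite_dim_def by blast
  then have "finite (B \<union> C)" "{v + w | v w. v \<in> V \<and> w \<in> W} = complex_vector.span (B \<union> C)"
    by (simp_all add: complex_vector.span_Un)
  then show ?thesis unfolding finite_dim_def by blast
qed

lemma span_image_bounded_ops:
  assumes T: "T \<in> bounded_ops E" and E: "complex_vector.subspace E" and B: "B \<subseteq> E"
    and y: "y \<in> complex_vector.span B"
  shows "T y \<in> complex_vector.span (T ` B)"
proof -
  have "y \<in> E \<and> T y \<in> complex_vector.span (T ` B)"
    using y
  proof (induction rule: complex_vector.span_induct_alt)
    case base
    show ?case using bounded_ops_zero[OF T] complex_vector.subspace_0[OF E] complex_vector.span_zero by simp
  next
    case (step c x y)
    then have x: "x \<in> E" "T x \<in> complex_vector.span (T ` B)"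
      using B complex_vector.span_base by blast+
    have "c *\<^sub>C x \<in> E" "T (c *\<^sub>C x) \<in> complex_vector.span (T ` B)"
      using x complex_vector.subspace_scale[OF E] complex_vector.span_scale bounded_opsD(3)[OF T] by auto
    then show ?case
      using step complex_vector.subspace_add[OF E] complex_vector.span_add bounded_opsD(2)[OF T] by auto
  qed
  then show ?thesis ..
qed

text \<open>The spanning vectors of the quotient are added to \<open>V\<close> one at a time; those already in the
  enlarged subspace are skipped, the others span the complement.\<close>
lemma finite_codim_complement:
  assumes E: "complex_vector.subspace E" and V: "complex_vector.subspace V" "V \<subseteq> E"
    and fc: "finite_codim E V"
  obtains W where "finite_dim W" "direct_sum E V W"
proof -
  obtain B where B: "finite B" "B \<subseteq> E" "\<And>x. x \<in> E \<Longrightarrow> \<exists>y\<in>complex_vector.span B. x - y \<in> V"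
    using fc unfolding finite_codim_def by blast
  have "\<exists>W. finite_dim W \<and> direct_sum E V W"
    using B(1,2) V B(3)
  proof (induction B arbitrary: V)
    case empty
    have "E \<subseteq> V" using empty(4) by fastforce
    then have "V = E" using empty(3) by blast
    then have "direct_sum E V {0}" using empty E by (intro direct_sumI) auto
    then show ?case using finite_dim_zero by blast
  next
    case (insert b B)
    have bE: "b \<in> E" and BE: "B \<subseteq> E" using insert.prems(1) by auto
    have ex: "\<exists>y k. y \<in> complex_vector.span B \<and> x - y - k *\<^sub>C b \<in> V" if x: "x \<in> E" for x
    proof -
      obtain y where y0: "x - y \<in> V" "y \<in> complex_vector.span (insert b B)"
        using insert.prems(4)[OF x] by blast
      then obtain k where y: "x - y \<in> V" "y - k *\<^sub>C b \<in> complex_vector.span B"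
        unfolding complex_vector.span_breakdown_eq by blast
      have "x - (y - k *\<^sub>C b) - k *\<^sub>C b = x - y" by simp
      then show ?thesis using y by metis
    qed
    show ?case
    proof (cases "b \<in> V")
      case True
      have "\<exists>y\<in>complex_vector.span B. x - y \<in> V" if x: "x \<in> E" for x
      proof -
        obtain y k where y: "y \<in> complex_vector.span B" "x - y - k *\<^sub>C b \<in> V" using ex[OF x] by blast
        have "(x - y - k *\<^sub>C b) + k *\<^sub>C b \<in> V"
          using y(2) True complex_vector.subspace_add[OF insert.prems(2)]
            complex_vector.subspace_scale[OF insert.prems(2)] by blast
        then show ?thesis using y(1) by auto
      qed
      then show ?thesis using insert.IH[OF BE insert.prems(2,3)] by blast
    next
      case False
      define V' where "V' = {v + w | v w. v \<in> V \<and> w \<in> complex_vector.span {b}}"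
      have V': "complex_vector.subspace V'"
        unfolding V'_def by (intro complex_vector.subspace_sums insert.prems(2) complex_vector.subspace_span)
      have V'I: "v + k *\<^sub>C b \<in> V'" if "v \<in> V" for v k
        unfolding V'_def complex_vector.span_singleton using that by blast
      have V'E: "V' \<subseteq> E"
        unfolding V'_def complex_vector.span_singleton
        using insert.prems(3) bE complex_vector.subspace_add[OF E] complex_vector.subspace_scale[OF E] by blast
      have "\<exists>y\<in>complex_vector.span B. x - y \<in> V'" if x: "x \<in> E" for x
      proof -
        obtain y k where y: "y \<in> complex_vector.span B" "x - y - k *\<^sub>C b \<in> V" using ex[OF x] by blast
        have "(x - y - k *\<^sub>C b) + k *\<^sub>C b \<in> V'" using y(2) V'I by blast
        then show ?thesis using y(1) by auto
      qed
      then obtain W' where W': "finite_dim W'" "direct_sum E V' W'"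
        using insert.IH[OF BE V' V'E] by blast
      note D = direct_sumD[OF W'(2)]
      define W where "W = {w + u | w u. w \<in> W' \<and> u \<in> complex_vector.span {b}}"
      have "finite_dim W"
        unfolding W_def by (intro finite_dim_sum W'(1)) (auto simp: finite_dim_def)
      moreover have "direct_sum E V W"
      proof (rule direct_sumI)
        show "complex_vector.subspace W"
          unfolding W_def by (intro complex_vector.subspace_sums D(5) complex_vector.subspace_span)
        show "V \<inter> W \<subseteq> {0}"
        proof
          fix v assume v: "v \<in> V \<inter> W"
          then obtain w k where w: "w \<in> W'" "v = w + k *\<^sub>C b"
            unfolding W_def complex_vector.span_singleton by blast
          have "w = v + (- k) *\<^sub>C b" using w(2) by simp
          then have "w \<in> V' \<inter> W'" using w(1) v V'I by (metis IntD1 IntI)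
          then have v': "v = k *\<^sub>C b" using D(3) w(2) by simp
          have "k = 0"
          proof (rule ccontr)
            assume k: "k \<noteq> 0"
            have "(1 / k) *\<^sub>C v \<in> V" using v complex_vector.subspace_scale[OF insert.prems(2)] by blast
            then show False using False v' k by simp
          qed
          then show "v \<in> {0}" using v' by simp
        qed
        show "\<exists>v\<in>V. \<exists>w\<in>W. x = v + w" if x: "x \<in> E" for x
        proof -
          obtain v k w where *: "v \<in> V" "w \<in> W'" "x = v + k *\<^sub>C b + w"
            using D(6)[OF x] unfolding V'_def complex_vector.span_singleton by blast
          have "x = v + (w + k *\<^sub>C b)" using * by (simp add: algebra_simps)
          then show ?thesis using * unfolding W_def complex_vector.span_singleton by blast
        qed
        show "v + w \<in> E" if vw: "v \<in> V" "w \<in> W" for v w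
        proof -
          obtain w' k where w: "w' \<in> W'" "w = w' + k *\<^sub>C b"
            using vw(2) unfolding W_def complex_vector.span_singleton by blast
          have "(v + k *\<^sub>C b) + w' \<in> E" using D(7) V'I vw(1) w(1) by blast
          then show ?thesis using w(2) by (simp add: algebra_simps)
        qed
      qed (rule insert.prems(2))
      ultimately show ?thesis by blast
    qed
  qed
  then show thesis using that by blast
qed

section \<open>Operators with closed range\<close>

text \<open>Only closedness of the range is at stake. Let \<open>W\<close> be an algebraic complement of it. The map
  \<open>(x, w) \<mapsto> T x + w\<close> from \<open>E \<times> W\<close> onto \<open>E\<close> is open, so the \<open>W\<close>-component of a vector is bounded by
  its norm; hence it vanishes for limits of vectors in the range.\<close>
lemma complemented_range_of_finite_codim:
  assumes E: "closed_subspace E" and T: "T \<in> bounded_ops E" and fc: "finite_codim E (T ` E)"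
  shows "complemented E (T ` E)"
proof -
  have TE: "complex_vector.subspace (T ` E)" "T ` E \<subseteq> E"
    using subspace_range[OF T closed_subspaceD(2)[OF E]] bounded_opsD(1)[OF T] by auto
  obtain W where W: "finite_dim W" "direct_sum E (T ` E) W"
    using finite_codim_complement[OF closed_subspaceD(2)[OF E] TE fc] by blast
  note D = direct_sumD[OF W(2)]
  have Wc: "closed_subspace W" by (rule closed_subspace_finite_dim[OF W(1)])
  define S where "S z = T (fst z) + snd z" for z
  have img: "S ` (E \<times> W) = E"
  proof
    show "S ` (E \<times> W) \<subseteq> E" unfolding S_def using D(7) by auto
    show "E \<subseteq> S ` (E \<times> W)"
    proof
      fix x assume "x \<in> E"
      then obtain u w where "u \<in> E" "w \<in> W" "x = T u + w" using D(6) by blast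
      then show "x \<in> S ` (E \<times> W)" unfolding S_def by (intro image_eqI[of _ _ "(u, w)"]) auto
    qed
  qed
  obtain K where K: "K > 0" "\<And>x. x \<in> E \<Longrightarrow> norm (T x) \<le> K * norm x" using bounded_ops_bound[OF T] by blast
  obtain C where C: "C > 0" "\<And>y. y \<in> S ` (E \<times> W) \<Longrightarrow> \<exists>z\<in>E \<times> W. S z = y \<and> norm z \<le> C * norm y"
  proof (rule open_mapping_closed_image[of "E \<times> W" S "K + 1"])
    show "subspace (E \<times> W)" using closed_subspaceD(3) E Wc by (intro subspace_Times) auto
    show "closed (E \<times> W)" using closed_subspaceD(1) E Wc by (intro closed_Times) auto
    show "closed (S ` (E \<times> W))" using img closed_subspaceD(1)[OF E] by simp
    show "S (z + z') = S z + S z'" if "z \<in> E \<times> W" "z' \<in> E \<times> W" for z z'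
      using that bounded_opsD(2)[OF T] unfolding S_def by (auto simp: algebra_simps)
    show "S (c *\<^sub>R z) = c *\<^sub>R S z" if "z \<in> E \<times> W" for c z
      using that bounded_ops_real_scale[OF T] unfolding S_def by (auto simp: algebra_simps)
    show "norm (S z) \<le> norm z * (K + 1)" if z: "z \<in> E \<times> W" for z
    proof -
      have "norm (S z) \<le> norm (T (fst z)) + norm (snd z)" unfolding S_def by (rule norm_triangle_ineq)
      also have "\<dots> \<le> K * norm (fst z) + norm (snd z)" using K(2) z by auto
      also have "\<dots> \<le> K * norm z + norm z"
        using K(1) norm_fst_le[of "fst z" "snd z"] norm_snd_le[of "snd z" "fst z"]
        by (intro add_mono mult_left_mono) auto
      finally show ?thesis by (simp add: algebra_simps)
    qed
  qed blast
  have "closed (T ` E)"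
  proof (subst closed_sequential_limits, intro allI impI, elim conjE)
    fix y l assume y: "\<forall>n. y n \<in> T ` E" and lim: "y \<longlonglongrightarrow> l"
    have "l \<in> E" using closed_sequentially[OF closed_subspaceD(1)[OF E] _ lim] y TE(2) by blast
    then obtain u w where uw: "u \<in> T ` E" "w \<in> W" "l = u + w" using D(6) by blast
    have le: "norm w \<le> C * norm (y n - l)" for n
    proof -
      have dE: "y n - l \<in> E" using y TE(2) \<open>l \<in> E\<close> closed_subspaceD(6)[OF E] by blast
      then obtain x w' where z: "x \<in> E" "w' \<in> W" "T x + w' = y n - l" "norm (x, w') \<le> C * norm (y n - l)"
        using C(2)[of "y n - l"] img unfolding S_def by auto
      have "y n - u \<in> T ` E" using y uw(1) complex_vector.subspace_diff[OF TE(1)] by blast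
      moreover have "y n - u + (- w) = T x + w'" using z(3) uw(3) by simp
      moreover have "- w \<in> W" using closed_subspaceD(8)[OF Wc uw(2)] .
      ultimately have "w' = - w" using direct_sum_unique[OF W(2), of "y n - u" "T x" "- w" w'] z(1,2) by auto
      then show ?thesis using z(4) norm_snd_le[of w' x] by simp
    qed
    have "(\<lambda>n. C * norm (y n - l)) \<longlonglongrightarrow> 0"
      using tendsto_mult_right_zero[OF tendsto_norm_zero[OF LIM_zero[OF lim]]] by simp
    then have "norm w \<le> 0" using le by (intro LIMSEQ_le_const[of _ 0]) auto
    then show "l \<in> T ` E" using uw by simp
  qed
  then show ?thesis using W(2) closed_subspaceD(1)[OF Wc] unfolding complemented_def by blast
qed

text \<open>\<open>F\<close> may be enlarged by the kernel without changing its image, and it stays closed because the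
  kernel has finite dimension. Once \<open>F\<close> contains the kernel, small preimages of the differences
  \<open>y n - l\<close> show that a preimage of the limit \<open>l\<close> is a limit of points of \<open>F\<close>.\<close>
lemma closed_image_of_finite_dim_kernel:
  assumes E: "closed_subspace E" and T: "T \<in> bounded_ops E" and cl: "closed (T ` E)"
    and N: "finite_dim (null_space E T)" and F: "closed_subspace F" "F \<subseteq> E"
  shows "closed (T ` F)"
proof (subst closed_sequential_limits, intro allI impI, elim conjE)
  define G where "G = {v + w | v w. v \<in> F \<and> w \<in> null_space E T}"
  have G: "closed_subspace G" unfolding G_def by (rule closed_subspace_add_finite_dim[OF F(1) N])
  obtain C where C: "C > 0" "\<And>y. y \<in> T ` E \<Longrightarrow> \<exists>x\<in>E. T x = y \<and> norm x \<le> C * norm y"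
    using range_open_mapping[OF T E order_refl cl] by blast
  fix y l assume y: "\<forall>n. y n \<in> T ` F" and lim: "y \<longlonglongrightarrow> l"
  have "l \<in> T ` E" using closed_sequentially[OF cl _ lim] y F(2) by blast
  then obtain x where x: "x \<in> E" "l = T x" by blast
  \<comment> \<open>the small corrections that move \<open>x\<close> into \<open>G\<close>\<close>
  have "\<exists>z. z \<in> E \<and> x + z \<in> G \<and> norm z \<le> C * norm (y n - l)" for n
  proof -
    obtain f where f: "f \<in> F" "y n = T f" using y by blast
    have fE: "f \<in> E" using f F(2) by blast
    have "y n - l = T (f - x)" using f x bounded_ops_diff[OF T closed_subspaceD(2)[OF E] fE x(1)] by simp
    then obtain z where z: "z \<in> E" "T z = y n - l" "norm z \<le> C * norm (y n - l)"
      using C(2)[of "y n - l"] closed_subspaceD(6)[OF E fE x(1)] by blast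
    have xz: "x + z \<in> E" using closed_subspaceD(5)[OF E x(1) z(1)] .
    have "T (x + z - f) = 0"
      using bounded_ops_diff[OF T closed_subspaceD(2)[OF E] xz fE] bounded_opsD(2)[OF T x(1) z(1)] x f z
      by simp
    then have "x + z - f \<in> null_space E T"
      using closed_subspaceD(6)[OF E xz fE] unfolding null_space_def by simp
    moreover have "x + z = f + (x + z - f)" by simp
    ultimately have "x + z \<in> G" unfolding G_def using f(1) by blast
    then show ?thesis using z by blast
  qed
  then obtain z where z: "\<And>n. z n \<in> E" "\<And>n. x + z n \<in> G" "\<And>n. norm (z n) \<le> C * norm (y n - l)" by metis
  have "z \<longlonglongrightarrow> 0"
  proof (rule Lim_null_comparison)
    show "(\<lambda>n. C * norm (y n - l)) \<longlonglongrightarrow> 0"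
      using tendsto_mult_right_zero[OF tendsto_norm_zero[OF LIM_zero[OF lim]]] by simp
  qed (use z(3) in auto)
  then have "(\<lambda>n. x + z n) \<longlonglongrightarrow> x" using tendsto_add[OF tendsto_const, of z 0 sequentially x] by simp
  then have "x \<in> G" using closed_sequentially[OF closed_subspaceD(1)[OF G], of "\<lambda>n. x + z n"] z(2) by blast
  then obtain f w where fw: "x = f + w" "f \<in> F" "w \<in> null_space E T" unfolding G_def by blast
  have "T x = T f" using fw F(2) bounded_opsD(2)[OF T, of f w] unfolding null_space_def by auto
  then show "l \<in> T ` F" using x fw by blast
qed

lemma funpow_range_Suc: "(T ^^ Suc n) ` E = T ` ((T ^^ n) ` E)"
  by (simp add: image_comp)

lemma funpow_range_subset:
  assumes T: "T \<in> bounded_ops E" and mn: "m \<le> n" shows "(T ^^ n) ` E \<subseteq> (T ^^ m) ` E"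
proof -
  have "(T ^^ n) x = (T ^^ m) ((T ^^ (n - m)) x)" for x
    using funpow_add[of m "n - m" T] mn by (simp add: comp_def)
  then show ?thesis using bounded_opsD(1)[OF bounded_ops_funpow[OF T]] by (metis (no_types, lifting) image_eqI image_subsetI)
qed

lemma closed_subspace_funpow_range:
  assumes E: "closed_subspace E" and T: "T \<in> bounded_ops E" and cl: "closed (T ` E)"
    and N: "finite_dim (null_space E T)"
  shows "closed_subspace ((T ^^ n) ` E)"
proof (induction n)
  case 0
  then show ?case using E by simp
next
  case (Suc n)
  have sub: "(T ^^ n) ` E \<subseteq> E" using funpow_range_subset[OF T, of 0 n] by simp
  have "closed (T ` ((T ^^ n) ` E))" by (rule closed_image_of_finite_dim_kernel[OF E T cl N Suc sub])
  moreover have "complex_vector.subspace (T ` ((T ^^ n) ` E))"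
    by (rule subspace_range[OF T closed_subspaceD(2)[OF Suc] sub])
  ultimately show ?case unfolding closed_subspace_def funpow_range_Suc by blast
qed

lemma ascent_finite_iff: "ascent E T < \<infinity> \<longleftrightarrow> (\<exists>n. null_space E T \<inter> (T ^^ n) ` E = {0})"
proof -
  define S where "S = {enat n | n. null_space E T \<inter> (T ^^ n) ` E = {0}}"
  have "Inf S < \<infinity> \<longleftrightarrow> (\<exists>x\<in>S. x < \<infinity>)" by (rule Inf_less_iff)
  then show ?thesis unfolding ascent_def S_def[symmetric] unfolding S_def by auto
qed

lemma ascent_attained:
  assumes "ascent E T < \<infinity>"
  shows "null_space E T \<inter> (T ^^ the_enat (ascent E T)) ` E = {0}"
proof -
  define S where "S = {enat n | n. null_space E T \<inter> (T ^^ n) ` E = {0}}"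
  have ne: "S \<noteq> {}" using assms unfolding ascent_finite_iff S_def by auto
  then have "Inf S \<in> S" unfolding Inf_enat_def by (auto intro: LeastI)
  then have "\<exists>n. Inf S = enat n \<and> null_space E T \<inter> (T ^^ n) ` E = {0}"
    by (simp only: S_def mem_Collect_eq)
  then show ?thesis unfolding ascent_def S_def[symmetric] by (metis the_enat.simps)
qed

lemma left_Browder_imp_upper_Drazin:
  assumes E: "closed_subspace E" and T: "T \<in> bounded_ops E" and LB: "left_Browder E T"
  shows "upper_Drazin_invertible E T"
  using closed_subspaceD(1)[OF closed_subspace_funpow_range[OF E T]] LB
  unfolding left_Browder_def upper_Drazin_invertible_def complemented_def by blast

section \<open>Eigenvalues near zero\<close>

lemma eigenvector_in_funpow_range:
  assumes E: "complex_vector.subspace E" and S: "S \<in> bounded_ops E"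
    and x: "x \<in> E" "S x = \<mu> *\<^sub>C x" and \<mu>: "\<mu> \<noteq> 0"
  shows "x \<in> (S ^^ n) ` E"
proof -
  have pow: "(S ^^ n) x = \<mu> ^ n *\<^sub>C x" for n
  proof (induction n)
    case (Suc n)
    then show ?case using bounded_opsD(3)[OF S x(1)] x(2) by (simp add: mult.commute)
  qed simp
  have "(S ^^ n) ((1 / \<mu> ^ n) *\<^sub>C x) = (1 / \<mu> ^ n) *\<^sub>C (S ^^ n) x"
    by (rule bounded_opsD(3)[OF bounded_ops_funpow[OF S] x(1)])
  also have "\<dots> = x" unfolding pow using \<mu> by simp
  finally show ?thesis using complex_vector.subspace_scale[OF E x(1)] by (metis imageI)
qed

text \<open>Put \<open>n = a + 1\<close>, where \<open>a\<close> is the ascent of \<open>S\<close>. Eigenvectors for \<open>\<mu> \<noteq> 0\<close> lie in the range of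
  \<open>S\<^sup>n\<close>, so it suffices that \<open>S\<close> is bounded below there. Let \<open>y = S\<^sup>n x\<close>. By the open mapping theorem
  \<open>S y = S\<^sup>n z\<close> for some \<open>z\<close> bounded by \<open>S y\<close>. Now \<open>S x - z\<close> is in the kernel of \<open>S\<^sup>n\<close>, which equals that
  of \<open>S\<^sup>a\<close>, and therefore \<open>y = S\<^sup>a z\<close> is bounded by \<open>S y\<close>. The exponent \<open>a\<close>
  itself would not do, because only the range of \<open>S\<^sup>n\<close> is known to be closed.\<close>
lemma upper_Drazin_punctured_injective:
  assumes E: "closed_subspace E" and S: "S \<in> bounded_ops E" and UD: "upper_Drazin_invertible E S"
  obtains \<epsilon> where "\<epsilon> > 0" "\<And>\<mu>. \<mu> \<noteq> 0 \<Longrightarrow> cmod \<mu> < \<epsilon> \<Longrightarrow> null_space E (shift S \<mu>) = {0}"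
proof -
  define a where "a = the_enat (ascent E S)"
  have cl: "closed ((S ^^ Suc a) ` E)" and asc: "null_space E S \<inter> (S ^^ a) ` E = {0}"
    using UD ascent_attained unfolding upper_Drazin_invertible_def a_def by auto
  have ker: "(S ^^ a) w = 0" if "w \<in> E" "(S ^^ Suc a) w = 0" for w
    using that asc bounded_opsD(1)[OF bounded_ops_funpow[OF S] that(1), of a]
    unfolding null_space_def by auto
  obtain C where C: "C > 0" "\<And>y. y \<in> (S ^^ Suc a) ` E \<Longrightarrow> \<exists>x\<in>E. (S ^^ Suc a) x = y \<and> norm x \<le> C * norm y"
    using range_open_mapping[OF bounded_ops_funpow[OF S] E order_refl cl] by blast
  obtain L where L: "L > 0" "\<And>x. x \<in> E \<Longrightarrow> norm ((S ^^ a) x) \<le> L * norm x"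
    using bounded_ops_bound[OF bounded_ops_funpow[OF S]] by blast
  have below: "norm y \<le> L * C * norm (S y)" if y: "y \<in> (S ^^ Suc a) ` E" for y
  proof -
    obtain x where x: "x \<in> E" "y = (S ^^ Suc a) x" using y by blast
    have Sx: "S x \<in> E" by (rule bounded_opsD(1)[OF S x(1)])
    have Sy: "S y = (S ^^ Suc a) (S x)" using x(2) by (simp add: funpow_swap1)
    then obtain z where z: "z \<in> E" "(S ^^ Suc a) z = S y" "norm z \<le> C * norm (S y)"
      using C(2)[of "S y"] Sx by blast
    have "(S ^^ Suc a) (S x - z) = 0"
      using bounded_ops_diff[OF bounded_ops_funpow[OF S] closed_subspaceD(2)[OF E] Sx z(1), of "Suc a"] Sy z(2)
      by (simp del: funpow.simps)
    then have "(S ^^ a) (S x - z) = 0" by (rule ker[OF closed_subspaceD(6)[OF E Sx z(1)]])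
    then have "(S ^^ a) (S x) = (S ^^ a) z"
      using bounded_ops_diff[OF bounded_ops_funpow[OF S] closed_subspaceD(2)[OF E] Sx z(1)] by simp
    then have "y = (S ^^ a) z" using x(2) by (simp add: funpow_swap1)
    then have "norm y \<le> L * norm z" using L(2)[OF z(1)] by simp
    also have "\<dots> \<le> L * (C * norm (S y))" using z(3) L(1) by (intro mult_left_mono) auto
    finally show ?thesis by simp
  qed
  show thesis
  proof (rule that[of "1 / (L * C)"])
    show "1 / (L * C) > 0" using L C by simp
    fix \<mu> assume \<mu>: "\<mu> \<noteq> 0" "cmod \<mu> < 1 / (L * C)"
    have "x = 0" if x: "x \<in> E" "shift S \<mu> x = 0" for x
    proof (rule ccontr)
      assume "x \<noteq> 0"
      have Sx: "S x = \<mu> *\<^sub>C x" using x(2) unfolding shift_def by simp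
      have "norm x \<le> L * C * norm (S x)"
        by (rule below[OF eigenvector_in_funpow_range[OF closed_subspaceD(2)[OF E] S x(1) Sx \<mu>(1)]])
      also have "\<dots> = (L * C * cmod \<mu>) * norm x" unfolding Sx by (simp add: norm_scaleC)
      also have "\<dots> < 1 * norm x"
        using \<mu>(2) L(1) C(1) \<open>x \<noteq> 0\<close> by (intro mult_strict_right_mono) (auto simp: field_simps)
      finally show False by simp
    qed
    moreover have "shift S \<mu> 0 = 0" using bounded_ops_zero[OF S closed_subspaceD(4)[OF E]] by (simp add: shift_def)
    ultimately show "null_space E (shift S \<mu>) = {0}"
      using closed_subspaceD(4)[OF E] unfolding null_space_def by auto
  qed
qed

text \<open>Half of the natural radius of convergence is enough for what follows; it makes the derived
  series converge uniformly by comparison with the derived geometric series at \<open>1/2\<close>.\<close>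
lemma vector_power_series:
  fixes x :: "nat \<Rightarrow> 'a::complex_banach"
  assumes C: "C > 0" and x: "\<And>n. norm (x n) \<le> M * C ^ n"
  obtains f where "vector_analytic_on f (ball 0 (1 / (2 * C)))"
    "\<And>\<mu>. \<mu> \<in> ball 0 (1 / (2 * C)) \<Longrightarrow> (\<lambda>n. \<mu> ^ n *\<^sub>C x n) sums f \<mu>"
proof -
  define D where "D = ball (0::complex) (1 / (2 * C))"
  define u where "u n \<mu> = (of_nat n * \<mu> ^ (n - 1)) *\<^sub>C x n" for n \<mu>
  have M: "M \<ge> 0" using order_trans[OF norm_ge_zero x[of 0]] by simp
  have bound: "norm (u n \<mu>) \<le> M * C * (real n * (1/2) ^ (n - 1))" if \<mu>: "\<mu> \<in> D" for n \<mu>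
  proof (cases n)
    case (Suc k)
    have "cmod \<mu> * C \<le> 1 / 2" using \<mu> C unfolding D_def by (simp add: field_simps)
    then have half: "(cmod \<mu> * C) ^ k \<le> (1/2) ^ k" using C by (intro power_mono) auto
    have "norm (u n \<mu>) = real n * cmod \<mu> ^ k * norm (x n)"
      unfolding u_def Suc by (simp add: norm_scaleC norm_mult norm_power del: of_nat_Suc)
    also have "\<dots> \<le> real n * cmod \<mu> ^ k * (M * C ^ Suc k)"
      using x[of n] unfolding Suc by (intro mult_left_mono) auto
    also have "\<dots> = M * C * (real n * (cmod \<mu> * C) ^ k)" by (simp add: power_mult_distrib)
    also have "\<dots> \<le> M * C * (real n * (1/2) ^ k)"
      using half M C by (intro mult_left_mono) auto
    finally show ?thesis unfolding Suc by simp
  qed (simp add: u_def)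
  have "summable (\<lambda>n. real (Suc n) * (1/2) ^ n)"
    using geometric_deriv_sums[of "1/2 :: real"] by (simp add: sums_summable)
  then have "summable (\<lambda>n. real n * (1/2) ^ (n - 1))"
    using summable_Suc_iff[of "\<lambda>n. real n * (1/2) ^ (n - 1)"] by simp
  then have unif: "uniform_limit D (\<lambda>n \<mu>. \<Sum>i<n. u i \<mu>) (\<lambda>\<mu>. \<Sum>i. u i \<mu>) sequentially"
    by (intro Weierstrass_m_test[where M = "\<lambda>n. M * C * (real n * (1/2) ^ (n - 1))"] bound summable_mult)
  have "\<exists>f. \<forall>\<mu>\<in>D. (\<lambda>n. \<mu> ^ n *\<^sub>C x n) sums f \<mu> \<and>
      (f has_derivative (\<lambda>h. h *\<^sub>C (\<Sum>i. u i \<mu>))) (at \<mu> within D)"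
  proof (rule has_derivative_series)
    show "convex D" unfolding D_def by simp
    show "((\<lambda>\<mu>. \<mu> ^ n *\<^sub>C x n) has_derivative (\<lambda>h. h *\<^sub>C u n \<mu>)) (at \<mu> within D)" for n \<mu>
    proof -
      have "((\<lambda>\<mu>. \<mu> ^ n) has_derivative (\<lambda>h. h * (of_nat n * \<mu> ^ (n - 1)))) (at \<mu> within D)"
        by (auto intro!: derivative_eq_intros simp: mult_commute_abs simp flip: has_field_derivative_def)
      from bounded_linear.has_derivative[OF bounded_linear_scaleC_left[of "x n"] this]
      show ?thesis unfolding u_def by simp
    qed
    show "\<forall>\<^sub>F n in sequentially. \<forall>\<mu>\<in>D. \<forall>h.
      norm ((\<Sum>i<n. h *\<^sub>C u i \<mu>) - h *\<^sub>C (\<Sum>i. u i \<mu>)) \<le> e * norm h" if "e > 0" for e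
      using uniform_limitD[OF unif that]
    proof (eventually_elim, intro ballI allI)
      fix n \<mu> h assume "\<forall>\<mu>\<in>D. dist (\<Sum>i<n. u i \<mu>) (\<Sum>i. u i \<mu>) < e" "\<mu> \<in> D"
      then have le: "norm ((\<Sum>i<n. u i \<mu>) - (\<Sum>i. u i \<mu>)) \<le> e" by (simp add: dist_norm less_imp_le)
      have "(\<Sum>i<n. h *\<^sub>C u i \<mu>) - h *\<^sub>C (\<Sum>i. u i \<mu>) = h *\<^sub>C ((\<Sum>i<n. u i \<mu>) - (\<Sum>i. u i \<mu>))"
        by (simp add: complex_vector.scale_sum_right complex_vector.scale_right_diff_distrib)
      then have "norm ((\<Sum>i<n. h *\<^sub>C u i \<mu>) - h *\<^sub>C (\<Sum>i. u i \<mu>))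
          = cmod h * norm ((\<Sum>i<n. u i \<mu>) - (\<Sum>i. u i \<mu>))" by (simp add: norm_scaleC)
      then show "norm ((\<Sum>i<n. h *\<^sub>C u i \<mu>) - h *\<^sub>C (\<Sum>i. u i \<mu>)) \<le> e * norm h"
        using mult_left_mono[OF le, of "cmod h"] by (simp add: mult.commute)
    qed
    show "0 \<in> D" unfolding D_def using C by simp
    show "(\<lambda>n. 0 ^ n *\<^sub>C x n) sums (\<Sum>n\<in>{0}. 0 ^ n *\<^sub>C x n)"
      by (rule sums_finite) auto
  qed
  then obtain f where f: "\<And>\<mu>. \<mu> \<in> D \<Longrightarrow> (\<lambda>n. \<mu> ^ n *\<^sub>C x n) sums f \<mu>"
    "\<And>\<mu>. \<mu> \<in> D \<Longrightarrow> (f has_derivative (\<lambda>h. h *\<^sub>C (\<Sum>i. u i \<mu>))) (at \<mu> within D)" by blast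
  have "vector_analytic_on f D"
    unfolding vector_analytic_on_def using f(2) at_within_open[of _ D] unfolding D_def by (metis open_ball)
  then show thesis using that f(1) unfolding D_def by blast
qed

lemma bounded_ops_sums:
  assumes T: "T \<in> bounded_ops E" and E: "closed_subspace E" and y: "\<And>n. y n \<in> E" "y sums l"
  shows "l \<in> E" "(\<lambda>n. T (y n)) sums T l"
proof -
  have part: "(\<Sum>i<n. y i) \<in> E" for n
    using y(1) closed_subspaceD(2)[OF E] by (intro complex_vector.subspace_sum) auto
  have lim: "(\<lambda>n. \<Sum>i<n. y i) \<longlonglongrightarrow> l" using y(2) unfolding sums_def .
  show l: "l \<in> E" using closed_sequentially[OF closed_subspaceD(1)[OF E] _ lim] part by blast
  have "T (\<Sum>i<n. y i) = (\<Sum>i<n. T (y i))" for n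
    using part y(1) bounded_opsD(2)[OF T] bounded_ops_zero[OF T closed_subspaceD(4)[OF E]] by (induction n) auto
  moreover have "(\<lambda>n. T (\<Sum>i<n. y i)) \<longlonglongrightarrow> T l"
    using continuous_on_tendsto_compose[OF bounded_ops_continuous[OF T closed_subspaceD(2)[OF E]] lim l] part by simp
  ultimately show "(\<lambda>n. T (y n)) sums T l" unfolding sums_def by simp
qed

text \<open>In a Kato operator the kernel lies in all ranges \<open>S\<^sup>n E\<close>, so every preimage of a vector of their
  intersection \<open>R\<close> is again in \<open>R\<close>. A kernel vector \<open>x\<^sub>0\<close> therefore starts a backward orbit
  \<open>S x\<^sub>n\<^sub>+\<^sub>1 = x\<^sub>n\<close>, and the open mapping theorem keeps its growth geometric. The power series with
  these coefficients is multiplied by \<open>\<mu>\<close> when \<open>S\<close> is applied, and it does not vanish near \<open>0\<close>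
  because its value at \<open>0\<close> is \<open>x\<^sub>0\<close>.\<close>
lemma Kato_eigenvectors:
  assumes E: "closed_subspace E" and S: "S \<in> bounded_ops E" and K: "Kato E S"
    and nz: "null_space E S \<noteq> {0}"
  obtains r f where "r > 0" "vector_analytic_on f (ball 0 r)"
    "\<And>\<mu>. \<mu> \<in> ball 0 r \<Longrightarrow> f \<mu> \<in> E \<and> S (f \<mu>) = \<mu> *\<^sub>C f \<mu> \<and> f \<mu> \<noteq> 0"
proof -
  define R where "R = (\<Inter>n. (S ^^ n) ` E)"
  have cl: "closed (S ` E)" and sub: "\<And>n. null_space E S \<subseteq> (S ^^ n) ` E" using K unfolding Kato_def by auto
  obtain C where C: "C > 0" "\<And>y. y \<in> S ` E \<Longrightarrow> \<exists>x\<in>E. S x = y \<and> norm x \<le> C * norm y"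
    using range_open_mapping[OF S E order_refl cl] by blast
  have step: "\<exists>x. x \<in> R \<and> S x = y \<and> norm x \<le> C * norm y" if y: "y \<in> R" for y
  proof -
    have yn: "y \<in> (S ^^ Suc n) ` E" for n using y unfolding R_def by blast
    then have "y \<in> S ` E" using yn[of 0] by simp
    then obtain x where x: "x \<in> E" "S x = y" "norm x \<le> C * norm y" using C(2) by blast
    have "x \<in> (S ^^ n) ` E" for n
    proof -
      obtain w where w: "w \<in> E" "y = (S ^^ Suc n) w" using yn by blast
      define v where "v = (S ^^ n) w"
      have v: "v \<in> E" "S v = y" "v \<in> (S ^^ n) ` E"
        using w bounded_opsD(1)[OF bounded_ops_funpow[OF S] w(1)] unfolding v_def by auto
      have "x - v \<in> null_space E S"
        using bounded_ops_diff[OF S closed_subspaceD(2)[OF E] x(1) v(1)] closed_subspaceD(6)[OF E x(1) v(1)] x(2) v(2)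
        unfolding null_space_def by simp
      then have "x - v \<in> (S ^^ n) ` E" using sub by blast
      then have "(x - v) + v \<in> (S ^^ n) ` E"
        using complex_vector.subspace_add[OF subspace_range[OF bounded_ops_funpow[OF S] closed_subspaceD(2)[OF E] order_refl]] v(3)
        by blast
      then show ?thesis by simp
    qed
    then show ?thesis using x unfolding R_def by blast
  qed
  have zero: "0 \<in> null_space E S"
    using closed_subspaceD(4)[OF closed_subspace_null_space[OF S E]] .
  then obtain x0 where x0: "x0 \<in> null_space E S" "x0 \<noteq> 0" using nz by blast
  have x0R: "x0 \<in> R" using x0(1) sub unfolding R_def by blast
  obtain s where s: "\<And>y. y \<in> R \<Longrightarrow> s y \<in> R \<and> S (s y) = y \<and> norm (s y) \<le> C * norm y" using step by metis
  define x where "x n = (s ^^ n) x0" for n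
  have xR: "x n \<in> R" for n by (induction n) (use s x0R in \<open>auto simp: x_def\<close>)
  have xE: "x n \<in> E" for n using xR[of n] unfolding R_def by (auto dest: spec[of _ 0])
  have xS: "S (x (Suc n)) = x n" for n using s xR[of n] by (simp add: x_def)
  have xb: "norm (x n) \<le> norm x0 * C ^ n" for n
  proof (induction n)
    case (Suc n)
    have "norm (x (Suc n)) \<le> C * norm (x n)" using s xR[of n] by (simp add: x_def)
    also have "\<dots> \<le> C * (norm x0 * C ^ n)" using Suc C(1) by (intro mult_left_mono) auto
    finally show ?case by (simp add: algebra_simps)
  qed (simp add: x_def)
  define D where "D = ball (0::complex) (1 / (2 * C))"
  obtain f where f: "vector_analytic_on f D" "\<And>\<mu>. \<mu> \<in> D \<Longrightarrow> (\<lambda>n. \<mu> ^ n *\<^sub>C x n) sums f \<mu>"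
    using vector_power_series[OF C(1) xb] unfolding D_def by blast
  have eig: "f \<mu> \<in> E \<and> S (f \<mu>) = \<mu> *\<^sub>C f \<mu>" if \<mu>: "\<mu> \<in> D" for \<mu>
  proof -
    have tE: "\<mu> ^ n *\<^sub>C x n \<in> E" for n by (rule closed_subspaceD(7)[OF E xE])
    have s1: "(\<lambda>n. S (\<mu> ^ n *\<^sub>C x n)) sums S (f \<mu>)" by (rule bounded_ops_sums(2)[OF S E tE f(2)[OF \<mu>]])
    have "(\<lambda>n. \<mu> *\<^sub>C \<mu> ^ n *\<^sub>C x n) sums (\<mu> *\<^sub>C f \<mu>)"
      by (rule bounded_linear.sums[OF bounded_linear_scaleC_right f(2)[OF \<mu>]])
    then have "(\<lambda>n. S (\<mu> ^ Suc n *\<^sub>C x (Suc n))) sums (\<mu> *\<^sub>C f \<mu>)"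
      using bounded_opsD(3)[OF S xE] xS by simp
    moreover have "S (\<mu> ^ 0 *\<^sub>C x 0) = 0" using x0(1) unfolding null_space_def x_def by simp
    ultimately have "(\<lambda>n. S (\<mu> ^ n *\<^sub>C x n)) sums (\<mu> *\<^sub>C f \<mu>)"
      using sums_Suc_iff[of "\<lambda>n. S (\<mu> ^ n *\<^sub>C x n)" "\<mu> *\<^sub>C f \<mu>"] by simp
    then show ?thesis using sums_unique2[OF s1] bounded_ops_sums(1)[OF S E tE f(2)[OF \<mu>]] by simp
  qed
  have D0: "0 \<in> D" unfolding D_def using C(1) by simp
  have "(\<lambda>n. 0 ^ n *\<^sub>C x n) sums (\<Sum>n\<in>{0}. 0 ^ n *\<^sub>C x n)" by (rule sums_finite) auto
  then have f0: "f 0 = x0" using sums_unique2[OF f(2)[OF D0]] by (simp add: x_def)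
  obtain v where "(f has_derivative (\<lambda>h. h *\<^sub>C v)) (at 0)" using f(1) D0 unfolding vector_analytic_on_def by blast
  then have "continuous (at 0) f" by (rule has_derivative_continuous)
  then obtain e where e: "e > 0" "\<And>\<mu>. dist 0 \<mu> < e \<Longrightarrow> f \<mu> \<noteq> 0"
    using continuous_at_avoid[of 0 f 0] f0 x0(2) by auto
  show thesis
  proof (rule that[of "min e (1 / (2 * C))" f])
    show "min e (1 / (2 * C)) > 0" using e C by simp
    show "vector_analytic_on f (ball 0 (min e (1 / (2 * C))))"
      using f(1) unfolding vector_analytic_on_def D_def by auto
    show "f \<mu> \<in> E \<and> S (f \<mu>) = \<mu> *\<^sub>C f \<mu> \<and> f \<mu> \<noteq> 0" if "\<mu> \<in> ball 0 (min e (1 / (2 * C)))" for \<mu>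
      using eig e(2) that unfolding D_def by auto
  qed
qed

section \<open>Riesz operators\<close>

text \<open>Take the member of the chain with the smallest spanning set. A basis of a later member is at
  least as large, so it cannot miss a vector of the chosen one.\<close>
lemma finite_dim_decreasing_stable:
  assumes sub: "\<And>n. complex_vector.subspace (V n)" and dec: "\<And>m n. m \<le> n \<Longrightarrow> V n \<subseteq> V m"
    and fd: "finite_dim (V 0)"
  obtains n0 where "\<And>n. n \<ge> n0 \<Longrightarrow> V n = V (n0 :: nat)"
proof -
  define P where "P k \<longleftrightarrow> (\<exists>n B. finite B \<and> card B = k \<and> V n = complex_vector.span B)" for k
  obtain B0 where "finite B0" "V 0 = complex_vector.span B0" using fd unfolding finite_dim_def by blast
  then have "P (card B0)" unfolding P_def by blast
  then have "P (LEAST k. P k)" by (rule LeastI)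
  then obtain n0 B where B: "finite B" "card B = (LEAST k. P k)" "V n0 = complex_vector.span B" unfolding P_def by blast
  have "V n = V n0" if n: "n \<ge> n0" for n
  proof (rule equalityI[OF dec[OF n]], rule ccontr)
    obtain C where C: "C \<subseteq> V n" "complex_vector.independent C" "V n \<subseteq> complex_vector.span C"
      using complex_vector.maximal_independent_subset by blast
    have sp: "V n = complex_vector.span C" using complex_vector.span_minimal[OF C(1) sub] C(3) by blast
    have CB: "C \<subseteq> complex_vector.span B" using C(1) dec[OF n] B(3) by blast
    have fC: "finite C" using complex_vector.independent_span_bound[OF B(1) C(2) CB] by blast
    then have "P (card C)" using sp unfolding P_def by blast
    then have le: "card B \<le> card C" unfolding B(2) by (rule Least_le)
    assume "\<not> V n0 \<subseteq> V n"
    then obtain b where b: "b \<in> V n0" "b \<notin> complex_vector.span C" using sp by blast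
    have "card (insert b C) \<le> card B"
      using complex_vector.independent_span_bound[OF B(1) complex_vector.independent_insertI[OF b(2) C(2)]] CB b(1) B(3)
      by blast
    moreover have "b \<notin> C" using b(2) complex_vector.span_base by blast
    ultimately show False using le fC by simp
  qed
  then show thesis using that by blast
qed

text \<open>The spaces \<open>N(S) \<inter> S\<^sup>n E\<close> decrease within the kernel, which has finite dimension, so they become
  constant from some \<open>n0\<close> on. This says that \<open>S\<close> restricted to the range of \<open>S\<close> to the power \<open>n0\<close> is
  Kato; it has a kernel because the ascent is infinite.\<close>
lemma infinite_ascent_eigenvalues:
  assumes E: "closed_subspace E" and S: "S \<in> bounded_ops E" and cl: "closed (S ` E)"
    and fd: "finite_dim (null_space E S)" and asc: "\<not> ascent E S < \<infinity>"
  obtains r where "r > 0" "\<And>\<mu>. cmod \<mu> < r \<Longrightarrow> null_space E (shift S \<mu>) \<noteq> {0}"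
proof -
  have R: "closed_subspace ((S ^^ n) ` E)" for n by (rule closed_subspace_funpow_range[OF E S cl fd])
  have N: "closed_subspace (null_space E S)" by (rule closed_subspace_null_space[OF S E])
  obtain n0 where n0: "\<And>n. n \<ge> n0 \<Longrightarrow> null_space E S \<inter> (S ^^ n) ` E = null_space E S \<inter> (S ^^ n0) ` E"
  proof (rule finite_dim_decreasing_stable[of "\<lambda>n. null_space E S \<inter> (S ^^ n) ` E"])
    show "complex_vector.subspace (null_space E S \<inter> (S ^^ n) ` E)" for n
      using closed_subspaceD(2)[OF closed_subspace_Int[OF N R]] .
    show "null_space E S \<inter> (S ^^ n) ` E \<subseteq> null_space E S \<inter> (S ^^ m) ` E" if "m \<le> n" for m n
      using funpow_range_subset[OF S that] by blast
    have "null_space E S \<inter> (S ^^ 0) ` E = null_space E S" unfolding null_space_def by auto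
    then show "finite_dim (null_space E S \<inter> (S ^^ 0) ` E)" using fd by simp
  qed blast
  define F where "F = (S ^^ n0) ` E"
  have F: "closed_subspace F" unfolding F_def by (rule R)
  have FE: "F \<subseteq> E" using funpow_range_subset[OF S, of 0 n0] unfolding F_def by simp
  have pow: "(S ^^ n) ` F = (S ^^ (n + n0)) ` E" for n unfolding F_def by (simp add: image_comp funpow_add)
  have "S ` F \<subseteq> F"
    using pow[of 1] funpow_range_subset[OF S, of n0 "1 + n0"] unfolding F_def by simp
  then have SF: "S \<in> bounded_ops F" by (intro bounded_ops_restrict[OF S FE]) blast
  have nF: "null_space F S = null_space E S \<inter> (S ^^ n0) ` E" using FE unfolding null_space_def F_def by auto
  have "Kato F S"
    unfolding Kato_def
  proof (intro conjI allI)
    show "closed (S ` F)" using closed_subspaceD(1)[OF R[of "1 + n0"]] pow[of 1] by simp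
    show "null_space F S \<subseteq> (S ^^ n) ` F" for n unfolding pow nF using n0[of "n + n0"] by auto
  qed
  moreover have "null_space F S \<noteq> {0}" using asc unfolding ascent_finite_iff nF by blast
  ultimately obtain r f where r: "r > 0"
    and f: "\<And>\<mu>. \<mu> \<in> ball 0 r \<Longrightarrow> f \<mu> \<in> F \<and> S (f \<mu>) = \<mu> *\<^sub>C f \<mu> \<and> f \<mu> \<noteq> 0"
    using Kato_eigenvectors[OF F SF] by metis
  have "null_space E (shift S \<mu>) \<noteq> {0}" if "cmod \<mu> < r" for \<mu>
  proof -
    have "f \<mu> \<in> null_space E (shift S \<mu>)" "f \<mu> \<noteq> 0"
      using f[of \<mu>] that FE unfolding null_space_def shift_def by auto
    then show ?thesis by blast
  qed
  then show thesis using that r by blast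
qed

lemma shift_shift: "shift (shift T c) \<mu> = shift T (c + \<mu>)"
  unfolding shift_def by (simp add: scaleC_add_left fun_eq_iff)

text \<open>A finite ascent at \<open>c\<close> makes the neighbouring shifts injective, hence of ascent \<open>0\<close>; an infinite
  one produces eigenvalues in a whole neighbourhood of \<open>c\<close>, at none of which the ascent can be
  finite, since eigenvalues of finite ascent are isolated. So both cases are open conditions on \<open>c\<close> in the
  connected punctured plane, and for \<open>\<bar>c\<bar>\<close> beyond the norm the ascent is \<open>0\<close>.\<close>
theorem Riesz_finite_ascent:
  assumes E: "closed_subspace E" and T: "T \<in> bounded_ops E" and R: "Riesz E T" and c: "c \<noteq> 0"
  shows "ascent E (shift T c) < \<infinity>"
proof -
  have S: "shift T c \<in> bounded_ops E" for c by (rule bounded_ops_shift[OF T closed_subspaceD(2)[OF E]])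
  have fd: "finite_dim (null_space E (shift T c))" and cl: "closed (shift T c ` E)" if "c \<noteq> 0" for c
    using R that complemented_range_of_finite_codim[OF E S] unfolding Riesz_def complemented_def by blast+
  define G where "G = {c. c \<noteq> 0 \<and> ascent E (shift T c) < \<infinity>}"
  define H where "H = {c. c \<noteq> 0 \<and> \<not> ascent E (shift T c) < \<infinity>}"
  have isol: "\<exists>e>0. \<forall>d. d \<noteq> c \<and> cmod (d - c) < e \<longrightarrow> null_space E (shift T d) = {0}" if "c \<in> G" for c
  proof -
    have c: "c \<noteq> 0" "ascent E (shift T c) < \<infinity>" using that unfolding G_def by auto
    have "upper_Drazin_invertible E (shift T c)"
      using c closed_subspaceD(1)[OF closed_subspace_funpow_range[OF E S cl[OF c(1)] fd[OF c(1)]]]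
      unfolding upper_Drazin_invertible_def by blast
    then obtain e where e: "e > 0" "\<And>\<mu>. \<mu> \<noteq> 0 \<Longrightarrow> cmod \<mu> < e \<Longrightarrow> null_space E (shift (shift T c) \<mu>) = {0}"
      using upper_Drazin_punctured_injective[OF E S] by blast
    then show ?thesis unfolding shift_shift by (metis add.commute diff_add_cancel right_minus_eq)
  qed
  have inj_asc: "ascent E (shift T d) < \<infinity>" if "null_space E (shift T d) = {0}" for d
    using that closed_subspaceD(4)[OF E] unfolding ascent_finite_iff by (intro exI[of _ 0]) auto
  have "open G"
    unfolding open_dist
  proof
    fix c assume c: "c \<in> G"
    obtain e where e: "e > 0" "\<And>d. d \<noteq> c \<Longrightarrow> cmod (d - c) < e \<Longrightarrow> null_space E (shift T d) = {0}"
      using isol[OF c] by blast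
    show "\<exists>e>0. \<forall>d. dist d c < e \<longrightarrow> d \<in> G"
    proof (intro exI[of _ "min e (cmod c)"] conjI allI impI)
      show "min e (cmod c) > 0" using e c unfolding G_def by simp
      fix d assume d: "dist d c < min e (cmod c)"
      have "d \<noteq> 0" using d by (auto simp: dist_norm)
      then show "d \<in> G"
        using e(2)[of d] d c inj_asc unfolding G_def by (cases "d = c") (auto simp: dist_norm)
    qed
  qed
  moreover have "open H"
    unfolding open_dist
  proof
    fix c assume c: "c \<in> H"
    then have c0: "c \<noteq> 0" and na: "\<not> ascent E (shift T c) < \<infinity>" unfolding H_def by auto
    obtain r where r: "r > 0" "\<And>\<mu>. cmod \<mu> < r \<Longrightarrow> null_space E (shift (shift T c) \<mu>) \<noteq> {0}"
      using infinite_ascent_eigenvalues[OF E S cl[OF c0] fd[OF c0] na] by metis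
    have r': "null_space E (shift T d) \<noteq> {0}" if "cmod (d - c) < r" for d
      using r(2)[OF that] unfolding shift_shift by simp
    show "\<exists>e>0. \<forall>d. dist d c < e \<longrightarrow> d \<in> H"
    proof (intro exI[of _ "min r (cmod c)"] conjI allI impI)
      show "min r (cmod c) > 0" using r c0 by simp
      fix d assume d: "dist d c < min r (cmod c)"
      then have d0: "d \<noteq> 0" and dr: "cmod (d - c) < r" by (auto simp: dist_norm)
      have "d \<notin> G"
      proof
        assume dG: "d \<in> G"
        obtain e where e: "e > 0" "\<And>b. b \<noteq> d \<Longrightarrow> cmod (b - d) < e \<Longrightarrow> null_space E (shift T b) = {0}"
          using isol[OF dG] by metis
        \<comment> \<open>a shift by \<open>t\<close> stays in the disc around \<open>c\<close> and in the punctured disc around \<open>d\<close>\<close>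
        define t where "t = min e (r - cmod (d - c)) / 2"
        have t: "t > 0" "t < e" "t < r - cmod (d - c)" using e(1) dr unfolding t_def by auto
        define b where "b = d + complex_of_real t"
        have "b \<noteq> d" "cmod (b - d) < e" using t unfolding b_def by auto
        moreover have "cmod (b - c) < r"
          using norm_triangle_ineq[of "d - c" "complex_of_real t"] t unfolding b_def by (simp add: algebra_simps)
        ultimately show False using e(2)[of b] r'[of b] by simp
      qed
      then show "d \<in> H" using d0 unfolding G_def H_def by blast
    qed
  qed
  moreover have "G \<inter> H = {}" "- {0} \<subseteq> G \<union> H" unfolding G_def H_def by auto
  moreover have "connected (- {0 :: complex})"
    by (rule connected_punctured_universe) simp
  moreover have "G \<inter> - {0} \<noteq> {}"
  proof -
    obtain L where L: "L > 0" "\<And>x. x \<in> E \<Longrightarrow> norm (T x) \<le> L * norm x" using bounded_ops_bound[OF T] by blast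
    define d where "d = complex_of_real (L + 1)"
    have "x = 0" if "x \<in> null_space E (shift T d)" for x
    proof -
      have "x \<in> E" "T x = d *\<^sub>C x" using that unfolding null_space_def shift_def by auto
      then have "(L + 1) * norm x \<le> L * norm x" using L by (metis norm_scaleC d_def norm_of_real abs_of_pos add_pos_pos zero_less_one)
      then show ?thesis by (simp add: algebra_simps)
    qed
    then have "null_space E (shift T d) = {0}"
      using closed_subspaceD(4)[OF closed_subspace_null_space[OF S E]] by blast
    moreover have "d \<noteq> 0" using L(1) unfolding d_def by (metis add_pos_pos less_irrefl of_real_eq_0_iff zero_less_one)
    ultimately have "d \<in> G" using inj_asc unfolding G_def by blast
    then show ?thesis using \<open>d \<noteq> 0\<close> by blast
  qed
  ultimately have "H \<inter> - {0} = {}" unfolding connected_def by blast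
  then show ?thesis using c unfolding H_def by blast
qed

section \<open>Left Browder operators\<close>

lemma bounded_ops_summand:
  assumes T: "T \<in> bounded_ops E" and ds: "direct_sum E M N" and inv: "T ` M \<subseteq> M"
  shows "T \<in> bounded_ops M"
  using inv by (intro bounded_ops_restrict[OF T direct_sumD(1)[OF ds]]) blast

text \<open>If \<open>q\<close> projects onto the range of \<open>T\<close> and \<open>p\<close> projects onto \<open>M\<close> along \<open>N\<close>, then \<open>p q\<close>,
  restricted to \<open>M\<close>, projects onto the range of \<open>T\<close> on \<open>M\<close>.\<close>
lemma left_Browder_summand:
  assumes E: "closed_subspace E" and T: "T \<in> bounded_ops E" and LB: "left_Browder E T"
    and ds: "direct_sum E M N" and cl: "closed M" "closed N" and inv: "T ` M \<subseteq> M" "T ` N \<subseteq> N"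
  shows "left_Browder M T"
proof -
  note D = direct_sumD[OF ds]
  have M: "closed_subspace M" using closed_subspace_summand[OF ds cl(1)] .
  have TM: "T \<in> bounded_ops M" by (rule bounded_ops_summand[OF T ds inv(1)])
  have sub: "null_space M T \<subseteq> null_space E T" using D(1) unfolding null_space_def by auto
  have "finite_dim (null_space M T)"
    using LB finite_dim_subspace[OF _ closed_subspaceD(2)[OF closed_subspace_null_space[OF TM M]] sub]
    unfolding left_Browder_def by blast
  moreover have "ascent M T < \<infinity>"
  proof -
    obtain n where n: "null_space E T \<inter> (T ^^ n) ` E = {0}"
      using LB unfolding left_Browder_def ascent_finite_iff by blast
    have "(T ^^ n) ` M \<subseteq> (T ^^ n) ` E" using D(1) by (rule image_mono)
    then have "null_space M T \<inter> (T ^^ n) ` M \<subseteq> {0}" using sub n by blast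
    moreover have "0 \<in> null_space M T"
      using closed_subspaceD(4)[OF closed_subspace_null_space[OF TM M]] .
    moreover have "0 \<in> (T ^^ n) ` M"
      using complex_vector.subspace_0[OF subspace_range[OF bounded_ops_funpow[OF TM] D(4) order_refl]] .
    ultimately have "null_space M T \<inter> (T ^^ n) ` M = {0}" by blast
    then show ?thesis unfolding ascent_finite_iff by blast
  qed
  moreover have "complemented M (T ` M)"
  proof -
    have "complemented E (T ` E)" using LB unfolding left_Browder_def by blast
    then obtain q where q: "q \<in> bounded_ops E" "\<forall>x\<in>E. q x \<in> T ` E" "\<forall>x\<in>T ` E. x \<in> E \<and> q x = x"
      unfolding complemented_iff_projection[OF E] by metis
    obtain p where p: "p \<in> bounded_ops E" "\<forall>x\<in>E. p x \<in> M \<and> x - p x \<in> N" "\<forall>x\<in>M. p x = x" "\<forall>x\<in>N. p x = 0"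
      using direct_sum_projection[OF E ds cl] by metis
    have pT: "p x \<in> T ` M" if x: "x \<in> T ` E" for x
    proof -
      obtain m n where mn: "m \<in> M" "n \<in> N" "x = T (m + n)" using x D(6) by blast
      have "x = T m + T n" using mn bounded_opsD(2)[OF T] D(1,2) by blast
      moreover have "T m \<in> M" "T n \<in> N" using inv mn by blast+
      ultimately have "p x = T m" using bounded_opsD(2)[OF p(1)] p(3,4) D(1,2) by fastforce
      then show ?thesis using mn(1) by blast
    qed
    have "(\<lambda>x. p (q x)) \<in> bounded_ops M"
      using p(2) q(2) bounded_opsD(1)[OF q(1)] D(1)
      by (intro bounded_ops_restrict[OF bounded_ops_comp[OF p(1) q(1)] D(1)]) blast
    moreover have "\<forall>x\<in>M. p (q x) \<in> T ` M" using pT q(2) D(1) by blast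
    moreover have "\<forall>x\<in>T ` M. x \<in> M \<and> p (q x) = x"
    proof
      fix x assume x: "x \<in> T ` M"
      then have "x \<in> M" "x \<in> T ` E" using inv(1) D(1) by blast+
      moreover have "q x = x" using q(3) \<open>x \<in> T ` E\<close> by blast
      ultimately show "x \<in> M \<and> p (q x) = x" using p(3) by simp
    qed
    ultimately show ?thesis unfolding complemented_iff_projection[OF M] by (intro bexI[of _ "\<lambda>x. p (q x)"]) auto
  qed
  ultimately show ?thesis unfolding left_Browder_def by blast
qed

text \<open>This splits off one Jordan chain at the eigenvalue \<open>0\<close>. Since the ascent is finite, some range
  \<open>T\<^sup>n E\<close> misses a kernel vector; let \<open>n = k + 1\<close> be minimal and let \<open>e\<close> be such a vector, so that
  \<open>e = T\<^sup>k x\<close>. The chain \<open>x, T x, \<dots>, T\<^sup>k x = e\<close> spans \<open>W\<close>. With a functional \<open>\<phi>\<close> that vanishes on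
  \<open>T\<^sup>n E\<close> and is \<open>1\<close> at \<open>e\<close>, the conditions \<open>\<phi> (T\<^sup>i y) = 0\<close> for \<open>i \<le> k\<close> cut out an invariant
  complement \<open>M\<close> of \<open>W\<close>: the matrix \<open>\<phi> (T\<^sup>i\<^sup>+\<^sup>j x)\<close> has entries \<open>1\<close> for \<open>i + j = k\<close> and \<open>0\<close> for
  \<open>i + j > k\<close>, so it is invertible.\<close>
lemma Kato_peel:
  assumes E: "closed_subspace E" and T: "T \<in> bounded_ops E" and cl: "closed (T ` E)"
    and fd: "finite_dim (null_space E T)" and asc: "ascent E T < \<infinity>" and nz: "null_space E T \<noteq> {0}"
  shows "\<exists>M W e. closed_subspace M \<and> finite_dim W \<and> direct_sum E M W \<and> T ` M \<subseteq> M \<and> T ` W \<subseteq> W \<and>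
    e \<in> null_space E T \<and> e \<notin> M"
proof -
  have R: "closed_subspace ((T ^^ n) ` E)" for n by (rule closed_subspace_funpow_range[OF E T cl fd])
  note E' = closed_subspaceD(2)[OF E]
  note P = bounded_ops_funpow[OF T]
  obtain n where "null_space E T \<inter> (T ^^ n) ` E = {0}" using asc unfolding ascent_finite_iff by blast
  then have "\<not> null_space E T \<subseteq> (T ^^ n) ` E" using nz by (metis inf.absorb1)
  then obtain m where m: "\<not> null_space E T \<subseteq> (T ^^ m) ` E" "\<And>i. i < m \<Longrightarrow> null_space E T \<subseteq> (T ^^ i) ` E"
    using exists_least_iff[of "\<lambda>n. \<not> null_space E T \<subseteq> (T ^^ n) ` E"] by metis
  have "m \<noteq> 0"
  proof
    assume "m = 0"
    then show False using m(1) unfolding null_space_def by auto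
  qed
  then obtain k where k: "m = Suc k" using not0_implies_Suc by blast
  obtain e where e: "e \<in> null_space E T" "e \<notin> (T ^^ Suc k) ` E" using m(1) k by blast
  then obtain x where x: "x \<in> E" "e = (T ^^ k) x" using m(2)[of k] k by blast
  obtain \<phi> :: "'a \<Rightarrow> complex" where \<phi>: "bounded_linear \<phi>" "\<And>c x. \<phi> (c *\<^sub>C x) = c * \<phi> x"
    "\<And>v. v \<in> (T ^^ Suc k) ` E \<Longrightarrow> \<phi> v = 0" "\<phi> e = 1"
    using Hahn_Banach_separation[OF closed_subspaceD(2,1)[OF R] e(2)] by metis
  note \<phi>lin = bounded_linear.linear[OF \<phi>(1)]
  have ker: "closed_subspace {v. \<phi> v = 0}"
    unfolding closed_subspace_def
  proof
    show "closed {v. \<phi> v = 0}"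
      using continuous_closed_preimage_constant[OF bounded_linear.continuous_on[OF \<phi>(1) continuous_on_id] closed_UNIV]
      by simp
    show "complex_vector.subspace {v. \<phi> v = 0}"
      by (rule complex_vector.subspaceI) (auto simp: \<phi>(2) linear_0[OF \<phi>lin] linear_add[OF \<phi>lin])
  qed
  define M where "M = {y \<in> E. \<forall>i\<le>k. \<phi> ((T ^^ i) y) = 0}"
  define W where "W = complex_vector.span ((\<lambda>i. (T ^^ i) x) ` {..k})"
  have Meq: "M = (\<Inter>i\<in>{..k}. {y \<in> E. (T ^^ i) y \<in> {v. \<phi> v = 0}})" unfolding M_def by auto
  have M: "closed_subspace M"
    unfolding Meq closed_subspace_def
    using closed_subspace_preimage[OF P E ker] unfolding closed_subspace_def
    by (intro conjI closed_INT complex_vector.subspace_Int) auto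
  have zero_x: "(T ^^ i) x = 0" if "k < i" for i
  proof -
    have "(T ^^ i) x = (T ^^ (i - Suc k)) (T e)"
      unfolding x(2) using that funpow_add[of "i - Suc k" "Suc k" T] by simp
    also have "\<dots> = 0" using e(1) bounded_ops_zero[OF P closed_subspaceD(4)[OF E]] unfolding null_space_def by simp
    finally show ?thesis .
  qed
  have zero_\<phi>: "\<phi> ((T ^^ i) y) = 0" if "k < i" "y \<in> E" for i y
    using funpow_range_subset[OF T, of "Suc k" i] that \<phi>(3) by (metis Suc_leI imageI subsetD)
  have xE: "(T ^^ i) x \<in> E" for i by (rule bounded_opsD(1)[OF P x(1)])
  have xW: "(T ^^ i) x \<in> W" for i
    using zero_x[of i] complex_vector.span_zero complex_vector.span_base[of "(T ^^ i) x" "(\<lambda>i. (T ^^ i) x) ` {..k}"]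
    unfolding W_def by (cases "i \<le> k") auto
  have WE: "W \<subseteq> E" unfolding W_def by (rule complex_vector.span_minimal) (use xE E' in auto)
  have TM: "T ` M \<subseteq> M"
  proof
    fix z assume "z \<in> T ` M"
    then obtain y where y: "y \<in> M" "z = T y" by blast
    have yE: "y \<in> E" using y(1) unfolding M_def by blast
    have "\<phi> ((T ^^ i) z) = 0" if "i \<le> k" for i
    proof -
      have "(T ^^ i) z = (T ^^ Suc i) y" unfolding y(2) by (simp add: funpow_swap1)
      then show ?thesis using zero_\<phi>[of "Suc i" y] y(1) yE unfolding M_def by (cases "Suc i \<le> k") auto
    qed
    then show "z \<in> M" unfolding M_def using bounded_opsD(1)[OF T yE] y(2) by simp
  qed
  have TW: "T ` W \<subseteq> W"
  proof
    fix z assume "z \<in> T ` W"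
    then obtain w where w: "w \<in> W" "z = T w" by blast
    have "T w \<in> complex_vector.span (T ` (\<lambda>i. (T ^^ i) x) ` {..k})"
      using w(1) unfolding W_def by (intro span_image_bounded_ops[OF T E']) (use xE in auto)
    moreover have "T ((T ^^ i) x) \<in> W" for i using xW[of "Suc i"] by simp
    then have "complex_vector.span (T ` (\<lambda>i. (T ^^ i) x) ` {..k}) \<subseteq> W"
      by (intro complex_vector.span_minimal) (auto simp: W_def)
    ultimately show "z \<in> W" using w(2) by blast
  qed
  \<comment> \<open>solving the triangular system from \<open>i = k\<close> downwards\<close>
  have dec: "\<exists>w\<in>W. \<forall>i\<le>k. k < i + j \<longrightarrow> \<phi> ((T ^^ i) (y - w)) = 0" if y: "y \<in> E" and j: "j \<le> Suc k" for y j
    using j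
  proof (induction j)
    case 0
    show ?case by (rule bexI[of _ 0]) (auto simp: W_def complex_vector.span_zero)
  next
    case (Suc j)
    then obtain w where w: "w \<in> W" "\<And>i. i \<le> k \<Longrightarrow> k < i + j \<Longrightarrow> \<phi> ((T ^^ i) (y - w)) = 0" by auto
    define c where "c = \<phi> ((T ^^ (k - j)) (y - w))"
    have yw: "y - w \<in> E" using y w(1) WE closed_subspaceD(6)[OF E] by blast
    have "\<phi> ((T ^^ i) (y - (w + c *\<^sub>C (T ^^ j) x))) = 0" if i: "i \<le> k" "k < i + Suc j" for i
    proof -
      have "(T ^^ i) (y - (w + c *\<^sub>C (T ^^ j) x)) = (T ^^ i) ((y - w) - c *\<^sub>C (T ^^ j) x)"
        by (simp add: diff_diff_eq)
      also have "\<dots> = (T ^^ i) (y - w) - c *\<^sub>C (T ^^ i) ((T ^^ j) x)"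
        using bounded_ops_diff[OF P E' yw closed_subspaceD(7)[OF E xE]] bounded_opsD(3)[OF P xE] by simp
      also have "(T ^^ i) ((T ^^ j) x) = (T ^^ (i + j)) x" by (simp add: funpow_add)
      finally have eq: "\<phi> ((T ^^ i) (y - (w + c *\<^sub>C (T ^^ j) x))) = \<phi> ((T ^^ i) (y - w)) - c * \<phi> ((T ^^ (i + j)) x)"
        by (simp add: linear_diff[OF \<phi>lin] \<phi>(2))
      show ?thesis
      proof (cases "i + j = k")
        case True
        then have "i = k - j" by simp
        then show ?thesis unfolding eq True using \<phi>(4) x(2) c_def by simp
      next
        case False
        then show ?thesis unfolding eq using w(2)[of i] i zero_x[of "i + j"] linear_0[OF \<phi>lin] by simp
      qed
    qed
    moreover have "w + c *\<^sub>C (T ^^ j) x \<in> W"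
      using w(1) xW complex_vector.span_add complex_vector.span_scale unfolding W_def by blast
    ultimately show ?case by blast
  qed
  \<comment> \<open>the same system with right-hand side \<open>0\<close>: the coefficients of \<open>w\<close> vanish one by one\<close>
  have indep: "w \<in> complex_vector.span ((\<lambda>i. (T ^^ i) x) ` {j..k})"
    if w: "w \<in> M" "w \<in> W" and j: "j \<le> Suc k" for w j
    using j
  proof (induction j)
    case 0
    then show ?case using w(2) unfolding W_def by (simp add: atLeast0AtMost)
  next
    case (Suc j)
    then have jk: "j \<le> k" by simp
    then have "{j..k} = insert j {Suc j..k}" by auto
    then obtain c where c: "w - c *\<^sub>C (T ^^ j) x \<in> complex_vector.span ((\<lambda>i. (T ^^ i) x) ` {Suc j..k})"
      using Suc complex_vector.span_breakdown_eq[of w "(T ^^ j) x"] by auto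
    have "(\<lambda>i. (T ^^ i) x) ` {Suc j..k} \<subseteq> {u \<in> E. (T ^^ (k - j)) u \<in> {v. \<phi> v = 0}}"
    proof
      fix u assume "u \<in> (\<lambda>i. (T ^^ i) x) ` {Suc j..k}"
      then obtain i where i: "u = (T ^^ i) x" "Suc j \<le> i" by auto
      have "(T ^^ (k - j)) u = (T ^^ (k - j + i)) x" unfolding i(1) by (simp add: funpow_add)
      also have "\<dots> = 0" using i(2) jk by (intro zero_x) auto
      finally show "u \<in> {u \<in> E. (T ^^ (k - j)) u \<in> {v. \<phi> v = 0}}"
        using xE i(1) linear_0[OF \<phi>lin] by simp
    qed
    then have "complex_vector.span ((\<lambda>i. (T ^^ i) x) ` {Suc j..k}) \<subseteq> {u \<in> E. (T ^^ (k - j)) u \<in> {v. \<phi> v = 0}}"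
      by (rule complex_vector.span_minimal[OF _ closed_subspaceD(2)[OF closed_subspace_preimage[OF P E ker]]])
    then have "\<phi> ((T ^^ (k - j)) (w - c *\<^sub>C (T ^^ j) x)) = 0" using c by blast
    moreover have wE: "w \<in> E" using w(1) unfolding M_def by blast
    moreover have "(T ^^ (k - j)) (w - c *\<^sub>C (T ^^ j) x) = (T ^^ (k - j)) w - c *\<^sub>C (T ^^ (k - j)) ((T ^^ j) x)"
      using bounded_ops_diff[OF P E' wE closed_subspaceD(7)[OF E xE]] bounded_opsD(3)[OF P xE] by simp
    moreover have "(T ^^ (k - j)) ((T ^^ j) x) = e"
      using funpow_add[of "k - j" j T] jk x(2) by simp
    moreover have "\<phi> ((T ^^ (k - j)) w) = 0" using w(1) unfolding M_def by simp
    ultimately have "c = 0" by (simp add: linear_diff[OF \<phi>lin] \<phi>(2,4))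
    then show ?case using c by simp
  qed
  have "direct_sum E M W"
  proof (rule direct_sumI)
    show "complex_vector.subspace M" by (rule closed_subspaceD(2)[OF M])
    show "complex_vector.subspace W" unfolding W_def by simp
    show "M \<inter> W \<subseteq> {0}" using indep[of _ "Suc k"] by auto
    show "\<exists>m\<in>M. \<exists>w\<in>W. y = m + w" if y: "y \<in> E" for y
    proof -
      obtain w where w: "w \<in> W" "\<forall>i\<le>k. \<phi> ((T ^^ i) (y - w)) = 0" using dec[OF y, of "Suc k"] by auto
      have "y - w \<in> M" unfolding M_def using w y WE closed_subspaceD(6)[OF E] by blast
      moreover have "y = (y - w) + w" by simp
      ultimately show ?thesis using w(1) by blast
    qed
    show "m + w \<in> E" if "m \<in> M" "w \<in> W" for m w
      using that WE closed_subspaceD(5)[OF E] unfolding M_def by blast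
  qed
  moreover have "finite_dim W" unfolding finite_dim_def W_def by blast
  moreover have "e \<notin> M" using x(2) \<phi>(4) e(1) unfolding M_def by (auto dest: spec[of _ 0])
  ultimately show ?thesis using M TM TW e(1) by blast
qed

text \<open>Jordan chains are split off until the kernel is \<open>{0}\<close>; then the operator is left invertible
  because its range is complemented. The recursion ends since each chain takes a vector out of the
  kernel. The bound on the cardinality of independent subsets of the kernel measures this.\<close>
theorem left_Browder_decomposition:
  assumes "closed_subspace E" and "T \<in> bounded_ops E" and "left_Browder E T"
  shows "\<exists>M W. closed M \<and> finite_dim W \<and> direct_sum E M W \<and> T ` M \<subseteq> M \<and> T ` W \<subseteq> W \<and> left_invertible M T"
proof -
  have injective: "\<exists>M W. closed M \<and> finite_dim W \<and> direct_sum E M W \<and> T ` M \<subseteq> M \<and> T ` W \<subseteq> W \<and> left_invertible M T"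
    if E: "closed_subspace E" and T: "T \<in> bounded_ops E" and LB: "left_Browder E T" and nul: "null_space E T = {0}" for E
  proof -
    have "left_invertible E T"
      using LB nul left_invertible_iff_complemented_range[OF E T] unfolding left_Browder_def by blast
    moreover have "direct_sum E E {0}"
      using closed_subspaceD[OF E] by (intro direct_sumI) auto
    moreover have "T ` E \<subseteq> E" "T ` {0} \<subseteq> {0}"
      using bounded_opsD(1)[OF T] bounded_ops_zero[OF T closed_subspaceD(4)[OF E]] by auto
    ultimately show ?thesis using closed_subspaceD(1)[OF E] finite_dim_zero by blast
  qed
  have main: "\<exists>M W. closed M \<and> finite_dim W \<and> direct_sum E M W \<and> T ` M \<subseteq> M \<and> T ` W \<subseteq> W \<and> left_invertible M T"
    if "closed_subspace E" "T \<in> bounded_ops E" "left_Browder E T"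
      and "\<And>B. B \<subseteq> null_space E T \<Longrightarrow> complex_vector.independent B \<Longrightarrow> card B \<le> n"
    for E n
    using that
  proof (induction n arbitrary: E)
    case (0 E)
    have "x = 0" if x: "x \<in> null_space E T" for x
    proof (rule ccontr)
      assume "x \<noteq> 0"
      then show False using 0(4)[of "{x}"] x by simp
    qed
    then have "null_space E T = {0}"
      using closed_subspaceD(4)[OF closed_subspace_null_space[OF 0(2,1)]] by blast
    then show ?case by (rule injective[OF 0(1-3)])
  next
    case (Suc n E)
    note E = Suc.prems(1) and T = Suc.prems(2)
    have fd: "finite_dim (null_space E T)" using Suc.prems(3) unfolding left_Browder_def by blast
    show ?case
    proof (cases "null_space E T = {0}")
      case True
      then show ?thesis by (rule injective[OF Suc.prems(1-3)])
    next
      case False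
      then obtain M W e where MW: "closed_subspace M" "finite_dim W" "direct_sum E M W" "T ` M \<subseteq> M" "T ` W \<subseteq> W"
        and e: "e \<in> null_space E T" "e \<notin> M"
        using Kato_peel[OF E T] Suc.prems(3) unfolding left_Browder_def complemented_def by metis
      note D = direct_sumD[OF MW(3)]
      have TM: "T \<in> bounded_ops M" by (rule bounded_ops_summand[OF T MW(3,4)])
      have LB: "left_Browder M T"
        by (rule left_Browder_summand[OF E T Suc.prems(3) MW(3) closed_subspaceD(1)[OF MW(1)]
              closed_subspaceD(1)[OF closed_subspace_finite_dim[OF MW(2)]] MW(4,5)])
      have "card B \<le> n" if B: "B \<subseteq> null_space M T" "complex_vector.independent B" for B
      proof -
        have "complex_vector.span B \<subseteq> M"
          using B(1) D(4) unfolding null_space_def by (intro complex_vector.span_minimal) auto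
        then have enB: "e \<notin> complex_vector.span B" using e(2) by blast
        have sub: "insert e B \<subseteq> null_space E T" using B(1) e(1) D(1) unfolding null_space_def by auto
        have ind: "complex_vector.independent (insert e B)"
          by (rule complex_vector.independent_insertI[OF enB B(2)])
        obtain C where C: "finite C" "null_space E T = complex_vector.span C" using fd unfolding finite_dim_def by blast
        have "insert e B \<subseteq> complex_vector.span C" using sub C(2) by simp
        then have "finite (insert e B)"
          by (rule conjunct1[OF complex_vector.independent_span_bound[OF C(1) ind]])
        moreover have "e \<notin> B" using enB complex_vector.span_base by blast
        moreover have "card (insert e B) \<le> Suc n" by (rule Suc.prems(4)[OF sub ind])
        ultimately show ?thesis by simp
      qed
      then obtain M' W' where IH: "closed M'" "finite_dim W'" "direct_sum M M' W'" "T ` M' \<subseteq> M'" "T ` W' \<subseteq> W'"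
        "left_invertible M' T"
        using Suc.IH[OF MW(1) TM LB] by metis
      define V where "V = {w + w' | w w'. w \<in> W \<and> w' \<in> W'}"
      have "finite_dim V" unfolding V_def by (rule finite_dim_sum[OF MW(2) IH(2)])
      moreover have "T ` V \<subseteq> V"
        unfolding V_def using D(1,2) direct_sumD(2)[OF IH(3)] by (intro sum_invariant[OF T _ _ MW(5) IH(5)]) blast+
      moreover have "direct_sum E M' V" unfolding V_def by (rule direct_sum_assoc(1)[OF MW(3) IH(3)])
      ultimately show ?thesis using IH(1,4,6) by blast
    qed
  qed
  obtain C where C: "finite C" "null_space E T = complex_vector.span C"
    using assms(3) unfolding left_Browder_def finite_dim_def by blast
  show ?thesis
  proof (rule main[OF assms])
    show "card B \<le> card C" if "B \<subseteq> null_space E T" "complex_vector.independent B" for B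
      using complex_vector.independent_span_bound[OF C(1) that(2)] that(1) C(2) by simp
  qed
qed

section \<open>Direct sums of Riesz and of left Browder operators\<close>

lemma null_space_direct_sum:
  assumes T: "T \<in> bounded_ops E" and ds: "direct_sum E M N" and inv: "T ` M \<subseteq> M" "T ` N \<subseteq> N"
  shows "null_space E T = {m + n | m n. m \<in> null_space M T \<and> n \<in> null_space N T}"
proof (intro equalityI subsetI)
  note D = direct_sumD[OF ds]
  fix x assume "x \<in> null_space E T"
  then have x: "x \<in> E" "T x = 0" unfolding null_space_def by auto
  obtain m n where mn: "m \<in> M" "n \<in> N" "x = m + n" using D(6)[OF x(1)] by blast
  have "T m + T n = 0 + 0" using x(2) mn bounded_opsD(2)[OF T, of m n] D(1,2) by auto
  then have "T m = 0 \<and> T n = 0"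
    using mn inv complex_vector.subspace_0[OF D(4)] complex_vector.subspace_0[OF D(5)]
    by (intro direct_sum_unique[OF ds]) blast+
  then show "x \<in> {m + n | m n. m \<in> null_space M T \<and> n \<in> null_space N T}"
    using mn unfolding null_space_def by blast
next
  note D = direct_sumD[OF ds]
  fix x assume "x \<in> {m + n | m n. m \<in> null_space M T \<and> n \<in> null_space N T}"
  then obtain m n where mn: "x = m + n" "m \<in> M" "n \<in> N" "T m = 0" "T n = 0" unfolding null_space_def by blast
  then have "T x = 0" using bounded_opsD(2)[OF T, of m n] D(1,2) by auto
  then show "x \<in> null_space E T" using mn D(7) unfolding null_space_def by blast
qed

text \<open>Kernels and ranges decompose along the direct sum. Applied to all \<open>T - c\<close> with \<open>c \<noteq> 0\<close>, this
  lets the Riesz property pass between the sum and its summands.\<close>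
lemma Fredholm_direct_sum:
  assumes E: "closed_subspace E" and T: "T \<in> bounded_ops E" and ds: "direct_sum E M N"
    and cl: "closed M" "closed N" and inv: "T ` M \<subseteq> M" "T ` N \<subseteq> N"
  shows "finite_dim (null_space E T) \<and> finite_codim E (T ` E) \<longleftrightarrow>
    (finite_dim (null_space M T) \<and> finite_codim M (T ` M)) \<and> (finite_dim (null_space N T) \<and> finite_codim N (T ` N))"
proof -
  have half: "finite_dim (null_space M T) \<and> finite_codim M (T ` M)"
    if fin: "finite_dim (null_space E T) \<and> finite_codim E (T ` E)"
      and ds: "direct_sum E M N" and cl: "closed M" "closed N" and inv: "T ` M \<subseteq> M" "T ` N \<subseteq> N" for M N
  proof
    note D = direct_sumD[OF ds]
    have M: "closed_subspace M" by (rule closed_subspace_summand[OF ds cl(1)])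
    have TM: "T \<in> bounded_ops M" by (rule bounded_ops_summand[OF T ds inv(1)])
    show "finite_dim (null_space M T)"
      using fin D(1) by (intro finite_dim_subspace[OF _ closed_subspaceD(2)[OF closed_subspace_null_space[OF TM M]],
            of "null_space E T"]) (auto simp: null_space_def)
    obtain p where p: "p \<in> bounded_ops E" "\<forall>x\<in>E. p x \<in> M \<and> x - p x \<in> N" "\<forall>x\<in>M. p x = x" "\<forall>x\<in>N. p x = 0"
      using direct_sum_projection[OF E ds cl] by metis
    obtain B where B: "finite B" "B \<subseteq> E" "\<forall>x\<in>E. \<exists>y\<in>complex_vector.span B. x - y \<in> T ` E"
      using fin unfolding finite_codim_def by blast
    show "finite_codim M (T ` M)"
      unfolding finite_codim_def
    proof (intro exI[of _ "p ` B"] conjI ballI)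
      show "finite (p ` B)" using B(1) by simp
      show "p ` B \<subseteq> M" using p(2) B(2) by blast
      fix x assume x: "x \<in> M"
      then have xE: "x \<in> E" using D(1) by blast
      obtain y where y: "y \<in> complex_vector.span B" "x - y \<in> T ` E" using B(3) xE by blast
      then obtain z where z: "z \<in> E" "x - y = T z" by blast
      have yE: "y \<in> E" using y(1) complex_vector.span_minimal[OF B(2) closed_subspaceD(2)[OF E]] by blast
      obtain m n where mn: "m \<in> M" "n \<in> N" "z = m + n" using D(6)[OF z(1)] by blast
      have Tz: "T z = T m + T n" using mn D(1,2) bounded_opsD(2)[OF T] by blast
      have TmTn: "T m \<in> M" "T n \<in> N" using mn inv by blast+
      then have "p (T z) = p (T m) + p (T n)" unfolding Tz using D(1,2) bounded_opsD(2)[OF p(1)] by blast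
      then have "p (T z) = T m" using TmTn p(3,4) by simp
      moreover have "p (x - y) = x - p y"
        using bounded_ops_diff[OF p(1) closed_subspaceD(2)[OF E] xE yE] p(3) x by simp
      ultimately have "x - p y = T m" using z(2) by simp
      then show "\<exists>y\<in>complex_vector.span (p ` B). x - y \<in> T ` M"
        using mn(1) span_image_bounded_ops[OF p(1) closed_subspaceD(2)[OF E] B(2) y(1)] by blast
    qed
  qed
  have conv: "finite_dim (null_space E T) \<and> finite_codim E (T ` E)"
    if MN: "finite_dim (null_space M T)" "finite_codim M (T ` M)" "finite_dim (null_space N T)" "finite_codim N (T ` N)"
  proof
    note D = direct_sumD[OF ds]
    show "finite_dim (null_space E T)"
      unfolding null_space_direct_sum[OF T ds inv] by (rule finite_dim_sum[OF MN(1,3)])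
    obtain B where B: "finite B" "B \<subseteq> M" "\<forall>x\<in>M. \<exists>y\<in>complex_vector.span B. x - y \<in> T ` M"
      using MN(2) unfolding finite_codim_def by blast
    obtain C where C: "finite C" "C \<subseteq> N" "\<forall>x\<in>N. \<exists>y\<in>complex_vector.span C. x - y \<in> T ` N"
      using MN(4) unfolding finite_codim_def by blast
    show "finite_codim E (T ` E)"
      unfolding finite_codim_def
    proof (intro exI[of _ "B \<union> C"] conjI ballI)
      show "finite (B \<union> C)" "B \<union> C \<subseteq> E" using B C D(1,2) by auto
      fix x assume "x \<in> E"
      then obtain m n where mn: "m \<in> M" "n \<in> N" "x = m + n" using D(6) by blast
      obtain y u where y: "y \<in> complex_vector.span B" "u \<in> M" "m - y = T u" using B(3) mn(1) by blast
      obtain z v where z: "z \<in> complex_vector.span C" "v \<in> N" "n - z = T v" using C(3) mn(2) by blast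
      have "x - (y + z) = (m - y) + (n - z)" using mn(3) by simp
      also have "\<dots> = T (u + v)" unfolding y(3) z(3) using bounded_opsD(2)[OF T subsetD[OF D(1) y(2)] subsetD[OF D(2) z(2)]] by simp
      finally have "x - (y + z) \<in> T ` E" using D(7)[OF y(2) z(2)] by blast
      moreover have "y + z \<in> complex_vector.span (B \<union> C)"
        unfolding complex_vector.span_Un using y(1) z(1) by blast
      ultimately show "\<exists>y\<in>complex_vector.span (B \<union> C). x - y \<in> T ` E" by blast
    qed
  qed
  show ?thesis
    using half[OF _ ds cl inv] half[OF _ direct_sum_commute[OF ds] cl(2,1) inv(2,1)] conv by blast
qed

lemma shift_invariant:
  assumes "complex_vector.subspace M" "T ` M \<subseteq> M" shows "shift T c ` M \<subseteq> M"
  using assms complex_vector.subspace_diff[OF assms(1)] complex_vector.subspace_scale[OF assms(1)]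
  unfolding shift_def by blast

lemma Riesz_direct_sum:
  assumes E: "closed_subspace E" and T: "T \<in> bounded_ops E" and ds: "direct_sum E M N"
    and cl: "closed M" "closed N" and inv: "T ` M \<subseteq> M" "T ` N \<subseteq> N"
  shows "Riesz E T \<longleftrightarrow> Riesz M T \<and> Riesz N T"
  unfolding Riesz_def
  using Fredholm_direct_sum[OF E bounded_ops_shift[OF T closed_subspaceD(2)[OF E]] ds cl
      shift_invariant[OF direct_sumD(4)[OF ds] inv(1)] shift_invariant[OF direct_sumD(5)[OF ds] inv(2)]]
  by blast

lemma Riesz_cong:
  assumes "\<And>x. x \<in> E \<Longrightarrow> S x = T x" shows "Riesz E S \<longleftrightarrow> Riesz E T"
proof -
  have "null_space E (shift S c) = null_space E (shift T c)" "shift S c ` E = shift T c ` E" for c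
    using assms unfolding null_space_def shift_def by auto
  then show ?thesis unfolding Riesz_def by simp
qed

lemma Riesz_zero:
  assumes E: "complex_vector.subspace E" and T: "\<And>x. x \<in> E \<Longrightarrow> T x = 0" shows "Riesz E T"
  unfolding Riesz_def
proof (intro allI impI conjI)
  fix c :: complex assume c: "c \<noteq> 0"
  have "null_space E (shift T c) = {0}"
    using T c complex_vector.subspace_0[OF E] unfolding null_space_def shift_def by auto
  then show "finite_dim (null_space E (shift T c))" by simp
  have "x \<in> shift T c ` E" if x: "x \<in> E" for x
  proof (rule image_eqI)
    have y: "(- 1 / c) *\<^sub>C x \<in> E" using x by (rule complex_vector.subspace_scale[OF E])
    then show "(- 1 / c) *\<^sub>C x \<in> E" .
    show "x = shift T c ((- 1 / c) *\<^sub>C x)" unfolding shift_def T[OF y] using c by simp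
  qed
  then show "finite_codim E (shift T c ` E)"
    unfolding finite_codim_def by (intro exI[of _ "{}"]) auto
qed

lemma Riesz_finite_dim:
  assumes T: "T \<in> bounded_ops E" and E: "finite_dim E" shows "Riesz E T"
  unfolding Riesz_def
proof (intro allI impI conjI)
  fix c :: complex
  have Ec: "closed_subspace E" by (rule closed_subspace_finite_dim[OF E])
  have S: "shift T c \<in> bounded_ops E" by (rule bounded_ops_shift[OF T closed_subspaceD(2)[OF Ec]])
  show "finite_dim (null_space E (shift T c))"
    by (rule finite_dim_subspace[OF E closed_subspaceD(2)[OF closed_subspace_null_space[OF S Ec]]])
      (auto simp: null_space_def)
  obtain B where B: "finite B" "E = complex_vector.span B" using E unfolding finite_dim_def by blast
  have "0 \<in> shift T c ` E"
    using complex_vector.subspace_0[OF subspace_range[OF S closed_subspaceD(2)[OF Ec] order_refl]] .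
  then have "\<forall>x\<in>E. \<exists>y\<in>complex_vector.span B. x - y \<in> shift T c ` E"
    using B(2) by (metis diff_self)
  then show "finite_codim E (shift T c ` E)"
    unfolding finite_codim_def using B complex_vector.span_superset by blast
qed

lemma left_Browder_direct_sum:
  assumes E: "closed_subspace E" and T: "T \<in> bounded_ops E" and ds: "direct_sum E M N"
    and cl: "closed M" "closed N" and inv: "T ` M \<subseteq> M" "T ` N \<subseteq> N"
    and L: "left_invertible M T"
    and F: "finite_dim (null_space N T)" "finite_codim N (T ` N)" "ascent N T < \<infinity>"
  shows "left_Browder E T"
proof -
  note D = direct_sumD[OF ds]
  have M: "closed_subspace M" by (rule closed_subspace_summand[OF ds cl(1)])
  have N: "closed_subspace N" by (rule closed_subspace_summand[OF direct_sum_commute[OF ds] cl(2)])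
  have TM: "T \<in> bounded_ops M" by (rule bounded_ops_summand[OF T ds inv(1)])
  have TN: "T \<in> bounded_ops N" by (rule bounded_ops_summand[OF T direct_sum_commute[OF ds] inv(2)])
  have nM: "null_space M T = {0}" and cM: "complemented M (T ` M)"
    using L unfolding left_invertible_iff_complemented_range[OF M TM] by auto
  have nE: "null_space E T = null_space N T"
    unfolding null_space_direct_sum[OF T ds inv] nM by auto
  have "ascent E T < \<infinity>"
  proof -
    obtain n where n: "null_space N T \<inter> (T ^^ n) ` N = {0}" using F(3) unfolding ascent_finite_iff by blast
    have "x = 0" if x: "x \<in> null_space E T" "x \<in> (T ^^ n) ` E" for x
    proof -
      obtain u v where uv: "u \<in> M" "v \<in> N" "x = (T ^^ n) (u + v)" using x(2) D(6) by blast
      have "0 + x = (T ^^ n) u + (T ^^ n) v"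
        using uv(3) bounded_opsD(2)[OF bounded_ops_funpow[OF T] subsetD[OF D(1) uv(1)] subsetD[OF D(2) uv(2)]] by simp
      moreover have "x \<in> N" using x(1)[unfolded nE] unfolding null_space_def by blast
      ultimately have "x = (T ^^ n) v"
        using direct_sum_unique[OF ds, of 0 "(T ^^ n) u" x "(T ^^ n) v"] complex_vector.subspace_0[OF D(4)]
          bounded_opsD(1)[OF bounded_ops_funpow[OF TM] uv(1)] bounded_opsD(1)[OF bounded_ops_funpow[OF TN] uv(2)]
        by simp
      then have "x \<in> null_space N T \<inter> (T ^^ n) ` N" using x(1) uv(2) unfolding nE by blast
      then show ?thesis unfolding n by simp
    qed
    moreover have "0 \<in> null_space E T" "0 \<in> (T ^^ n) ` E"
      using closed_subspaceD(4)[OF closed_subspace_null_space[OF T E]]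
        complex_vector.subspace_0[OF subspace_range[OF bounded_ops_funpow[OF T] closed_subspaceD(2)[OF E] order_refl]]
      by auto
    ultimately have "null_space E T \<inter> (T ^^ n) ` E = {0}" by blast
    then show ?thesis unfolding ascent_finite_iff by blast
  qed
  moreover have "complemented E (T ` E)"
  proof -
    obtain p where p: "p \<in> bounded_ops E" "\<forall>x\<in>E. p x \<in> M \<and> x - p x \<in> N" "\<forall>x\<in>M. p x = x" "\<forall>x\<in>N. p x = 0"
      using direct_sum_projection[OF E ds cl] by metis
    obtain f where f: "f \<in> bounded_ops M" "\<forall>x\<in>M. f x \<in> T ` M" "\<forall>x\<in>T ` M. x \<in> M \<and> f x = x"
      using cM unfolding complemented_iff_projection[OF M] by metis
    obtain g where g: "g \<in> bounded_ops N" "\<forall>x\<in>N. g x \<in> T ` N" "\<forall>x\<in>T ` N. x \<in> N \<and> g x = x"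
      using complemented_range_of_finite_codim[OF N TN F(2)] unfolding complemented_iff_projection[OF N] by metis
    have p': "(\<lambda>x. x - p x) \<in> bounded_ops E"
      by (intro bounded_ops_minus_op bounded_ops_id p(1) closed_subspaceD(2) E)
    define q where "q x = f (p x) + g (x - p x)" for x
    have "q \<in> bounded_ops E"
      unfolding q_def using p(2) D(1,2)
      by (intro bounded_ops_add bounded_ops_comp_subspace[OF f(1) p(1)] bounded_ops_comp_subspace[OF g(1) p']
          closed_subspaceD(2)[OF E]) auto
    moreover have "\<forall>x\<in>E. q x \<in> T ` E"
    proof
      fix x assume "x \<in> E"
      then obtain u v where uv: "u \<in> M" "v \<in> N" "f (p x) = T u" "g (x - p x) = T v" using p(2) f(2) g(2) by blast
      then have "q x = T (u + v)" unfolding q_def using bounded_opsD(2)[OF T subsetD[OF D(1) uv(1)] subsetD[OF D(2) uv(2)]] by simp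
      then show "q x \<in> T ` E" using D(7)[OF uv(1,2)] by blast
    qed
    moreover have "\<forall>x\<in>T ` E. x \<in> E \<and> q x = x"
    proof
      fix x assume "x \<in> T ` E"
      then obtain u v where uv: "u \<in> M" "v \<in> N" "x = T (u + v)" using D(6) by blast
      have x: "x = T u + T v"
        using uv(3) bounded_opsD(2)[OF T subsetD[OF D(1) uv(1)] subsetD[OF D(2) uv(2)]] by simp
      have Tuv: "T u \<in> M" "T v \<in> N" using uv inv by blast+
      then have "p x = T u" unfolding x
        using bounded_opsD(2)[OF p(1) subsetD[OF D(1) Tuv(1)] subsetD[OF D(2) Tuv(2)]] p(3,4) Tuv by simp
      then have "q x = f (T u) + g (T v)" unfolding q_def x by simp
      then show "x \<in> E \<and> q x = x" using f(3) g(3) uv x D(7)[OF Tuv] by simp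
    qed
    ultimately show ?thesis unfolding complemented_iff_projection[OF E] by blast
  qed
  ultimately show ?thesis unfolding left_Browder_def nE using F(1) by blast
qed

text \<open>With a left inverse \<open>B\<close> one has \<open>B (T - \<mu>) = I - \<mu> B\<close>. For small \<open>\<mu>\<close> this is bijective: solving
  \<open>x - \<mu> B x = y\<close> is a fixed point problem for a contraction.\<close>
lemma left_invertible_shift:
  assumes E: "closed_subspace E" and T: "T \<in> bounded_ops E" and L: "left_invertible E T"
  obtains \<epsilon> where "\<epsilon> > 0" "\<And>\<mu>. cmod \<mu> < \<epsilon> \<Longrightarrow> left_invertible E (shift T \<mu>)"
proof -
  obtain B where B: "B \<in> bounded_ops E" "\<And>x. x \<in> E \<Longrightarrow> B (T x) = x" using L unfolding left_invertible_def by blast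
  obtain K where K: "K > 0" "\<And>x. x \<in> E \<Longrightarrow> norm (B x) \<le> K * norm x" using bounded_ops_bound[OF B(1)] by blast
  show thesis
  proof (rule that[of "1 / K"])
    show "1 / K > 0" using K(1) by simp
    fix \<mu> assume \<mu>: "cmod \<mu> < 1 / K"
    define c where "c = cmod \<mu> * K"
    have c: "0 \<le> c" "c < 1" using \<mu> K(1) unfolding c_def by (auto simp: field_simps)
    define U where "U x = x - \<mu> *\<^sub>C B x" for x
    have U: "U \<in> bounded_ops E"
      unfolding U_def by (intro bounded_ops_minus_op bounded_ops_id bounded_ops_scale B closed_subspaceD(2) E)
    have small: "norm (\<mu> *\<^sub>C B x) \<le> c * norm x" if "x \<in> E" for x
      using mult_left_mono[OF K(2)[OF that], of "cmod \<mu>"] unfolding c_def by (simp add: norm_scaleC)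
    have "x = 0" if x: "x \<in> null_space E U" for x
    proof -
      have xE: "x \<in> E" "x = \<mu> *\<^sub>C B x" using x unfolding null_space_def U_def by auto
      then have "norm x \<le> c * norm x" using small by metis
      then have "(1 - c) * norm x \<le> 0" by (simp add: algebra_simps)
      then show ?thesis using c(2) by (simp add: mult_le_0_iff)
    qed
    then have nU: "null_space E U = {0}"
      using closed_subspaceD(4)[OF closed_subspace_null_space[OF U E]] by blast
    have "y \<in> U ` E" if y: "y \<in> E" for y
    proof -
      have "\<exists>!x\<in>E. y + \<mu> *\<^sub>C B x = x"
      proof (rule Banach_fix[where c = c])
        show "complete E" using closed_subspaceD(1)[OF E] by (simp add: complete_eq_closed)
        show "E \<noteq> {}" using y by blast
        show "(\<lambda>x. y + \<mu> *\<^sub>C B x) ` E \<subseteq> E"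
          using y closed_subspaceD(5,7)[OF E] bounded_opsD(1)[OF B(1)] by blast
        show "dist (y + \<mu> *\<^sub>C B u) (y + \<mu> *\<^sub>C B v) \<le> c * dist u v" if uv: "u \<in> E" "v \<in> E" for u v
        proof -
          have "dist (y + \<mu> *\<^sub>C B u) (y + \<mu> *\<^sub>C B v) = norm (\<mu> *\<^sub>C B (u - v))"
            using bounded_ops_diff[OF B(1) closed_subspaceD(2)[OF E] uv]
            by (simp add: dist_norm complex_vector.scale_right_diff_distrib)
          then show ?thesis using small[OF closed_subspaceD(6)[OF E uv]] by (simp add: dist_norm)
        qed
      qed (use c in auto)
      then obtain x where "x \<in> E" "y + \<mu> *\<^sub>C B x = x" by blast
      then show ?thesis unfolding U_def by (intro image_eqI[of _ _ x]) (auto simp: eq_diff_eq)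
    qed
    then have "U ` E = E" using bounded_opsD(1)[OF U] by blast
    moreover have "complemented E E"
      unfolding complemented_iff_projection[OF E] by (rule bexI[OF _ bounded_ops_id]) auto
    ultimately have "left_invertible E U"
      using nU unfolding left_invertible_iff_complemented_range[OF E U] by simp
    then obtain G where G: "G \<in> bounded_ops E" "\<And>x. x \<in> E \<Longrightarrow> G (U x) = x" unfolding left_invertible_def by blast
    show "left_invertible E (shift T \<mu>)"
      unfolding left_invertible_def
    proof (rule bexI[OF _ bounded_ops_comp[OF G(1) B(1)]], rule ballI)
      fix x assume x: "x \<in> E"
      have "B (shift T \<mu> x) = B (T x) - B (\<mu> *\<^sub>C x)"
        unfolding shift_def
        by (rule bounded_ops_diff[OF B(1) closed_subspaceD(2)[OF E] bounded_opsD(1)[OF T x] closed_subspaceD(7)[OF E x]])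
      also have "\<dots> = U x" unfolding U_def using B(2)[OF x] bounded_opsD(3)[OF B(1) x] by simp
      finally show "G (B (shift T \<mu> x)) = x" using G(2)[OF x] by simp
    qed
  qed
qed

section \<open>Reducing pairs and commuting projectors\<close>

lemma RedD:
  assumes "(M, N) \<in> Red A"
  shows "closed M" "closed N" "A ` M \<subseteq> M" "A ` N \<subseteq> N" "direct_sum UNIV M N"
  using assms unfolding Red_def by auto

lemma Red_projector:
  assumes A: "A \<in> bounded_ops UNIV" and red: "(M, N) \<in> Red A"
  obtains P where "projector P" "A \<circ> P = P \<circ> A" "\<And>x. P x \<in> N" "\<And>x. x - P x \<in> M"
    "\<And>x. x \<in> N \<Longrightarrow> P x = x" "\<And>x. x \<in> M \<Longrightarrow> P x = 0"
proof -
  note R = RedD[OF red]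
  obtain P where P: "P \<in> bounded_ops UNIV" "\<forall>x\<in>UNIV. P x \<in> N \<and> x - P x \<in> M" "\<forall>x\<in>N. P x = x" "\<forall>x\<in>M. P x = 0"
    using direct_sum_projection[OF closed_subspace_UNIV direct_sum_commute[OF R(5)] R(2,1)] by metis
  have "P \<circ> P = P" using P(2,3) by auto
  moreover have "A \<circ> P = P \<circ> A"
  proof
    fix x
    have "A x = A (P x) + A (x - P x)"
      using bounded_opsD(2)[OF A, of "P x" "x - P x"] by simp
    moreover have "A (P x) \<in> N" "A (x - P x) \<in> M" using P(2) R(3,4) by blast+
    ultimately have "P (A x) = A (P x)" using bounded_opsD(2)[OF P(1)] P(3,4) by simp
    then show "(A \<circ> P) x = (P \<circ> A) x" by simp
  qed
  ultimately show thesis using that P unfolding projector_def by blast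
qed

lemma projector_Red:
  assumes A: "A \<in> bounded_ops UNIV" and P: "projector P" and comm: "A \<circ> P = P \<circ> A"
  shows "(null_space UNIV P, range P) \<in> Red A" "\<And>x. x \<in> range P \<Longrightarrow> P x = x"
proof -
  have b: "P \<in> bounded_ops UNIV" and PP: "\<And>x. P (P x) = P x"
    using P unfolding projector_def by (auto simp: fun_eq_iff)
  have c: "A (P x) = P (A x)" for x using fun_cong[OF comm, of x] by simp
  show fixed: "\<And>x. x \<in> range P \<Longrightarrow> P x = x" using PP by auto
  have V: "\<And>x. x \<in> UNIV \<Longrightarrow> P x \<in> range P" "\<And>x. x \<in> range P \<Longrightarrow> x \<in> UNIV \<and> P x = x"
    by (rule rangeI) (intro conjI UNIV_I fixed)
  note ds = projection_direct_sum(1)[OF closed_subspace_UNIV b V]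
    and cl = projection_direct_sum(2,3)[OF closed_subspace_UNIV b V]
  have "A ` range P \<subseteq> range P" using c by auto
  moreover have "A ` null_space UNIV P \<subseteq> null_space UNIV P"
    using c bounded_ops_zero[OF A] unfolding null_space_def by (auto simp flip: c)
  ultimately show "(null_space UNIV P, range P) \<in> Red A"
    using direct_sum_commute[OF ds] cl unfolding Red_def by simp
qed

definition left_invertible_Riesz_splitting :: "('a::complex_banach \<Rightarrow> 'a) \<Rightarrow> bool"
  where "left_invertible_Riesz_splitting A \<longleftrightarrow> (\<exists>(M, N)\<in>Red A. left_invertible M A \<and> Riesz N A)"

lemma left_invertible_cong:
  assumes "\<And>x. x \<in> E \<Longrightarrow> S x = T x" shows "left_invertible E S \<longleftrightarrow> left_invertible E T"
proof -
  have "(\<forall>x\<in>E. B (S x) = x) \<longleftrightarrow> (\<forall>x\<in>E. B (T x) = x)" for B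
    by (rule ball_cong) (simp_all add: assms)
  then show ?thesis unfolding left_invertible_def by simp
qed

lemma splittingE:
  assumes "left_invertible_Riesz_splitting A"
  obtains M N where "(M, N) \<in> Red A" "left_invertible M A" "Riesz N A"
  using assms unfolding left_invertible_Riesz_splitting_def by blast

lemma Riesz_UNIV_iff:
  assumes T: "T \<in> bounded_ops UNIV" and red: "(M, N) \<in> Red T"
  shows "Riesz UNIV T \<longleftrightarrow> Riesz M T \<and> Riesz N T"
  using Riesz_direct_sum[OF closed_subspace_UNIV T RedD(5,1,2,3,4)[OF red]] .

lemma Red_cong:
  assumes red: "(M, N) \<in> Red A" and M: "\<And>x. x \<in> M \<Longrightarrow> T x \<in> M" and N: "\<And>x. x \<in> N \<Longrightarrow> T x \<in> N"
  shows "(M, N) \<in> Red T"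
  using red M N unfolding Red_def by auto

text \<open>The operators \<open>AP\<close>, \<open>A(I - Q)\<close> and \<open>A - ABA\<close> that are required to be Riesz all have this form,
  so the requirement concerns only the restriction of \<open>A\<close> to \<open>N\<close>.\<close>
lemma Riesz_compression:
  assumes A: "A \<in> bounded_ops UNIV" and red: "(M, N) \<in> Red A"
    and T: "T \<in> bounded_ops UNIV" "\<And>x. x \<in> M \<Longrightarrow> T x = 0" "\<And>x. x \<in> N \<Longrightarrow> T x = A x"
  shows "Riesz UNIV T \<longleftrightarrow> Riesz N A"
proof -
  note D = direct_sumD(4,5)[OF RedD(5)[OF red]]
  have "(M, N) \<in> Red T"
    using T(2,3) complex_vector.subspace_0[OF D(1)] RedD(4)[OF red] by (intro Red_cong[OF red]) auto
  then have "Riesz UNIV T \<longleftrightarrow> Riesz M T \<and> Riesz N T" by (rule Riesz_UNIV_iff[OF T(1)])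
  also have "Riesz N T \<longleftrightarrow> Riesz N A" using T(3) by (rule Riesz_cong)
  also have "Riesz M T \<and> Riesz N A \<longleftrightarrow> Riesz N A" using Riesz_zero[of M T, OF D(1) T(2)] by simp
  finally show ?thesis .
qed

lemma bounded_ops_comp':
  assumes "S \<in> bounded_ops E" "T \<in> bounded_ops E" shows "S \<circ> T \<in> bounded_ops E"
  using bounded_ops_comp[OF assms] by (simp add: comp_def)

section \<open>Algebraic characterisations\<close>

lemma quasipolar_imp_splitting:
  assumes A: "A \<in> bounded_ops UNIV" and qp: "left_Riesz_quasipolar A"
  shows "left_invertible_Riesz_splitting A"
proof -
  obtain Q T where Q: "projector Q" "A \<circ> Q = Q \<circ> A" "Riesz UNIV (A \<circ> (\<lambda>x. x - Q x))"
    and T: "T \<in> bounded_ops UNIV" "Q = T \<circ> A"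
    using qp unfolding left_Riesz_quasipolar_def by blast
  have Qb: "Q \<in> bounded_ops UNIV" using Q(1) unfolding projector_def by blast
  define M where "M = range Q"
  define N where "N = null_space UNIV Q"
  note NM = projector_Red(1)[OF A Q(1,2), folded M_def N_def]
    and Qx = projector_Red(2)[OF A Q(1,2), folded M_def]
  have red: "(M, N) \<in> Red A" using RedD[OF NM] direct_sum_commute unfolding Red_def by auto
  have "left_invertible M A"
    unfolding left_invertible_def
  proof (rule bexI[of _ "\<lambda>x. Q (T x)"])
    show "\<forall>x\<in>M. Q (T (A x)) = x" using Qx fun_cong[OF T(2)] by simp
    show "(\<lambda>x. Q (T x)) \<in> bounded_ops M"
      by (rule bounded_ops_restrict[OF bounded_ops_comp[OF Qb T(1)]]) (auto simp: M_def)
  qed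
  moreover have "Riesz N A"
  proof -
    have "A \<circ> (\<lambda>x. x - Q x) \<in> bounded_ops UNIV"
      by (intro bounded_ops_comp' A bounded_ops_minus_op bounded_ops_id Qb) simp
    moreover have "(A \<circ> (\<lambda>x. x - Q x)) x = 0" if "x \<in> M" for x using Qx[OF that] bounded_ops_zero[OF A] by simp
    moreover have "(A \<circ> (\<lambda>x. x - Q x)) x = A x" if "x \<in> N" for x using that unfolding N_def null_space_def by simp
    ultimately show ?thesis using Riesz_compression[OF A red] Q(3) by blast
  qed
  ultimately show ?thesis using red unfolding left_invertible_Riesz_splitting_def by blast
qed

text \<open>The defining equations give \<open>(BA)(BA) = B(ABA) = B\<^sup>2A\<^sup>2 = BA\<close> and \<open>A(BA) = BA\<^sup>2 = (BA)A\<close>; so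
  \<open>BA\<close> is a projector that commutes with \<open>A\<close> and visibly a left multiple of \<open>A\<close>.\<close>
lemma generalized_inverse_imp_quasipolar:
  assumes A: "A \<in> bounded_ops UNIV" and inv: "left_gen_Drazin_Riesz_invertible A"
  shows "left_Riesz_quasipolar A"
proof -
  obtain B where B: "B \<in> bounded_ops UNIV" and 1: "A \<circ> B \<circ> A = B \<circ> (A ^^ 2)" and 2: "(B ^^ 2) \<circ> A = B"
    and R: "Riesz UNIV (\<lambda>x. A x - (A \<circ> B \<circ> A) x)"
    using inv unfolding left_gen_Drazin_Riesz_invertible_def by blast
  have e1: "A (B (A x)) = B (A (A x))" for x using fun_cong[OF 1, of x] by (simp add: numeral_2_eq_2)
  have e2: "B (B (A x)) = B x" for x using fun_cong[OF 2, of x] by (simp add: numeral_2_eq_2)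
  define Q where "Q = B \<circ> A"
  have Qb: "Q \<in> bounded_ops UNIV" unfolding Q_def by (intro bounded_ops_comp' B A)
  have "Q \<circ> Q = Q" using e1 e2 unfolding Q_def by (auto simp: fun_eq_iff)
  then have "projector Q" using Qb unfolding projector_def by blast
  moreover have "A \<circ> Q = Q \<circ> A" using e1 unfolding Q_def by (auto simp: fun_eq_iff)
  moreover have "A \<circ> (\<lambda>x. x - Q x) = (\<lambda>x. A x - (A \<circ> B \<circ> A) x)"
    using bounded_ops_diff[OF A] unfolding Q_def by (auto simp: fun_eq_iff)
  ultimately show ?thesis using R B unfolding left_Riesz_quasipolar_def Q_def by auto
qed

lemma splitting_imp_generalized_inverse:
  assumes A: "A \<in> bounded_ops UNIV" and sp: "left_invertible_Riesz_splitting A"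
  shows "\<exists>C\<in>bounded_ops UNIV. A \<circ> C \<circ> A = C \<circ> (A ^^ 2) \<and> (C ^^ 2) \<circ> A = C \<and> C = C \<circ> A \<circ> C \<and>
      Riesz UNIV (\<lambda>x. A x - (A \<circ> C \<circ> A) x)"
proof -
  obtain M N where red: "(M, N) \<in> Red A" and L: "left_invertible M A" and R: "Riesz N A"
    using sp by (rule splittingE)
  have red': "(N, M) \<in> Red A" using RedD[OF red] direct_sum_commute unfolding Red_def by auto
  obtain P where P: "projector P" "A \<circ> P = P \<circ> A" "\<And>x. P x \<in> M" "\<And>x. x - P x \<in> N"
    "\<And>x. x \<in> M \<Longrightarrow> P x = x" "\<And>x. x \<in> N \<Longrightarrow> P x = 0"
    using Red_projector[OF A red'] by metis
  have Pb: "P \<in> bounded_ops UNIV" using P(1) unfolding projector_def by blast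
  have comm: "P (A x) = A (P x)" for x using fun_cong[OF P(2), of x] by simp
  obtain B where B: "B \<in> bounded_ops M" "\<And>x. x \<in> M \<Longrightarrow> B (A x) = x" using L unfolding left_invertible_def by blast
  define C where "C x = B (P x)" for x
  have CM: "C x \<in> M" for x unfolding C_def using bounded_opsD(1)[OF B(1)] P(3) by blast
  have CA: "C (A x) = P x" for x unfolding C_def comm by (rule B(2)[OF P(3)])
  have PC: "P (C x) = C x" for x by (rule P(5)[OF CM])
  have CP: "C (P x) = C x" for x unfolding C_def using P(3,5) by simp
  have Cb: "C \<in> bounded_ops UNIV"
    unfolding C_def by (rule bounded_ops_comp_subspace[OF B(1) Pb P(3)]) simp
  show ?thesis
  proof (intro bexI[OF _ Cb] conjI)
    show "A \<circ> C \<circ> A = C \<circ> (A ^^ 2)" using CA comm by (auto simp: fun_eq_iff numeral_2_eq_2)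
    show "(C ^^ 2) \<circ> A = C" using CA CP by (auto simp: fun_eq_iff numeral_2_eq_2)
    show "C = C \<circ> A \<circ> C" using CA PC by (auto simp: fun_eq_iff)
    have "(\<lambda>x. A x - (A \<circ> C \<circ> A) x) \<in> bounded_ops UNIV"
      by (intro bounded_ops_minus_op bounded_ops_comp' A Cb) simp
    moreover have "A x - (A \<circ> C \<circ> A) x = 0" if "x \<in> M" for x using CA P(5)[OF that] by simp
    moreover have "A x - (A \<circ> C \<circ> A) x = A x" if "x \<in> N" for x
      using CA P(6)[OF that] bounded_ops_zero[OF A] by simp
    ultimately show "Riesz UNIV (\<lambda>x. A x - (A \<circ> C \<circ> A) x)" using Riesz_compression[OF A red] R by blast
  qed
qed

section \<open>Characterisations by left Browder operators\<close>

text \<open>For \<open>c = -1\<close> the operator \<open>T\<close> is \<open>A + P\<close>, where \<open>P\<close> projects onto \<open>N\<close> along \<open>M\<close>. That the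
  ascent of \<open>A - c\<close> on \<open>N\<close> is finite is where the theory of Riesz operators enters.\<close>
lemma splitting_left_Browder:
  assumes A: "A \<in> bounded_ops UNIV" and red: "(M, N) \<in> Red A"
    and L: "left_invertible M A" and R: "Riesz N A"
    and T: "T \<in> bounded_ops UNIV" "\<And>x. x \<in> M \<Longrightarrow> T x = A x" "\<And>x. x \<in> N \<Longrightarrow> T x = shift A c x" and c: "c \<noteq> 0"
  shows "left_Browder UNIV T"
proof -
  note D = RedD[OF red]
  have N: "closed_subspace N" by (rule closed_subspace_summand[OF direct_sum_commute[OF D(5)] D(2)])
  have AN: "A \<in> bounded_ops N" by (rule bounded_ops_summand[OF A direct_sum_commute[OF D(5)] D(4)])
  have inv: "T ` M \<subseteq> M" "T ` N \<subseteq> N"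
    using T(2,3) D(3) shift_invariant[OF closed_subspaceD(2)[OF N] D(4), of c] by auto
  have SN: "shift A c \<in> bounded_ops N" by (rule bounded_ops_shift[OF AN closed_subspaceD(2)[OF N]])
  have nul: "null_space N T = null_space N (shift A c)" and img: "T ` N = shift A c ` N"
    using T(3) unfolding null_space_def by auto
  have pow: "(T ^^ n) x = (shift A c ^^ n) x" if "x \<in> N" for n x
    using that bounded_opsD(1)[OF bounded_ops_funpow[OF SN] that] T(3) by (induction n) auto
  have "(T ^^ n) ` N = (shift A c ^^ n) ` N" for n by (rule image_cong) (use pow in auto)
  then have "ascent N T = ascent N (shift A c)" unfolding ascent_def nul by simp
  then have asc: "ascent N T < \<infinity>" using Riesz_finite_ascent[OF N AN R c] by simp
  have "left_invertible M T" using left_invertible_cong[of M T A] T(2) L by blast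
  then show ?thesis
    using left_Browder_direct_sum[OF closed_subspace_UNIV T(1) D(5,1,2) inv] R c asc
    unfolding Riesz_def nul img by blast
qed

lemma splitting_imp_Browder_translate:
  assumes A: "A \<in> bounded_ops UNIV" and sp: "left_invertible_Riesz_splitting A"
  shows "\<exists>P. projector P \<and> A \<circ> P = P \<circ> A \<and> left_Browder UNIV (\<lambda>x. A x + P x) \<and> Riesz UNIV (A \<circ> P)"
    and "\<exists>P. projector P \<and> A \<circ> P = P \<circ> A \<and> left_Browder UNIV (\<lambda>x. A (x - P x) + P x) \<and> Riesz UNIV (A \<circ> P)"
proof -
  obtain M N where red: "(M, N) \<in> Red A" and L: "left_invertible M A" and R: "Riesz N A"
    using sp by (rule splittingE)
  obtain P where P: "projector P" "A \<circ> P = P \<circ> A" "\<And>x. P x \<in> N" "\<And>x. x - P x \<in> M"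
    "\<And>x. x \<in> N \<Longrightarrow> P x = x" "\<And>x. x \<in> M \<Longrightarrow> P x = 0"
    using Red_projector[OF A red] by metis
  have Pb: "P \<in> bounded_ops UNIV" using P(1) unfolding projector_def by blast
  have A0: "A 0 = 0" using bounded_ops_zero[OF A] by simp
  have AP: "Riesz UNIV (A \<circ> P)"
    using Riesz_compression[OF A red bounded_ops_comp'[OF A Pb]] P(5,6) A0 R by simp
  have "left_Browder UNIV (\<lambda>x. A x + P x)"
  proof (rule splitting_left_Browder[OF A red L R, of _ "-1"])
    show "(\<lambda>x. A x + P x) \<in> bounded_ops UNIV" by (intro bounded_ops_add A Pb) simp
  qed (use P(5,6) in \<open>auto simp: shift_def\<close>)
  then show "\<exists>P. projector P \<and> A \<circ> P = P \<circ> A \<and> left_Browder UNIV (\<lambda>x. A x + P x) \<and> Riesz UNIV (A \<circ> P)"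
    using P(1,2) AP by blast
  have "left_Browder UNIV (\<lambda>x. A (x - P x) + P x)"
  proof -
    note D = RedD[OF red]
    define T where "T x = A (x - P x) + P x" for x
    have T: "T \<in> bounded_ops UNIV"
      unfolding T_def by (intro bounded_ops_add bounded_ops_comp[OF A] bounded_ops_minus_op bounded_ops_id Pb) simp_all
    have TM: "T x = A x" if "x \<in> M" for x using P(6)[OF that] unfolding T_def by simp
    have TN: "T x = x" if "x \<in> N" for x using P(5)[OF that] A0 unfolding T_def by simp
    have nN: "null_space N T = {0}"
      using TN complex_vector.subspace_0[OF direct_sumD(5)[OF D(5)]] unfolding null_space_def by auto
    have "finite_codim N (T ` N)"
      using TN unfolding finite_codim_def by (intro exI[of _ "{}"]) (auto simp: image_iff)
    moreover have "ascent N T < \<infinity>"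
      unfolding ascent_finite_iff nN using complex_vector.subspace_0[OF direct_sumD(5)[OF D(5)]]
      by (intro exI[of _ 0]) auto
    moreover have "T ` M \<subseteq> M" "T ` N \<subseteq> N" using TM TN D(3) by auto
    moreover have "left_invertible M T" using left_invertible_cong[of M T A] TM L by blast
    ultimately have "left_Browder UNIV T"
      using left_Browder_direct_sum[OF closed_subspace_UNIV T D(5,1,2)] nN by simp
    then show ?thesis unfolding T_def .
  qed
  then show "\<exists>P. projector P \<and> A \<circ> P = P \<circ> A \<and> left_Browder UNIV (\<lambda>x. A (x - P x) + P x) \<and> Riesz UNIV (A \<circ> P)"
    using P(1,2) AP by blast
qed

text \<open>On the range of \<open>P\<close> the sum is the Riesz operator \<open>D\<close>. On its kernel the sum is \<open>C\<close>, still left Browder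
  there, so it is left invertible on some \<open>M\<close> with a complement \<open>W\<close> of finite dimension;
  \<open>W\<close> joins the range of \<open>P\<close> to form \<open>N\<close>.\<close>
lemma Browder_Riesz_sum_imp_splitting:
  assumes C: "C \<in> bounded_ops UNIV" "left_Browder UNIV C" and D: "D \<in> bounded_ops UNIV" "Riesz UNIV D"
    and P: "projector P" "C \<circ> P = P \<circ> C" "D \<circ> P = P \<circ> D"
  shows "left_invertible_Riesz_splitting (\<lambda>x. C (x - P x) + D (P x))"
proof -
  define A where "A x = C (x - P x) + D (P x)" for x
  have Pb: "P \<in> bounded_ops UNIV" using P(1) unfolding projector_def by blast
  have A: "A \<in> bounded_ops UNIV"
    unfolding A_def
    by (intro bounded_ops_add bounded_ops_comp[OF C(1)] bounded_ops_comp[OF D(1) Pb] bounded_ops_minus_op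
        bounded_ops_id Pb) simp_all
  define M0 where "M0 = null_space UNIV P"
  define N0 where "N0 = range P"
  note redC = projector_Red(1)[OF C(1) P(1,2), folded M0_def N0_def]
    and redD = projector_Red(1)[OF D(1) P(1,3), folded M0_def N0_def]
    and Px = projector_Red(2)[OF C(1) P(1,2), folded N0_def]
  note RC = RedD[OF redC] and RD = RedD[OF redD]
  note S = direct_sumD[OF RC(5)]
  have AM: "A x = C x" if "x \<in> M0" for x
    using that bounded_ops_zero[OF D(1)] unfolding A_def M0_def null_space_def by simp
  have AN: "A x = D x" if "x \<in> N0" for x using Px[OF that] bounded_ops_zero[OF C(1)] unfolding A_def by simp
  have M0: "closed_subspace M0" by (rule closed_subspace_summand[OF RC(5,1)])
  have N0: "closed_subspace N0" by (rule closed_subspace_summand[OF direct_sum_commute[OF RC(5)] RC(2)])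
  have "left_Browder M0 C" by (rule left_Browder_summand[OF closed_subspace_UNIV C RC(5,1,2,3,4)])
  then obtain M W where MW: "closed M" "finite_dim W" "direct_sum M0 M W" "C ` M \<subseteq> M" "C ` W \<subseteq> W" "left_invertible M C"
    using left_Browder_decomposition[OF M0 bounded_ops_summand[OF C(1) RC(5,3)]] by blast
  note S' = direct_sumD[OF MW(3)]
  define N where "N = {y + w | y w. y \<in> N0 \<and> w \<in> W}"
  have N: "closed_subspace N" unfolding N_def by (rule closed_subspace_add_finite_dim[OF N0 MW(2)])
  have W: "closed_subspace W" by (rule closed_subspace_finite_dim[OF MW(2)])
  note ds = direct_sum_assoc[OF RC(5) MW(3), folded N_def]
  have AMM: "A ` M \<subseteq> M" using AM S'(1) MW(4) by auto
  have AW: "A ` W \<subseteq> W" using AM S'(2) MW(5) by auto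
  have AN0: "A ` N0 \<subseteq> N0" using AN RD(4) by auto
  have ANN: "A ` N \<subseteq> N" unfolding N_def by (rule sum_invariant[OF A subset_UNIV subset_UNIV AN0 AW])
  have red: "(M, N) \<in> Red A" using ds(1) MW(1) closed_subspaceD(1)[OF N] AMM ANN unfolding Red_def by simp
  have "left_invertible M A" using left_invertible_cong[of M A C] AM S'(1) MW(6) by blast
  moreover have "Riesz N A"
  proof -
    have "Riesz N0 D" using Riesz_UNIV_iff[OF D(1) redD] D(2) by blast
    then have "Riesz N0 A" using Riesz_cong[of N0 A D] AN by blast
    moreover have "Riesz W A"
      by (rule Riesz_finite_dim[OF bounded_ops_restrict[OF A] MW(2)]) (use AW in auto)
    moreover have "A \<in> bounded_ops N" by (rule bounded_ops_restrict[OF A]) (use ANN in auto)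
    ultimately show ?thesis
      using Riesz_direct_sum[OF N _ ds(2) closed_subspaceD(1)[OF N0] closed_subspaceD(1)[OF W] AN0 AW] by blast
  qed
  ultimately have "left_invertible_Riesz_splitting A" using red unfolding left_invertible_Riesz_splitting_def by blast
  then show ?thesis unfolding A_def .
qed

section \<open>Spectral characterisations\<close>

lemma splitting_imp_GSRD:
  assumes A: "A \<in> bounded_ops UNIV" and sp: "left_invertible_Riesz_splitting A"
  shows "admits_GSRD A"
proof -
  obtain M N where red: "(M, N) \<in> Red A" and L: "left_invertible M A" and R: "Riesz N A"
    using sp by (rule splittingE)
  note D = RedD[OF red]
  have M: "closed_subspace M" by (rule closed_subspace_summand[OF D(5,1)])
  have AM: "A \<in> bounded_ops M" by (rule bounded_ops_summand[OF A D(5,3)])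
  have nul: "null_space M A = {0}" and comp: "complemented M (A ` M)"
    using L unfolding left_invertible_iff_complemented_range[OF M AM] by auto
  have "Kato M A"
    using comp complex_vector.subspace_0[OF subspace_range[OF bounded_ops_funpow[OF AM] closed_subspaceD(2)[OF M] order_refl]]
    unfolding Kato_def nul complemented_def by auto
  moreover have "complemented M {0}"
    unfolding complemented_iff_projection[OF M]
    by (rule bexI[of _ "\<lambda>x. 0"]) (use closed_subspaceD(4)[OF M] in \<open>auto intro!: bounded_opsI[where K = 0]\<close>)
  ultimately have "Saphar M A" using comp unfolding Saphar_def nul by blast
  then show ?thesis using red R unfolding admits_GSRD_def by blast
qed

lemma splitting_imp_Browder_isolated:
  assumes A: "A \<in> bounded_ops UNIV" and sp: "left_invertible_Riesz_splitting A"
  shows "\<not> 0 islimpt left_Browder_spectrum A"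
proof -
  obtain M N where red: "(M, N) \<in> Red A" and L: "left_invertible M A" and R: "Riesz N A"
    using sp by (rule splittingE)
  note D = RedD[OF red]
  have M: "closed_subspace M" by (rule closed_subspace_summand[OF D(5,1)])
  have N: "closed_subspace N" by (rule closed_subspace_summand[OF direct_sum_commute[OF D(5)] D(2)])
  have AM: "A \<in> bounded_ops M" by (rule bounded_ops_summand[OF A D(5,3)])
  have AN: "A \<in> bounded_ops N" by (rule bounded_ops_summand[OF A direct_sum_commute[OF D(5)] D(4)])
  obtain e where e: "e > 0" "\<And>\<mu>. cmod \<mu> < e \<Longrightarrow> left_invertible M (shift A \<mu>)"
    using left_invertible_shift[OF M AM L] by blast
  have "left_Browder UNIV (shift A \<mu>)" if \<mu>: "\<mu> \<noteq> 0" "cmod \<mu> < e" for \<mu>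
    using left_Browder_direct_sum[OF closed_subspace_UNIV bounded_ops_shift[OF A complex_vector.subspace_UNIV] D(5,1,2)
        shift_invariant[OF closed_subspaceD(2)[OF M] D(3)] shift_invariant[OF closed_subspaceD(2)[OF N] D(4)]
        e(2)[OF \<mu>(2)]] R \<mu>(1) Riesz_finite_ascent[OF N AN R \<mu>(1)] unfolding Riesz_def by blast
  then show ?thesis
    using e(1) unfolding islimpt_approachable left_Browder_spectrum_def by (auto simp: dist_norm intro!: exI[of _ e])
qed

text \<open>Left Browder points need not be points of left invertibility, but around a left Browder point
  \<open>c\<close> all other nearby points have an injective shift, and an injective left Browder operator is left
  invertible. The disc is placed around such a \<open>c \<noteq> 0\<close> close to the origin.\<close>
lemma Browder_isolated_imp_left_invertible:
  assumes A: "A \<in> bounded_ops UNIV" and iso: "\<not> 0 islimpt left_Browder_spectrum A" and r: "r > 0"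
  obtains c \<epsilon> where "\<epsilon> > 0" "cball c \<epsilon> \<subseteq> ball 0 r" "\<And>z. z \<in> ball c \<epsilon> - {c} \<Longrightarrow> left_invertible UNIV (shift A z)"
proof -
  obtain e where e: "e > 0" "\<And>z. z \<noteq> 0 \<Longrightarrow> cmod z < e \<Longrightarrow> left_Browder UNIV (shift A z)"
    using iso unfolding islimpt_approachable left_Browder_spectrum_def by (auto simp: dist_norm)
  have S: "shift A z \<in> bounded_ops UNIV" for z by (rule bounded_ops_shift[OF A complex_vector.subspace_UNIV])
  \<comment> \<open>\<open>\<bar>c\<bar> = t\<close> and \<open>\<epsilon> \<le> t\<close> keep the disc around \<open>c\<close> away from \<open>0\<close> and within radius \<open>2 t\<close>\<close>
  define t where "t = min e r / 3"
  have t: "t > 0" "3 * t \<le> e" "3 * t \<le> r" using e(1) r unfolding t_def by auto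
  define c where "c = complex_of_real t"
  have c: "c \<noteq> 0" "cmod c = t" using t(1) unfolding c_def by auto
  have "left_Browder UNIV (shift A c)" using e(2)[OF c(1)] c(2) t by simp
  then obtain d where d: "d > 0" "\<And>\<mu>. \<mu> \<noteq> 0 \<Longrightarrow> cmod \<mu> < d \<Longrightarrow> null_space UNIV (shift (shift A c) \<mu>) = {0}"
    using upper_Drazin_punctured_injective[OF closed_subspace_UNIV S left_Browder_imp_upper_Drazin[OF closed_subspace_UNIV S]]
    by metis
  define \<epsilon> where "\<epsilon> = min d t"
  show thesis
  proof (rule that[of \<epsilon> c])
    show "\<epsilon> > 0" using d(1) t(1) unfolding \<epsilon>_def by simp
    show "cball c \<epsilon> \<subseteq> ball 0 r"
    proof
      fix z assume "z \<in> cball c \<epsilon>"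
      then have "cmod (z - c) \<le> t" unfolding \<epsilon>_def by (simp add: dist_norm norm_minus_commute)
      then show "z \<in> ball 0 r" using norm_triangle_ineq[of "z - c" c] c(2) t by simp
    qed
    fix z assume z: "z \<in> ball c \<epsilon> - {c}"
    then have z': "z \<noteq> c" "cmod (z - c) < d" "cmod (z - c) < t"
      unfolding \<epsilon>_def by (auto simp: dist_norm norm_minus_commute)
    have "z \<noteq> 0" using z'(3) c(2) by auto
    moreover have "cmod z < e" using norm_triangle_ineq[of "z - c" c] z'(3) c(2) t by simp
    ultimately have "left_Browder UNIV (shift A z)" by (rule e(2))
    moreover have "null_space UNIV (shift A z) = {0}" using d(2)[of "z - c"] z'(1,2) unfolding shift_shift by simp
    ultimately show "left_invertible UNIV (shift A z)"
      unfolding left_invertible_iff_complemented_range[OF closed_subspace_UNIV S] left_Browder_def by blast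
  qed
qed

text \<open>Functionals separate points, so the scalar identity theorem applies to \<open>\<phi> \<circ> f\<close>.\<close>
lemma vector_analytic_identity:
  fixes f :: "complex \<Rightarrow> 'a::complex_banach"
  assumes f: "vector_analytic_on f S" and S: "open S" "connected S"
    and U: "U \<subseteq> S" "\<xi> \<in> S" "\<xi> islimpt U" "\<And>z. z \<in> U \<Longrightarrow> f z = 0" and w: "w \<in> S"
  shows "f w = 0"
proof (rule ccontr)
  assume "f w \<noteq> 0"
  then have "f w \<notin> {0}" by simp
  then obtain \<phi> :: "'a \<Rightarrow> complex" where \<phi>: "bounded_linear \<phi>" "\<And>c x. \<phi> (c *\<^sub>C x) = c * \<phi> x" "\<phi> (f w) = 1"
    using Hahn_Banach_separation[OF closed_subspaceD(2,1)[OF closed_subspace_zero], of "f w"] by metis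
  have "(\<lambda>z. \<phi> (f z)) holomorphic_on S"
    unfolding holomorphic_on_def
  proof
    fix z assume z: "z \<in> S"
    then obtain v where "(f has_derivative (\<lambda>h. h *\<^sub>C v)) (at z)" using f unfolding vector_analytic_on_def by blast
    then have "((\<lambda>z. \<phi> (f z)) has_derivative (\<lambda>h. \<phi> (h *\<^sub>C v))) (at z)"
      by (rule bounded_linear.has_derivative[OF \<phi>(1)])
    then have "((\<lambda>z. \<phi> (f z)) has_field_derivative \<phi> v) (at z)"
      unfolding has_field_derivative_def \<phi>(2) by (simp add: mult_commute_abs)
    then show "(\<lambda>z. \<phi> (f z)) field_differentiable at z within S"
      unfolding field_differentiable_def by (blast intro: has_field_derivative_at_within)
  qed
  then have "\<phi> (f w) = 0"
    using analytic_continuation[OF _ S U(1,2,3) _ w, of "\<lambda>z. \<phi> (f z)"] U(4)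
      linear_0[OF bounded_linear.linear[OF \<phi>(1)]] by simp
  then show False using \<phi>(3) by simp
qed

lemma left_invertible_injective:
  assumes "left_invertible UNIV (shift A z)" and A: "A \<in> bounded_ops UNIV" and "shift A z x = 0"
  shows "x = 0"
proof -
  have "null_space UNIV (shift A z) = {0}"
    using assms(1) left_invertible_iff_complemented_range[OF closed_subspace_UNIV bounded_ops_shift[OF A complex_vector.subspace_UNIV]]
    by blast
  then show ?thesis using assms(3) unfolding null_space_def by auto
qed

text \<open>A solution \<open>f\<close> vanishes wherever the shift is injective, in particular on a punctured disc
  somewhere in its domain, and then everywhere by the identity theorem.\<close>
lemma Browder_isolated_imp_SVEP:
  assumes A: "A \<in> bounded_ops UNIV" and iso: "\<not> 0 islimpt left_Browder_spectrum A"
  shows "SVEP_at A 0"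
  unfolding SVEP_at_def
proof (intro allI impI ballI, elim conjE)
  fix r :: real and f :: "complex \<Rightarrow> 'a" and w :: complex
  assume r: "r > 0" and f: "vector_analytic_on f (ball 0 r)" "\<forall>z\<in>ball 0 r. shift A z (f z) = 0" and w: "w \<in> ball 0 r"
  obtain c \<epsilon> where c: "\<epsilon> > 0" "cball c \<epsilon> \<subseteq> ball 0 r"
    "\<And>z. z \<in> ball c \<epsilon> - {c} \<Longrightarrow> left_invertible UNIV (shift A z)"
    using Browder_isolated_imp_left_invertible[OF A iso r] by metis
  have sub: "ball c \<epsilon> \<subseteq> ball 0 r" using c(2) ball_subset_cball by blast
  show "f w = 0"
  proof (rule vector_analytic_identity[OF f(1) open_ball connected_ball])
    show "ball c \<epsilon> - {c} \<subseteq> ball 0 r" using sub by blast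
    show "c \<in> ball 0 r" using subsetD[OF sub, of c] c(1) by simp
    have "c islimpt ball c \<epsilon>" using c(1) by (simp add: islimpt_ball)
    then show "c islimpt ball c \<epsilon> - {c}" unfolding islimpt_def by blast
    show "f z = 0" if z: "z \<in> ball c \<epsilon> - {c}" for z
      using left_invertible_injective[OF c(3)[OF z] A] f(2) sub z by blast
  qed (rule w)
qed

lemma Browder_isolated_imp_left_spectrum_interior:
  assumes A: "A \<in> bounded_ops UNIV" and iso: "\<not> 0 islimpt left_Browder_spectrum A"
  shows "0 \<notin> interior (left_spectrum A)"
proof
  assume "0 \<in> interior (left_spectrum A)"
  then obtain r where r: "r > 0" "ball 0 r \<subseteq> left_spectrum A" unfolding mem_interior by blast
  obtain c \<epsilon> where c: "\<epsilon> > 0" "cball c \<epsilon> \<subseteq> ball 0 r"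
    "\<And>z. z \<in> ball c \<epsilon> - {c} \<Longrightarrow> left_invertible UNIV (shift A z)"
    using Browder_isolated_imp_left_invertible[OF A iso r(1)] by metis
  have "c + complex_of_real (\<epsilon> / 2) \<in> ball c \<epsilon> - {c}" using c(1) by (simp add: dist_norm)
  then have "left_invertible UNIV (shift A (c + complex_of_real (\<epsilon> / 2)))"
    "c + complex_of_real (\<epsilon> / 2) \<in> left_spectrum A"
    using c(2,3) r(2) ball_subset_cball by blast+
  then show False unfolding left_spectrum_def by blast
qed

lemma upper_Drazin_spectrum_subset:
  assumes A: "A \<in> bounded_ops UNIV" shows "upper_Drazin_spectrum A \<subseteq> left_Browder_spectrum A"
  unfolding upper_Drazin_spectrum_def left_Browder_spectrum_def
  using left_Browder_imp_upper_Drazin[OF closed_subspace_UNIV bounded_ops_shift[OF A complex_vector.subspace_UNIV]] by blast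

lemma point_spectrum_subset:
  assumes A: "A \<in> bounded_ops UNIV" shows "point_spectrum A \<subseteq> left_spectrum A"
  unfolding point_spectrum_def left_spectrum_def
  using left_invertible_injective[OF _ A] unfolding shift_def by fastforce

text \<open>A Saphar operator has a complemented range, so it fails to be left invertible only by having a
  kernel, and then the eigenvectors of a Kato operator are available.\<close>
lemma GSRD_eigenvectors_of_no_splitting:
  assumes A: "A \<in> bounded_ops UNIV" and G: "admits_GSRD A" and ns: "\<not> left_invertible_Riesz_splitting A"
  obtains r f where "r > 0" "vector_analytic_on f (ball 0 r)"
    "\<And>\<mu>. \<mu> \<in> ball 0 r \<Longrightarrow> A (f \<mu>) = \<mu> *\<^sub>C f \<mu> \<and> f \<mu> \<noteq> 0"
proof -
  obtain M N where red: "(M, N) \<in> Red A" and Sa: "Saphar M A" and R: "Riesz N A"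
    using G unfolding admits_GSRD_def by blast
  note D = RedD[OF red]
  have M: "closed_subspace M" by (rule closed_subspace_summand[OF D(5,1)])
  have AM: "A \<in> bounded_ops M" by (rule bounded_ops_summand[OF A D(5,3)])
  have "\<not> left_invertible M A" using ns red R unfolding left_invertible_Riesz_splitting_def by blast
  then have "null_space M A \<noteq> {0}"
    using Sa left_invertible_iff_complemented_range[OF M AM] unfolding Saphar_def by blast
  then obtain r f where "r > 0" "vector_analytic_on f (ball 0 r)"
    "\<And>\<mu>. \<mu> \<in> ball 0 r \<Longrightarrow> f \<mu> \<in> M \<and> A (f \<mu>) = \<mu> *\<^sub>C f \<mu> \<and> f \<mu> \<noteq> 0"
    using Kato_eigenvectors[OF M AM] Sa unfolding Saphar_def by metis
  then show thesis using that by blast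
qed

lemma GSRD_imp_splitting:
  assumes A: "A \<in> bounded_ops UNIV" and G: "admits_GSRD A"
  shows "SVEP_at A 0 \<Longrightarrow> left_invertible_Riesz_splitting A"
    and "0 \<notin> interior (point_spectrum A) \<Longrightarrow> left_invertible_Riesz_splitting A"
    and "0 \<notin> interior (upper_Drazin_spectrum A) \<Longrightarrow> left_invertible_Riesz_splitting A"
proof -
  have S: "shift A z \<in> bounded_ops UNIV" for z by (rule bounded_ops_shift[OF A complex_vector.subspace_UNIV])
  have neg: "\<not> SVEP_at A 0 \<and> 0 \<in> interior (point_spectrum A) \<and> 0 \<in> interior (upper_Drazin_spectrum A)"
    if ns: "\<not> left_invertible_Riesz_splitting A"
  proof (intro conjI)
    obtain r f where r: "r > 0" and f: "vector_analytic_on f (ball 0 r)"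
      "\<And>\<mu>. \<mu> \<in> ball 0 r \<Longrightarrow> A (f \<mu>) = \<mu> *\<^sub>C f \<mu> \<and> f \<mu> \<noteq> 0"
      using GSRD_eigenvectors_of_no_splitting[OF A G ns] by metis
    have sh: "shift A z (f z) = 0" if "z \<in> ball 0 r" for z using f(2)[OF that] unfolding shift_def by simp
    have z0: "0 \<in> ball (0::complex) r" using r by simp
    show "\<not> SVEP_at A 0"
      unfolding SVEP_at_def using r f(1) sh f(2)[OF z0] z0 by blast
    have "ball 0 r \<subseteq> point_spectrum A" unfolding point_spectrum_def using f(2) by blast
    then show "0 \<in> interior (point_spectrum A)" unfolding mem_interior using r by blast
    have "c \<in> upper_Drazin_spectrum A" if c: "c \<in> ball 0 r" for c
      unfolding upper_Drazin_spectrum_def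
    proof (intro CollectI notI)
      assume "upper_Drazin_invertible UNIV (shift A c)"
      then obtain d where d: "d > 0" "\<And>\<mu>. \<mu> \<noteq> 0 \<Longrightarrow> cmod \<mu> < d \<Longrightarrow> null_space UNIV (shift (shift A c) \<mu>) = {0}"
        using upper_Drazin_punctured_injective[OF closed_subspace_UNIV S] by metis
      define t where "t = min d (r - cmod c) / 2"
      have t: "t > 0" "t < d" "t < r - cmod c" using d(1) c unfolding t_def by auto
      define z where "z = c + complex_of_real t"
      have "null_space UNIV (shift A z) = {0}"
        using d(2)[of "complex_of_real t"] t unfolding shift_shift z_def by simp
      moreover have "z \<in> ball 0 r"
        using norm_triangle_ineq[of c "complex_of_real t"] t unfolding z_def by simp
      ultimately show False using sh[of z] f(2)[of z] unfolding null_space_def by blast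
    qed
    then show "0 \<in> interior (upper_Drazin_spectrum A)" unfolding mem_interior using r by blast
  qed
  show "SVEP_at A 0 \<Longrightarrow> left_invertible_Riesz_splitting A"
    and "0 \<notin> interior (point_spectrum A) \<Longrightarrow> left_invertible_Riesz_splitting A"
    and "0 \<notin> interior (upper_Drazin_spectrum A) \<Longrightarrow> left_invertible_Riesz_splitting A"
    using neg by blast+
qed

section \<open>The equivalence of all conditions\<close>

lemma all_equivalentI:
  assumes "\<And>p. p \<in> set ps \<Longrightarrow> p \<longleftrightarrow> q" shows "all_equivalent ps"
  using assms unfolding all_equivalent_def by blast

theorem theorem4p5:
  fixes A :: "'a::complex_banach \<Rightarrow> 'a"
  assumes "\<not> finite_dim (UNIV :: 'a set)"
    and "A \<in> bounded_ops UNIV"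
  shows "all_equivalent
   [\<comment> \<open>(i)\<close>
    left_gen_Drazin_Riesz_invertible A,
    \<comment> \<open>(ii)\<close>
    \<exists>C\<in>bounded_ops UNIV. A \<circ> C \<circ> A = C \<circ> (A ^^ 2) \<and> (C ^^ 2) \<circ> A = C \<and> C = C \<circ> A \<circ> C \<and>
      Riesz UNIV (\<lambda>x. A x - (A \<circ> C \<circ> A) x),
    \<comment> \<open>(iii)\<close>
    \<exists>(M, N)\<in>Red A. left_invertible M A \<and> Riesz N A,
    \<comment> \<open>(iv)\<close>
    \<exists>P. projector P \<and> A \<circ> P = P \<circ> A \<and>
      left_Browder UNIV (\<lambda>x. A x + P x) \<and> Riesz UNIV (A \<circ> P),
    \<comment> \<open>(v)\<close>
    \<exists>P. projector P \<and> A \<circ> P = P \<circ> A \<and>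
      left_Browder UNIV (\<lambda>x. A (x - P x) + P x) \<and> Riesz UNIV (A \<circ> P),
    \<comment> \<open>(vi)\<close>
    \<exists>C\<in>bounded_ops UNIV. \<exists>D\<in>bounded_ops UNIV. \<exists>P. left_Browder UNIV C \<and> Riesz UNIV D \<and>
      projector P \<and> C \<circ> P = P \<circ> C \<and> D \<circ> P = P \<circ> D \<and> A = (\<lambda>x. C (x - P x) + D (P x)),
    \<comment> \<open>(vii)\<close>
    left_Riesz_quasipolar A,
    \<comment> \<open>(viii)\<close>
    admits_GSRD A \<and> 0 \<notin> interior (left_spectrum A),
    \<comment> \<open>(ix)\<close>
    admits_GSRD A \<and> SVEP_at A 0,
    \<comment> \<open>(x)\<close>
    admits_GSRD A \<and> \<not> 0 islimpt left_Browder_spectrum A,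
    \<comment> \<open>(xi)\<close>
    admits_GSRD A \<and> 0 \<notin> interior (left_Browder_spectrum A),
    \<comment> \<open>(xii)\<close>
    admits_GSRD A \<and> \<not> 0 islimpt upper_Drazin_spectrum A,
    \<comment> \<open>(xiii)\<close>
    admits_GSRD A \<and> 0 \<notin> interior (upper_Drazin_spectrum A),
    \<comment> \<open>(xiv)\<close>
    admits_GSRD A \<and> 0 \<notin> interior (point_spectrum A)]"
  (is "all_equivalent [?i, ?ii, ?iii, ?iv, ?v, ?vi, ?vii, ?viii, ?ix, ?x, ?xi, ?xii, ?xiii, ?xiv]")
proof -
  note A = assms(2)
  let ?S = "left_invertible_Riesz_splitting A"
  have ii: "?S \<Longrightarrow> ?ii" by (rule splitting_imp_generalized_inverse[OF A])
  have i: "?ii \<Longrightarrow> ?i" unfolding left_gen_Drazin_Riesz_invertible_def by blast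
  have vii: "?i \<Longrightarrow> ?vii" by (rule generalized_inverse_imp_quasipolar[OF A])
  have vii': "?vii \<Longrightarrow> ?S" by (rule quasipolar_imp_splitting[OF A])
  have iv: "?S \<Longrightarrow> ?iv" and v: "?S \<Longrightarrow> ?v" using splitting_imp_Browder_translate[OF A] by blast+
  have proj: "P \<in> bounded_ops UNIV \<and> (\<forall>x. P (P x) = P x) \<and> A 0 = 0 \<and> (\<forall>x. A (P x) = P (A x))"
    if "projector P" "A \<circ> P = P \<circ> A" for P
    using that bounded_ops_zero[OF A] unfolding projector_def by (auto simp: fun_eq_iff)
  have iv': ?vi if hyp: ?iv
  proof -
    obtain P where P: "projector P" "A \<circ> P = P \<circ> A" "left_Browder UNIV (\<lambda>x. A x + P x)" "Riesz UNIV (A \<circ> P)"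
      using hyp by blast
    note Q = proj[OF P(1,2)]
    have C: "(\<lambda>x. A x + P x) \<in> bounded_ops UNIV" by (intro bounded_ops_add A) (use Q in auto)
    have D: "A \<circ> P \<in> bounded_ops UNIV" by (intro bounded_ops_comp' A) (use Q in auto)
    have "(\<lambda>x. A x + P x) \<circ> P = P \<circ> (\<lambda>x. A x + P x)" "(A \<circ> P) \<circ> P = P \<circ> (A \<circ> P)"
      using Q bounded_opsD(2)[of P UNIV] by (auto simp: fun_eq_iff)
    moreover have "A = (\<lambda>x. (A (x - P x) + P (x - P x)) + (A \<circ> P) (P x))"
      using Q bounded_ops_diff[of P UNIV] bounded_ops_diff[OF A] by (auto simp: fun_eq_iff)
    ultimately show ?vi using C D P by blast
  qed
  have v': ?vi if hyp: ?v
  proof -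
    obtain P where P: "projector P" "A \<circ> P = P \<circ> A" "left_Browder UNIV (\<lambda>x. A (x - P x) + P x)" "Riesz UNIV (A \<circ> P)"
      using hyp by blast
    note Q = proj[OF P(1,2)]
    have C: "(\<lambda>x. A (x - P x) + P x) \<in> bounded_ops UNIV"
      by (intro bounded_ops_add bounded_ops_comp[OF A] bounded_ops_minus_op bounded_ops_id) (use Q in auto)
    have D: "A \<circ> P \<in> bounded_ops UNIV" by (intro bounded_ops_comp' A) (use Q in auto)
    have "(\<lambda>x. A (x - P x) + P x) \<circ> P = P \<circ> (\<lambda>x. A (x - P x) + P x)" "(A \<circ> P) \<circ> P = P \<circ> (A \<circ> P)"
      using Q bounded_opsD(2)[of P UNIV] bounded_ops_diff[OF A] bounded_ops_diff[of P UNIV]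
      by (auto simp: fun_eq_iff)
    moreover have "A = (\<lambda>x. (A (x - P x - P (x - P x)) + P (x - P x)) + (A \<circ> P) (P x))"
      using Q bounded_ops_diff[of P UNIV] bounded_ops_diff[OF A] by (auto simp: fun_eq_iff)
    ultimately show ?vi using C D P by blast
  qed
  have vi: ?S if hyp: ?vi
  proof -
    obtain C D P where *: "C \<in> bounded_ops UNIV" "left_Browder UNIV C" "D \<in> bounded_ops UNIV" "Riesz UNIV D"
      "projector P" "C \<circ> P = P \<circ> C" "D \<circ> P = P \<circ> D" and eq: "A = (\<lambda>x. C (x - P x) + D (P x))"
      using hyp by blast
    show ?S unfolding eq by (rule Browder_Riesz_sum_imp_splitting[OF *])
  qed
  have G: "?S \<Longrightarrow> admits_GSRD A" by (rule splitting_imp_GSRD[OF A])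
  have x: "?S \<Longrightarrow> \<not> 0 islimpt left_Browder_spectrum A" by (rule splitting_imp_Browder_isolated[OF A])
  have viii: "?S \<Longrightarrow> 0 \<notin> interior (left_spectrum A)"
    using Browder_isolated_imp_left_spectrum_interior[OF A] x by blast
  have ix: "?S \<Longrightarrow> SVEP_at A 0" using Browder_isolated_imp_SVEP[OF A] x by blast
  have xi: "\<not> 0 islimpt left_Browder_spectrum A \<Longrightarrow> 0 \<notin> interior (left_Browder_spectrum A)"
    using interior_limit_point by blast
  have xii: "?S \<Longrightarrow> \<not> 0 islimpt upper_Drazin_spectrum A"
    using x islimpt_subset[OF _ upper_Drazin_spectrum_subset[OF A]] by blast
  have xiii: "\<not> 0 islimpt upper_Drazin_spectrum A \<Longrightarrow> 0 \<notin> interior (upper_Drazin_spectrum A)"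
    using interior_limit_point by blast
  have xi': "0 \<notin> interior (left_Browder_spectrum A) \<Longrightarrow> 0 \<notin> interior (upper_Drazin_spectrum A)"
    using interior_mono[OF upper_Drazin_spectrum_subset[OF A]] by blast
  have xiv: "0 \<notin> interior (left_spectrum A) \<Longrightarrow> 0 \<notin> interior (point_spectrum A)"
    using interior_mono[OF point_spectrum_subset[OF A]] by blast
  note conv = GSRD_imp_splitting[OF A]
  show ?thesis
  proof (rule all_equivalentI[where q = ?S], unfold list.set insert_iff empty_iff simp_thms, elim disjE)
    fix p
    show "p \<longleftrightarrow> ?S" if "p \<longleftrightarrow> ?i" using that i ii vii vii' by blast
    show "p \<longleftrightarrow> ?S" if "p \<longleftrightarrow> ?ii" using that i ii vii vii' by blast
    show "p \<longleftrightarrow> ?S" if "p \<longleftrightarrow> ?iii" using that unfolding left_invertible_Riesz_splitting_def by blast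
    show "p \<longleftrightarrow> ?S" if "p \<longleftrightarrow> ?iv" using that iv iv' vi by blast
    show "p \<longleftrightarrow> ?S" if "p \<longleftrightarrow> ?v" using that v v' vi by blast
    show "p \<longleftrightarrow> ?S" if "p \<longleftrightarrow> ?vi" using that v v' vi by blast
    show "p \<longleftrightarrow> ?S" if "p \<longleftrightarrow> ?vii" using that i ii vii vii' by blast
    show "p \<longleftrightarrow> ?S" if "p \<longleftrightarrow> ?viii" using that G viii xiv conv(2) by blast
    show "p \<longleftrightarrow> ?S" if "p \<longleftrightarrow> ?ix" using that G ix conv(1) by blast
    show "p \<longleftrightarrow> ?S" if "p \<longleftrightarrow> ?x" using that G x xi xi' conv(3) by blast
    show "p \<longleftrightarrow> ?S" if "p \<longleftrightarrow> ?xi" using that G x xi xi' conv(3) by blast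
    show "p \<longleftrightarrow> ?S" if "p \<longleftrightarrow> ?xii" using that G xii xiii conv(3) by blast
    show "p \<longleftrightarrow> ?S" if "p \<longleftrightarrow> ?xiii" using that G xii xiii conv(3) by blast
    show "p \<longleftrightarrow> ?S" if "p \<longleftrightarrow> ?xiv" using that G viii xiv conv(2) by blast
  qed
qed

end
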